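(* Let $D\ge2$, $m\ge2$ and $w=X_1^D+\cdots+X_m^D\in\mathrm{Sym}^D\mathbb{C}^m$. (1) If $D$ is even, then $w$ has degree period $b(w)=m$ and minimal degree $e(w)=m$. (2) If $D$ is odd, then $w$ has degree period $b(w)=2m$. If additionally $2m\le\binom{2D}{D}$, then $e(w)=2m$. (3) If $D$ is odd and $2m>\binom{2D}{D}$, then $e(w)>2m$. With $e'(w):=e(w)/b(w)$, we have $e'(w)=1$ if $D$ is even, or if $D$ is odd and $2m\le\binom{2D}{D}$; and we have $e'(w)>1$ if $D$ is odd and $2m>\binom{2D}{D}$.
   Context: Work over $\mathbb{C}$. $\mathrm{Sym}^D\mathbb{C}^m$ is the space of forms of degree $D$ in $m$ variables with the natural action of $G=\mathrm{GL}_m$. The $\mathrm{SL}_m$-orbit of $w$ is closed (i.e. $w$ is polystable). $\mathrm{stab}(w)=\{g\in\mathrm{GL}_m\mid gw=w\}$; the stabilizer period $a(w)$ is the order of the finite group $\det(\mathrm{stab}(w))\subseteq\mathbb{C}^\times$, and the degree period is $b(w):=\frac{m}{D}a(w)$. The minimal degree $e(w)$ is the smallest positive integer $d$ such that there is a nonzero $\mathrm{SL}_m$-invariant regular function on the orbit closure $\overline{Gw}$ that is homogeneous of degree $d$; it is a multiple of $b(w)$. $e'(w)=e(w)/b(w)$ is the minimal exponent. *)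

theory Defs
  imports "HOL-Analysis.Analysis" "HOL-Library.Poly_Mapping"
begin

text \<open>
  Multivariate polynomials with variables indexed by \<open>'x\<close>: finitely supported maps from
  exponent vectors to coefficients.
\<close>

type_synonym 'x monom = "'x \<Rightarrow>\<^sub>0 nat"
type_synonym ('x, 'a) mpoly = "'x monom \<Rightarrow>\<^sub>0 'a"

definition Const :: "'a::zero \<Rightarrow> ('x, 'a) mpoly" where
  "Const c = Poly_Mapping.single 0 c"

definition Var :: "'x \<Rightarrow> ('x, 'a::zero_neq_one) mpoly" where
  "Var i = Poly_Mapping.single (Poly_Mapping.single i 1) 1"

text \<open>
  \<open>insertion c x p\<close> substitutes \<open>x i\<close> for the variable \<open>i\<close>, the coefficients being sent
  to the target ring by \<open>c\<close>: the identity for evaluation, \<^const>\<open>Const\<close> for a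
  polynomial substitution.
\<close>

definition insertion ::
  "('a::zero \<Rightarrow> 'b) \<Rightarrow> ('x \<Rightarrow> 'b) \<Rightarrow> ('x, 'a) mpoly \<Rightarrow> 'b::comm_semiring_1" where
  "insertion c x p =
     (\<Sum>\<mu>\<in>Poly_Mapping.keys p. c (Poly_Mapping.lookup p \<mu>) *
        (\<Prod>i\<in>Poly_Mapping.keys \<mu>. x i ^ Poly_Mapping.lookup \<mu> i))"

text \<open>
  \<open>Sym\<^sup>D \<complex>\<^sup>m\<close> with \<open>m = CARD('n)\<close>: the basis vectors of \<open>\<complex>\<^sup>m\<close> are the variables.
\<close>

definition forms :: "nat \<Rightarrow> ('n::finite, complex) mpoly set" where
  "forms D = {f. \<forall>\<mu>\<in>Poly_Mapping.keys f. (\<Sum>i\<in>UNIV. Poly_Mapping.lookup \<mu> i) = D}"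

text \<open>
  The action induced from \<open>\<complex>\<^sup>m\<close>: \<open>g\<close> sends the \<open>i\<close>-th basis vector to the \<open>i\<close>-th column of
  its matrix. This is a left action.
\<close>

definition act ::
  "complex^'n^'n \<Rightarrow> ('n::finite, complex) mpoly \<Rightarrow> ('n, complex) mpoly" where
  "act g = insertion Const (\<lambda>i. \<Sum>j\<in>UNIV. Const (g $ j $ i) * Var j)"

definition GL :: "(complex^'n^'n::finite) set" where
  "GL = {g. invertible g}"

definition SL :: "(complex^'n^'n::finite) set" where
  "SL = {g. det g = 1}"

definition stab :: "('n::finite, complex) mpoly \<Rightarrow> (complex^'n^'n) set" where
  "stab w = {g \<in> GL. act g w = w}"

definition stabilizer_period :: "('n::finite, complex) mpoly \<Rightarrow> nat" where
  "stabilizer_period w = card (det ` stab w)"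

definition degree_period :: "nat \<Rightarrow> ('n::finite, complex) mpoly \<Rightarrow> rat" where
  "degree_period D w = of_nat CARD('n) / of_nat D * of_nat (stabilizer_period w)"

text \<open>
  Polynomial functions on the space of forms are polynomials in the coefficients, so their
  variables are indexed by monomials; on \<^term>\<open>forms D\<close> the coordinates of degree
  other than \<open>D\<close> vanish.
\<close>

definition eval_at_form ::
  "('n::finite monom, complex) mpoly \<Rightarrow> ('n, complex) mpoly \<Rightarrow> complex" where
  "eval_at_form p f = insertion (\<lambda>c. c) (Poly_Mapping.lookup f) p"

text \<open>
  The Zariski closure of the orbit. As orbits are constructible, it agrees with the closure in
  the Euclidean topology.
\<close>

definition orbit_closure ::
  "nat \<Rightarrow> ('n::finite, complex) mpoly \<Rightarrow> ('n, complex) mpoly set" where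
  "orbit_closure D w =
     {v \<in> forms D. \<forall>p. (\<forall>g\<in>GL. eval_at_form p (act g w) = 0) \<longrightarrow> eval_at_form p v = 0}"

definition regular_on ::
  "('n::finite, complex) mpoly set \<Rightarrow> (('n, complex) mpoly \<Rightarrow> complex) \<Rightarrow> bool" where
  "regular_on Z \<phi> \<longleftrightarrow> (\<exists>p. \<forall>v\<in>Z. \<phi> v = eval_at_form p v)"

text \<open>
  For \<open>D > 0\<close> and \<open>w \<in> forms D\<close> the orbit closure is stable under scaling as well as under \<^const>\<open>GL\<close>, so the
  conditions below involve only the values of \<open>\<phi>\<close> on \<open>Z\<close>.
\<close>

definition nonzero_invariant_of_degree ::
  "nat \<Rightarrow> ('n::finite, complex) mpoly set \<Rightarrow> (('n, complex) mpoly \<Rightarrow> complex) \<Rightarrow> bool" where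
  "nonzero_invariant_of_degree d Z \<phi> \<longleftrightarrow>
     regular_on Z \<phi> \<and>
     (\<forall>v\<in>Z. \<forall>t. \<phi> (Const t * v) = t ^ d * \<phi> v) \<and>
     (\<forall>v\<in>Z. \<forall>g\<in>SL. \<phi> (act g v) = \<phi> v) \<and>
     (\<exists>v\<in>Z. \<phi> v \<noteq> 0)"

text \<open>
  If no such invariant existed, the value would be unspecified; any claim about it therefore
  includes the existence of an invariant.
\<close>

definition minimal_degree :: "nat \<Rightarrow> ('n::finite, complex) mpoly \<Rightarrow> nat" where
  "minimal_degree D w =
     (LEAST d. 0 < d \<and> (\<exists>\<phi>. nonzero_invariant_of_degree d (orbit_closure D w) \<phi>))"

definition minimal_exponent :: "nat \<Rightarrow> ('n::finite, complex) mpoly \<Rightarrow> rat" where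
  "minimal_exponent D w = of_nat (minimal_degree D w) / degree_period D w"

end

theory Submission
  imports Defs "HOL-Computational_Algebra.Polynomial"
begin

text \<open>
  Write \<open>m\<close> for \<open>CARD('n)\<close> and \<open>l\<^sub>i\<close> for the columns of a matrix \<open>g\<close>. The orbit of the Fermat form
  \<open>w\<close> consists of the forms \<open>g w = \<Sum>\<^sub>i l\<^sub>i ^ D\<close>. An invariant of degree \<open>d\<close> on the orbit closure is
  determined on the orbit by its value at \<open>w\<close>: if \<open>t ^ m = det g\<close>, it multiplies that value by
  \<open>t ^ (D d)\<close>. So invariants of degree \<open>d\<close> correspond to polynomials \<open>F\<close> on forms with
  \<open>F (g w) = c det(g) ^ (D d / m)\<close> and \<open>c \<noteq> 0\<close>; density of the orbit carries such an \<open>F\<close> to the closure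
  (\<open>invariant_of_semiinvariant\<close>), and evaluation at elements of the stabilizer yields divisibility
  conditions on \<open>d\<close> (\<open>invariant_degree_dvd\<close>).

  Suitable polynomials come from the symbolic method. A bracket monomial is a product of \<open>K\<close>
  determinants (blocks) in symbolic vectors (vertices), where every vertex lies in \<open>D\<close> blocks. At
  \<open>g w\<close> it becomes the sum, over all ways to replace the vertices by columns of \<open>g\<close>, of the product of
  the determinants, hence \<open>det(g) ^ K\<close> times a signed count of colourings (\<open>bracket_polynomial\<close>).
  For even \<open>D\<close> the block of all \<open>m\<close> vertices taken \<open>D\<close> times counts \<open>m!\<close> colourings, all with
  sign 1. For odd \<open>D\<close> one takes \<open>2 D\<close> blocks and \<open>2 m\<close> vertices whose sets of blocks are \<open>m\<close>
  complementary pairs of \<open>D\<close>-sets. They can be chosen distinct if \<open>2 m\<close> is at most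
  \<open>(2 D) choose D\<close>, and then complementary vertices must receive the same colour, so all signs agree
  again (\<open>bracket_value_halves\<close>).

  If \<open>2 m > (2 D) choose D\<close> with \<open>D\<close> odd, then degree \<open>2 m\<close> is impossible. Cayley's operator
  \<open>det(\<partial>) ^ (2 D)\<close> does not annihilate \<open>det ^ (2 D)\<close> (\<open>omega_det_power\<close>), but it annihilates every
  product of \<open>2 m\<close> power sums of degree \<open>D\<close> in the columns: after expansion two of the factors meet
  the same \<open>D\<close> of the \<open>2 D\<close> determinants, and exchanging them changes the sign
  (\<open>omega_power_sum_product\<close>).

  It remains to find some invariant for odd \<open>D\<close>, and to bound the determinants on the stabilizer.
  Both follow once brackets with \<open>q D\<close> blocks and nonzero value exist for all large even \<open>q\<close>
  (\<open>large_multiples_have_invariants\<close>): comparing \<open>q\<close> and \<open>q + 2\<close> shows that the \<open>2 D\<close>-th power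
  of a determinant on the stabilizer is 1. The brackets are found by averaging. The average is the
  pairing of \<open>det ^ (q D)\<close>, as a form in each of its \<open>m\<close> rows, with \<open>w ^ q\<close>. Up to a factor, the
  pairing with \<open>w ^ q\<close> is the sum of the evaluations at the unit vectors and of a remainder that is
  a combination of evaluations at unit-length vectors with total mass \<open>O(1 / sqrt q)\<close>; this uses
  \<open>D \<ge> 3\<close>. The unit vectors alone contribute \<open>m!\<close>, and by Hadamard's inequality the remainder is
  too small to cancel that.
\<close>

section \<open>Substitution in multivariate polynomials\<close>

definition monom_val :: "('x \<Rightarrow> 'b::comm_semiring_1) \<Rightarrow> 'x monom \<Rightarrow> 'b" where
  "monom_val x \<mu> = (\<Prod>i\<in>Poly_Mapping.keys \<mu>. x i ^ Poly_Mapping.lookup \<mu> i)"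

lemma monom_val_superset:
  assumes "finite K" "Poly_Mapping.keys \<mu> \<subseteq> K"
  shows "monom_val x \<mu> = (\<Prod>i\<in>K. x i ^ Poly_Mapping.lookup \<mu> i)"
  unfolding monom_val_def
  by (rule prod.mono_neutral_left) (use assms in \<open>auto simp: in_keys_iff\<close>)

lemma monom_val_0 [simp]: "monom_val x 0 = 1"
  by (simp add: monom_val_def)

lemma monom_val_single [simp]: "monom_val x (Poly_Mapping.single i k) = x i ^ k"
  by (simp add: monom_val_def)

lemma monom_val_add: "monom_val x (\<mu> + \<nu>) = monom_val x \<mu> * monom_val x \<nu>"
proof -
  let ?K = "Poly_Mapping.keys \<mu> \<union> Poly_Mapping.keys \<nu>"
  have "monom_val x (\<mu> + \<nu>) = (\<Prod>i\<in>?K. x i ^ Poly_Mapping.lookup (\<mu> + \<nu>) i)"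
    by (rule monom_val_superset) (auto simp: Poly_Mapping.keys_add)
  also have "\<dots> = (\<Prod>i\<in>?K. x i ^ Poly_Mapping.lookup \<mu> i) * (\<Prod>i\<in>?K. x i ^ Poly_Mapping.lookup \<nu> i)"
    by (simp add: lookup_add power_add prod.distrib)
  also have "(\<Prod>i\<in>?K. x i ^ Poly_Mapping.lookup \<mu> i) = monom_val x \<mu>"
    by (rule monom_val_superset [symmetric]) auto
  also have "(\<Prod>i\<in>?K. x i ^ Poly_Mapping.lookup \<nu> i) = monom_val x \<nu>"
    by (rule monom_val_superset [symmetric]) auto
  finally show ?thesis .
qed

lemma monom_val_sum: "finite X \<Longrightarrow> monom_val x (\<Sum>a\<in>X. f a) = (\<Prod>a\<in>X. monom_val x (f a))"
  by (induction X rule: finite_induct) (auto simp: monom_val_add)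

lemma insertion_eq_monom_val:
  "insertion c x p = (\<Sum>\<mu>\<in>Poly_Mapping.keys p. c (Poly_Mapping.lookup p \<mu>) * monom_val x \<mu>)"
  by (simp add: insertion_def monom_val_def)

lemma insertion_superset:
  assumes "finite K" "Poly_Mapping.keys p \<subseteq> K" "c 0 = 0"
  shows "insertion c x p = (\<Sum>\<mu>\<in>K. c (Poly_Mapping.lookup p \<mu>) * monom_val x \<mu>)"
  unfolding insertion_eq_monom_val
  by (rule sum.mono_neutral_left) (use assms in \<open>auto simp: in_keys_iff\<close>)

lemma insertion_0 [simp]: "insertion c x 0 = 0"
  by (simp add: insertion_def)

lemma insertion_single: "c 0 = 0 \<Longrightarrow> insertion c x (Poly_Mapping.single \<mu> a) = c a * monom_val x \<mu>"
  by (subst insertion_superset [of "{\<mu>}"]) auto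

lemma insertion_add:
  assumes "c 0 = 0" "\<And>a b. c (a + b) = c a + c b"
  shows "insertion c x (p + q) = insertion c x p + insertion c x q"
proof -
  let ?K = "Poly_Mapping.keys p \<union> Poly_Mapping.keys q"
  have "insertion c x (p + q) = (\<Sum>\<mu>\<in>?K. c (Poly_Mapping.lookup (p + q) \<mu>) * monom_val x \<mu>)"
    by (rule insertion_superset) (use assms in \<open>auto simp: Poly_Mapping.keys_add\<close>)
  also have "\<dots> = (\<Sum>\<mu>\<in>?K. c (Poly_Mapping.lookup p \<mu>) * monom_val x \<mu>) +
                   (\<Sum>\<mu>\<in>?K. c (Poly_Mapping.lookup q \<mu>) * monom_val x \<mu>)"
    by (simp add: lookup_add assms distrib_right sum.distrib)
  also have "(\<Sum>\<mu>\<in>?K. c (Poly_Mapping.lookup p \<mu>) * monom_val x \<mu>) = insertion c x p"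
    by (rule insertion_superset [symmetric]) (use assms in auto)
  also have "(\<Sum>\<mu>\<in>?K. c (Poly_Mapping.lookup q \<mu>) * monom_val x \<mu>) = insertion c x q"
    by (rule insertion_superset [symmetric]) (use assms in auto)
  finally show ?thesis .
qed

lemma insertion_sum:
  assumes "c 0 = 0" "\<And>a b. c (a + b) = c a + c b" "finite X"
  shows "insertion c x (\<Sum>a\<in>X. f a) = (\<Sum>a\<in>X. insertion c x (f a))"
  using assms(3)
  by (induction X rule: finite_induct) (auto simp: insertion_add assms)

lemma poly_mapping_eq_sum_single:
  "p = (\<Sum>\<mu>\<in>Poly_Mapping.keys p. Poly_Mapping.single \<mu> (Poly_Mapping.lookup p \<mu>))"
proof (rule poly_mapping_eqI)
  fix k
  have "(\<Sum>\<mu>\<in>Poly_Mapping.keys p. Poly_Mapping.lookup (Poly_Mapping.single \<mu> (Poly_Mapping.lookup p \<mu>)) k)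
     = (\<Sum>\<mu>\<in>Poly_Mapping.keys p. if \<mu> = k then Poly_Mapping.lookup p k else 0)"
    by (rule sum.cong) (auto simp: lookup_single)
  also have "\<dots> = Poly_Mapping.lookup p k"
    by (auto simp: in_keys_iff)
  finally show "Poly_Mapping.lookup p k =
      Poly_Mapping.lookup (\<Sum>\<mu>\<in>Poly_Mapping.keys p. Poly_Mapping.single \<mu> (Poly_Mapping.lookup p \<mu>)) k"
    by (simp add: lookup_sum)
qed

text \<open>
  The coefficient map is an arbitrary homomorphism because two of them occur: the identity for the
  evaluation of a polynomial function at a form, and \<^const>\<open>Const\<close> for the action of a matrix.
\<close>

lemma insertion_mult:
  fixes c :: "'a::comm_semiring_1 \<Rightarrow> 'b::comm_semiring_1"
  assumes c: "c 0 = 0" "\<And>a b. c (a + b) = c a + c b" "\<And>a b. c (a * b) = c a * c b"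
  shows "insertion c x (p * q) = insertion c x p * insertion c x q"
proof -
  have "p * q = (\<Sum>\<mu>\<in>Poly_Mapping.keys p. \<Sum>\<nu>\<in>Poly_Mapping.keys q.
      Poly_Mapping.single (\<mu> + \<nu>) (Poly_Mapping.lookup p \<mu> * Poly_Mapping.lookup q \<nu>))"
    by (simp flip: mult_single sum_product poly_mapping_eq_sum_single)
  also have "insertion c x \<dots> = (\<Sum>\<mu>\<in>Poly_Mapping.keys p. \<Sum>\<nu>\<in>Poly_Mapping.keys q.
      (c (Poly_Mapping.lookup p \<mu>) * monom_val x \<mu>) * (c (Poly_Mapping.lookup q \<nu>) * monom_val x \<nu>))"
    by (simp add: insertion_sum insertion_single c monom_val_add algebra_simps)
  also have "\<dots> = insertion c x p * insertion c x q"
    by (simp add: insertion_eq_monom_val sum_product)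
  finally show ?thesis .
qed

lemma Const_0 [simp]: "Const 0 = 0" by (simp add: Const_def)
lemma Const_1 [simp]: "Const 1 = 1" by (simp add: Const_def)
lemma Const_add: "Const (a + b) = Const a + Const b" by (simp add: Const_def single_add)
lemma Const_mult: "Const (a * b) = Const a * Const b" by (simp add: Const_def mult_single)
lemma Const_sum: "Const (\<Sum>i\<in>X. f i) = (\<Sum>i\<in>X. Const (f i))"
  by (induction X rule: infinite_finite_induct) (auto simp: Const_add)
lemma Const_power: "Const (a ^ k) = Const a ^ k"
  by (induction k) (auto simp: Const_mult)
lemma Const_prod: "Const (\<Prod>i\<in>X. f i) = (\<Prod>i\<in>X. Const (f i))"
  by (induction X rule: infinite_finite_induct) (auto simp: Const_mult)

lemma lookup_Const_mult: "Poly_Mapping.lookup (Const c * p) \<mu> = c * Poly_Mapping.lookup p \<mu>"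
  unfolding Const_def mult_map_scale_conv_mult [symmetric]
  by (simp add: Poly_Mapping.map.rep_eq when_def)

lemma act_sum: "finite X \<Longrightarrow> act g (\<Sum>a\<in>X. f a) = (\<Sum>a\<in>X. act g (f a))"
  unfolding act_def by (rule insertion_sum) (auto simp: Const_add)

lemma act_mult: "act g (p * q) = act g p * act g q"
  unfolding act_def by (rule insertion_mult) (auto simp: Const_add Const_mult)

lemma act_Const [simp]: "act g (Const c) = Const c"
  unfolding act_def by (subst Const_def) (simp add: insertion_single)

lemma act_power: "act g (p ^ k) = act g p ^ k"
  using act_Const [of g 1] by (induction k) (auto simp: act_mult)

lemma act_Var: "act g (Var i) = (\<Sum>j\<in>UNIV. Const (g $ j $ i) * Var j)"
  unfolding act_def Var_def by (simp add: insertion_single)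

definition fermat :: "nat \<Rightarrow> ('n::finite, complex) mpoly" where
  "fermat D = (\<Sum>i\<in>UNIV. Var i ^ D)"

definition column_form :: "complex^'n^'n \<Rightarrow> 'n \<Rightarrow> ('n::finite, complex) mpoly" where
  "column_form g i = (\<Sum>j\<in>UNIV. Const (g $ j $ i) * Var j)"

text \<open>
  The proof sees the orbit only through this formula: its points are the sums of \<open>D\<close>-th powers of
  the columns of a matrix.
\<close>

lemma act_fermat: "act g (fermat D) = (\<Sum>i\<in>UNIV. column_form g i ^ D)"
  by (simp add: fermat_def act_sum act_power act_Var column_form_def)

lemma act_column_form: "act g (column_form h i) = column_form (g ** h) i"
proof -
  have "act g (column_form h i) = (\<Sum>j\<in>UNIV. Const (h $ j $ i) * (\<Sum>k\<in>UNIV. Const (g $ k $ j) * Var k))"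
    by (simp add: column_form_def act_sum act_mult act_Var)
  also have "\<dots> = (\<Sum>j\<in>UNIV. \<Sum>k\<in>UNIV. Const (g $ k $ j * h $ j $ i) * Var k)"
    by (simp add: sum_distrib_left Const_mult mult_ac)
  also have "\<dots> = (\<Sum>k\<in>UNIV. \<Sum>j\<in>UNIV. Const (g $ k $ j * h $ j $ i) * Var k)"
    by (rule sum.swap)
  also have "\<dots> = column_form (g ** h) i"
    by (simp add: column_form_def matrix_matrix_mult_def Const_sum sum_distrib_right)
  finally show ?thesis .
qed

lemma act_act_fermat: "act g (act h (fermat D)) = act (g ** h) (fermat D)"
  by (simp add: act_fermat act_sum act_power act_column_form)

lemma column_form_mat1: "column_form (mat 1) i = Var i"
proof -
  have "column_form (mat 1) i = (\<Sum>j\<in>UNIV. if j = i then Var j else 0)"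
    unfolding column_form_def by (rule sum.cong) (auto simp: mat_def)
  thus ?thesis by simp
qed

lemma act_mat1_fermat: "act (mat 1) (fermat D) = fermat D"
  by (simp add: act_fermat column_form_mat1) (simp add: fermat_def)

lemma column_form_scale: "column_form (\<chi> i j. t * g $ i $ j) i = Const t * column_form g i"
  by (simp add: column_form_def Const_mult sum_distrib_left mult_ac)

lemma act_scale_fermat: "act (\<chi> i j. t * g $ i $ j) (fermat D) = Const (t ^ D) * act g (fermat D)"
  by (simp add: act_fermat column_form_scale power_mult_distrib Const_power sum_distrib_left)

section \<open>Polynomial functions on forms and the orbit closure\<close>

definition monom_degree :: "'x monom \<Rightarrow> nat" where
  "monom_degree \<mu> = (\<Sum>i\<in>Poly_Mapping.keys \<mu>. Poly_Mapping.lookup \<mu> i)"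

lemma monom_degree_superset:
  assumes "finite K" "Poly_Mapping.keys \<mu> \<subseteq> K"
  shows "monom_degree \<mu> = (\<Sum>i\<in>K. Poly_Mapping.lookup \<mu> i)"
  unfolding monom_degree_def
  by (rule sum.mono_neutral_left) (use assms in \<open>auto simp: in_keys_iff\<close>)

lemma monom_degree_UNIV:
  fixes \<mu> :: "'x::finite monom"
  shows "monom_degree \<mu> = (\<Sum>i\<in>UNIV. Poly_Mapping.lookup \<mu> i)"
  by (rule monom_degree_superset) auto

lemma monom_degree_add: "monom_degree (\<mu> + \<nu>) = monom_degree \<mu> + monom_degree \<nu>"
proof -
  let ?K = "Poly_Mapping.keys \<mu> \<union> Poly_Mapping.keys \<nu>"
  have "monom_degree (\<mu> + \<nu>) = (\<Sum>i\<in>?K. Poly_Mapping.lookup (\<mu> + \<nu>) i)"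
    by (rule monom_degree_superset) (auto simp: Poly_Mapping.keys_add)
  also have "\<dots> = (\<Sum>i\<in>?K. Poly_Mapping.lookup \<mu> i) + (\<Sum>i\<in>?K. Poly_Mapping.lookup \<nu> i)"
    by (simp add: lookup_add sum.distrib)
  also have "(\<Sum>i\<in>?K. Poly_Mapping.lookup \<mu> i) = monom_degree \<mu>"
    by (rule monom_degree_superset [symmetric]) auto
  also have "(\<Sum>i\<in>?K. Poly_Mapping.lookup \<nu> i) = monom_degree \<nu>"
    by (rule monom_degree_superset [symmetric]) auto
  finally show ?thesis .
qed

lemma monom_degree_0 [simp]: "monom_degree 0 = 0"
  by (simp add: monom_degree_def)

lemma monom_degree_single [simp]: "monom_degree (Poly_Mapping.single i k) = k"
  by (simp add: monom_degree_def)

lemma forms_altdef: "forms D = {f. \<forall>\<mu>\<in>Poly_Mapping.keys f. monom_degree \<mu> = D}"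
  by (simp add: forms_def monom_degree_UNIV)

text \<open>
  Monomials are written as words. Positions of a word can be summed over one at a time and can be
  permuted, which exponent vectors do not allow.
\<close>

definition word_monom :: "'a set \<Rightarrow> ('a \<Rightarrow> 'x) \<Rightarrow> 'x monom" where
  "word_monom X u = (\<Sum>x\<in>X. Poly_Mapping.single (u x) 1)"

lemma monom_val_word: "finite X \<Longrightarrow> monom_val f (word_monom X u) = (\<Prod>x\<in>X. f (u x))"
  by (simp add: word_monom_def monom_val_sum)

lemma monom_degree_word: "finite X \<Longrightarrow> monom_degree (word_monom X u) = card X"
  unfolding word_monom_def
  by (induction X rule: finite_induct) (auto simp: monom_degree_add)

lemma word_monom_cong: "(\<And>x. x \<in> X \<Longrightarrow> u x = v x) \<Longrightarrow> word_monom X u = word_monom X v"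
  unfolding word_monom_def by (rule sum.cong) auto

lemma monom_eq_word:
  assumes "monom_degree \<mu> = N"
  shows "\<exists>u. \<mu> = word_monom {..<N} u"
  using assms
proof (induction N arbitrary: \<mu>)
  case 0
  hence "\<mu> = 0"
    by (intro poly_mapping_eqI) (auto simp: monom_degree_def in_keys_iff)
  thus ?case by (auto simp: word_monom_def)
next
  case (Suc N)
  have "\<exists>i. Poly_Mapping.lookup \<mu> i > 0"
  proof (rule ccontr)
    assume "\<not> ?thesis"
    hence "\<mu> = 0" by (intro poly_mapping_eqI) auto
    with Suc.prems show False by simp
  qed
  then obtain i where i: "Poly_Mapping.lookup \<mu> i > 0" ..
  define \<nu> where "\<nu> = \<mu> - Poly_Mapping.single i 1"
  have \<mu>: "\<mu> = \<nu> + Poly_Mapping.single i 1"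
    by (rule poly_mapping_eqI) (use i in \<open>auto simp: \<nu>_def lookup_add lookup_minus lookup_single when_def\<close>)
  have "monom_degree \<nu> = N"
    using Suc.prems unfolding \<mu> by (simp add: monom_degree_add)
  then obtain u where u: "\<nu> = word_monom {..<N} u" using Suc.IH by blast
  have "\<mu> = word_monom {..<Suc N} (u(N := i))"
    unfolding \<mu> u word_monom_def by (simp add: lessThan_Suc add.commute)
  thus ?case by blast
qed

lemma prod_Var: "finite X \<Longrightarrow> (\<Prod>x\<in>X. Var (u x)) = Poly_Mapping.single (word_monom X u) (1::'a::comm_semiring_1)"
  unfolding word_monom_def Var_def
  by (induction X rule: finite_induct) (auto simp: mult_single)

abbreviation words :: "nat \<Rightarrow> (nat \<Rightarrow> 'n) set" where
  "words D \<equiv> {..<D} \<rightarrow>\<^sub>E UNIV"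

text \<open>
  The multinomial coefficient of a monomial of degree \<open>D\<close>, and \<open>0\<close> in all other degrees.
\<close>

definition word_count :: "nat \<Rightarrow> 'n monom \<Rightarrow> nat" where
  "word_count D \<mu> = card {v \<in> words D. word_monom {..<D} v = \<mu>}"

lemma finite_words [simp]: "finite (words D :: (nat \<Rightarrow> 'n::finite) set)"
  by (intro finite_PiE) auto

lemma restrict_in_words [simp]: "restrict u {..<D} \<in> words D"
  by (auto simp: PiE_def extensional_def)

lemma column_form_power:
  "column_form g i ^ D = (\<Sum>v\<in>words D. Poly_Mapping.single (word_monom {..<D} v) (\<Prod>r<D. g $ v r $ i))"
proof -
  have "column_form g i ^ D = (\<Prod>r<D. \<Sum>j\<in>UNIV. Const (g $ j $ i) * Var j)"
    by (simp add: column_form_def)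
  also have "\<dots> = (\<Sum>v\<in>words D. \<Prod>r<D. Const (g $ v r $ i) * Var (v r))"
    by (rule prod_sum_PiE) auto
  also have "\<dots> = (\<Sum>v\<in>words D. Poly_Mapping.single (word_monom {..<D} v) (\<Prod>r<D. g $ v r $ i))"
    by (simp add: prod.distrib prod_Var Const_prod [symmetric]) (simp add: Const_def mult_single)
  finally show ?thesis .
qed

text \<open>
  Up to multinomial coefficients, the coordinates of a point of the orbit are the power sums of
  degree \<open>D\<close> in the columns. Constructions and obstructions below are both expressed in them.
\<close>

lemma lookup_act_fermat:
  "Poly_Mapping.lookup (act g (fermat D)) \<mu> =
     of_nat (word_count D \<mu>) * (\<Sum>i\<in>UNIV. monom_val (\<lambda>j. g $ j $ i) \<mu>)"
proof -
  have "Poly_Mapping.lookup (column_form g i ^ D) \<mu> =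
      of_nat (word_count D \<mu>) * monom_val (\<lambda>j. g $ j $ i) \<mu>" for i
  proof -
    have eq: "Poly_Mapping.lookup (Poly_Mapping.single (word_monom {..<D} v) (\<Prod>r<D. g $ v r $ i)) \<mu> =
        (if word_monom {..<D} v = \<mu> then monom_val (\<lambda>j. g $ j $ i) \<mu> else 0)" for v
      using monom_val_word [of "{..<D}" "\<lambda>j. g $ j $ i" v] by (auto simp: lookup_single when_def)
    show ?thesis
      unfolding column_form_power lookup_sum eq
      by (subst sum.inter_filter [symmetric]) (simp_all add: word_count_def)
  qed
  thus ?thesis by (simp add: act_fermat lookup_sum sum_distrib_left)
qed

lemma word_count_pos:
  fixes \<mu> :: "'n::finite monom"
  assumes "monom_degree \<mu> = D"
  shows "word_count D \<mu> > 0"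
proof -
  obtain u where u: "\<mu> = word_monom {..<D} u" using monom_eq_word [OF assms] by blast
  have "restrict u {..<D} \<in> {v \<in> words D. word_monom {..<D} v = \<mu>}"
    unfolding u using word_monom_cong [of "{..<D}" "restrict u {..<D}" u] by simp
  moreover have "finite {v \<in> words D. word_monom {..<D} v = \<mu>}" by simp
  ultimately show ?thesis unfolding word_count_def card_gt_0_iff by (intro conjI notI) blast+
qed

lemma word_count_eq_0: "monom_degree \<mu> \<noteq> D \<Longrightarrow> word_count D \<mu> = 0"
proof -
  assume "monom_degree \<mu> \<noteq> D"
  hence "{v \<in> words D. word_monom {..<D} v = \<mu>} = {}"
    using monom_degree_word [of "{..<D}"] by auto
  thus ?thesis unfolding word_count_def by (simp only: card.empty)
qed

lemma act_fermat_in_forms: "act g (fermat D) \<in> forms D"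
proof -
  have "monom_degree \<mu> = D" if "\<mu> \<in> Poly_Mapping.keys (act g (fermat D))" for \<mu>
    using that word_count_eq_0 [of \<mu> D] by (auto simp: in_keys_iff lookup_act_fermat)
  thus ?thesis by (simp add: forms_altdef)
qed

lemma finite_monoms_of_degree: "finite {\<mu> :: 'n::finite monom. monom_degree \<mu> = D}"
proof (rule finite_subset)
  show "{\<mu> :: 'n monom. monom_degree \<mu> = D} \<subseteq> word_monom {..<D} ` words D"
  proof
    fix \<mu> :: "'n monom" assume "\<mu> \<in> {\<mu>. monom_degree \<mu> = D}"
    then obtain u where u: "\<mu> = word_monom {..<D} u" using monom_eq_word by blast
    have "\<mu> = word_monom {..<D} (restrict u {..<D})" unfolding u by (rule word_monom_cong) auto
    thus "\<mu> \<in> word_monom {..<D} ` words D" using restrict_in_words [of u D] by blast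
  qed
qed auto

definition polynomial_fun :: "(('n::finite, complex) mpoly \<Rightarrow> complex) \<Rightarrow> bool" where
  "polynomial_fun F \<longleftrightarrow> (\<exists>p. \<forall>f. F f = eval_at_form p f)"

lemma polynomial_fun_const [simp]: "polynomial_fun (\<lambda>f. c)"
  unfolding polynomial_fun_def eval_at_form_def
  by (rule exI [of _ "Const c"]) (simp add: Const_def insertion_single)

lemma polynomial_fun_lookup [simp]: "polynomial_fun (\<lambda>f. Poly_Mapping.lookup f \<mu>)"
  unfolding polynomial_fun_def eval_at_form_def
  by (rule exI [of _ "Var \<mu>"]) (simp add: Var_def insertion_single)

lemma polynomial_fun_add:
  "polynomial_fun F \<Longrightarrow> polynomial_fun G \<Longrightarrow> polynomial_fun (\<lambda>f. F f + G f)"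
  unfolding polynomial_fun_def eval_at_form_def
  by (elim exE, rule_tac x = "p + pa" in exI) (simp add: insertion_add)

lemma polynomial_fun_mult:
  "polynomial_fun F \<Longrightarrow> polynomial_fun G \<Longrightarrow> polynomial_fun (\<lambda>f. F f * G f)"
  unfolding polynomial_fun_def eval_at_form_def
  by (elim exE, rule_tac x = "p * pa" in exI) (simp add: insertion_mult)

lemma polynomial_fun_diff:
  "polynomial_fun F \<Longrightarrow> polynomial_fun G \<Longrightarrow> polynomial_fun (\<lambda>f. F f - G f)"
  using polynomial_fun_add [of F "\<lambda>f. (-1) * G f"] polynomial_fun_mult [of "\<lambda>f. -1" G] by simp

lemma polynomial_fun_sum:
  "(\<And>a. a \<in> X \<Longrightarrow> polynomial_fun (F a)) \<Longrightarrow> polynomial_fun (\<lambda>f. \<Sum>a\<in>X. F a f)"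
  by (induction X rule: infinite_finite_induct) (auto intro: polynomial_fun_add)

lemma polynomial_fun_prod:
  "(\<And>a. a \<in> X \<Longrightarrow> polynomial_fun (F a)) \<Longrightarrow> polynomial_fun (\<lambda>f. \<Prod>a\<in>X. F a f)"
  by (induction X rule: infinite_finite_induct) (auto intro: polynomial_fun_mult)

lemma polynomial_fun_power: "polynomial_fun F \<Longrightarrow> polynomial_fun (\<lambda>f. F f ^ k)"
  by (induction k) (auto intro: polynomial_fun_mult)

text \<open>
  The restriction to a fixed degree makes the coordinates of \<open>act g f\<close> finite linear combinations,
  with fixed coefficients, of those of \<open>f\<close>.
\<close>

lemma polynomial_fun_act:
  assumes "polynomial_fun F"
  obtains G where "polynomial_fun G" "\<And>f. f \<in> forms D \<Longrightarrow> F (act g f) = G f"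
proof -
  from assms obtain p where p: "\<And>f. F f = eval_at_form p f" by (auto simp: polynomial_fun_def)
  define E where "E = {\<mu> :: 'a monom. monom_degree \<mu> = D}"
  define y where "y = (\<lambda>\<nu>. monom_val (\<lambda>i. \<Sum>j\<in>UNIV. Const (g $ j $ i) * Var j) \<nu> :: ('a, complex) mpoly)"
  define H where "H = (\<lambda>\<mu> f. \<Sum>\<nu>\<in>E. Poly_Mapping.lookup f \<nu> * Poly_Mapping.lookup (y \<nu>) \<mu>)"
  define G where "G = (\<lambda>f. \<Sum>M\<in>Poly_Mapping.keys p. Poly_Mapping.lookup p M *
    (\<Prod>\<mu>\<in>Poly_Mapping.keys M. H \<mu> f ^ Poly_Mapping.lookup M \<mu>))"
  have "polynomial_fun G"
    unfolding G_def H_def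
    by (intro polynomial_fun_sum polynomial_fun_mult polynomial_fun_prod polynomial_fun_power
        polynomial_fun_const polynomial_fun_lookup)
  moreover have "F (act g f) = G f" if "f \<in> forms D" for f
  proof -
    have "act g f = (\<Sum>\<nu>\<in>E. Const (Poly_Mapping.lookup f \<nu>) * y \<nu>)"
      unfolding act_def y_def
      by (rule insertion_superset) (use that in \<open>auto simp: E_def forms_altdef finite_monoms_of_degree\<close>)
    hence "Poly_Mapping.lookup (act g f) = (\<lambda>\<mu>. H \<mu> f)"
      by (simp add: fun_eq_iff lookup_sum lookup_Const_mult H_def)
    thus ?thesis by (simp add: p eval_at_form_def insertion_def G_def)
  qed
  ultimately show ?thesis using that by blast
qed

lemma orbit_closure_density:
  assumes "polynomial_fun F" "\<And>g. g \<in> GL \<Longrightarrow> F (act g w) = 0" "v \<in> orbit_closure D w"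
  shows "F v = 0"
  using assms by (auto simp: polynomial_fun_def orbit_closure_def)

lemma act_fermat_in_orbit_closure: "g \<in> GL \<Longrightarrow> act g (fermat D) \<in> orbit_closure D (fermat D)"
  by (auto simp: orbit_closure_def act_fermat_in_forms)

lemma GL_iff: "g \<in> GL \<longleftrightarrow> det g \<noteq> (0::complex)"
  by (simp add: GL_def invertible_det_nz)

text \<open>
  Both sides of the equation that expresses invariance are polynomial functions on forms, so it
  suffices to compare them on the orbit, where the exponent of the determinant makes them equal.
\<close>

lemma invariant_of_semiinvariant:
  fixes F :: "('n::finite, complex) mpoly \<Rightarrow> complex"
  assumes F: "polynomial_fun F" "\<And>t f. F (Const t * f) = t ^ d * F f"
    and semi: "\<And>g. F (act g (fermat D)) = det g ^ b * z" and z: "z \<noteq> 0"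
  shows "nonzero_invariant_of_degree d (orbit_closure D (fermat D)) F"
  unfolding nonzero_invariant_of_degree_def
proof (intro conjI ballI allI)
  show "regular_on (orbit_closure D (fermat D)) F"
    using F(1) by (auto simp: polynomial_fun_def regular_on_def)
  show "\<exists>v\<in>orbit_closure D (fermat D). F v \<noteq> 0"
    using semi [of "mat 1"] z act_fermat_in_orbit_closure [of "mat 1" D] by (force simp: GL_iff)
next
  fix v :: "('n, complex) mpoly" and g :: "complex^'n^'n"
  assume v: "v \<in> orbit_closure D (fermat D)" and g: "g \<in> SL"
  obtain G where G: "polynomial_fun G" "\<And>f. f \<in> forms D \<Longrightarrow> F (act g f) = G f"
    using polynomial_fun_act [OF F(1)] by blast
  have "G v - F v = 0"
  proof (rule orbit_closure_density [OF polynomial_fun_diff [OF G(1) F(1)] _ v])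
    fix h :: "complex^'n^'n" assume "h \<in> GL"
    show "G (act h (fermat D)) - F (act h (fermat D)) = 0"
      using g by (simp flip: G(2) add: act_fermat_in_forms act_act_fermat semi det_mul SL_def)
  qed
  moreover have "F (act g v) = G v" using v G(2) by (auto simp: orbit_closure_def)
  ultimately show "F (act g v) = F v" by simp
qed (use F in auto)

section \<open>Bracket polynomials on the orbit\<close>

text \<open>
  The sign of \<open>x\<close> if \<open>x\<close> is a permutation, and \<open>0\<close> otherwise. Being a determinant, it records how a
  determinant changes when its columns are selected by \<open>x\<close>.
\<close>

definition index_det :: "('n::finite \<Rightarrow> 'n) \<Rightarrow> complex" where
  "index_det x = det (\<chi> i t. if x i = t then 1 else 0)"

lemma det_select_columns:
  fixes A :: "complex^'n^'n::finite"
  shows "det (\<chi> i t. A $ t $ (x i)) = index_det x * det A"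
proof -
  have "(\<chi> i t. A $ t $ (x i)) = (\<chi> i t. if x i = t then 1 else 0) ** transpose A"
    by (simp add: matrix_matrix_mult_def transpose_def vec_eq_iff if_distrib [of "\<lambda>z. z * _"] cong: if_cong)
  thus ?thesis by (simp add: det_mul det_transpose index_det_def)
qed

lemma index_det_not_inj:
  assumes "\<not> inj x"
  shows "index_det x = 0"
proof -
  from assms obtain i j where "i \<noteq> j" "x i = x j" by (auto simp: inj_def)
  thus ?thesis unfolding index_det_def
    by (intro det_identical_rows [of i j]) (auto simp: row_def vec_eq_iff)
qed

lemma index_det_expand:
  "index_det x = (\<Sum>p\<in>{p. p permutes UNIV}. of_int (sign p) * (if \<forall>i. x i = p i then 1 else 0))"
  unfolding index_det_def det_def
  by (intro sum.cong refl) (auto simp: prod_zero_iff intro!: prod.neutral)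

lemma index_det_permutes:
  assumes "p permutes UNIV"
  shows "index_det p = of_int (sign p)"
proof -
  have "index_det p = (\<Sum>q\<in>{q. q permutes UNIV}. if q = p then of_int (sign q) else 0)"
    unfolding index_det_expand by (rule sum.cong) (auto simp: fun_eq_iff)
  also have "\<dots> = of_int (sign p)" using assms by (simp add: finite_permutations)
  finally show ?thesis .
qed

lemma inj_permutes_UNIV: "inj (x :: 'n::finite \<Rightarrow> 'n) \<longleftrightarrow> x permutes UNIV"
proof
  assume x: "inj x"
  hence "bij x" by (simp add: bij_def finite_UNIV_inj_surj)
  thus "x permutes UNIV" by (intro bij_imp_permutes) auto
qed (rule permutes_inj)

lemma index_det_permute_arg:
  assumes "a \<noteq> b"
  shows "index_det (\<lambda>i. x (Transposition.transpose a b i)) = - index_det x"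
proof (cases "inj x")
  case True
  hence x: "x permutes UNIV" by (simp add: inj_permutes_UNIV)
  have t: "Transposition.transpose a b permutes UNIV" by (simp add: permutes_swap_id)
  have "index_det (x \<circ> Transposition.transpose a b) = of_int (sign (x \<circ> Transposition.transpose a b))"
    by (rule index_det_permutes [OF permutes_compose [OF t x]])
  also have "sign (x \<circ> Transposition.transpose a b) = - sign x"
  proof -
    have "permutation x" "permutation (Transposition.transpose a b)"
      using x t by (auto simp: permutation_permutes intro: exI [of _ UNIV])
    thus ?thesis using assms by (simp add: sign_compose sign_swap_id)
  qed
  finally show ?thesis using x by (simp add: index_det_permutes o_def)
next
  case False
  have "\<not> inj (\<lambda>i. x (Transposition.transpose a b i))"
  proof
    assume *: "inj (\<lambda>i. x (Transposition.transpose a b i))"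
    have "x = (\<lambda>i. x (Transposition.transpose a b i)) \<circ> Transposition.transpose a b" by (auto simp: fun_eq_iff)
    moreover have "inj ((\<lambda>i. x (Transposition.transpose a b i)) \<circ> Transposition.transpose a b)"
      by (rule inj_compose [OF * inj_transpose])
    ultimately have "inj x" by metis
    with False show False by simp
  qed
  thus ?thesis using False by (simp add: index_det_not_inj)
qed

lemma index_det_id: "index_det (\<lambda>i. i) = 1"
  using index_det_permutes [OF permutes_id] by (simp add: id_def sign_id)

lemma index_det_even_power:
  assumes "even k" "k > 0"
  shows "index_det x ^ k = (if x permutes UNIV then 1 else 0)"
proof (cases "x permutes UNIV")
  case True
  thus ?thesis using assms by (auto simp: index_det_permutes sign_def)
next
  case False
  thus ?thesis using assms by (simp add: index_det_not_inj inj_permutes_UNIV)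
qed

lemma sum_index_det_even_power:
  assumes "even k" "k > 0"
  shows "(\<Sum>x\<in>(UNIV :: ('n::finite \<Rightarrow> 'n) set). index_det x ^ k) = fact CARD('n)"
proof -
  have "(\<Sum>x\<in>(UNIV :: ('n \<Rightarrow> 'n) set). index_det x ^ k) = of_nat (card {p :: 'n \<Rightarrow> 'n. p permutes UNIV})"
    by (simp add: index_det_even_power assms sum.If_cases)
  also have "card {p :: 'n \<Rightarrow> 'n. p permutes UNIV} = fact CARD('n)"
    by (rule card_permutations) auto
  finally show ?thesis by simp
qed

text \<open>
  The value of a bracket monomial at the Fermat form: block \<open>j\<close> is the determinant of the symbolic
  vectors \<open>S j i\<close>, and on a sum of \<open>m\<close> powers each vertex is replaced by one of the \<open>m\<close> linear
  forms, its colour \<open>k v\<close>.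
\<close>

definition bracket_value :: "'j set \<Rightarrow> 'v set \<Rightarrow> ('j \<Rightarrow> 'n::finite \<Rightarrow> 'v) \<Rightarrow> complex" where
  "bracket_value J V S = (\<Sum>k\<in>V \<rightarrow>\<^sub>E UNIV. \<Prod>j\<in>J. index_det (\<lambda>i. k (S j i)))"

text \<open>
  Expand all determinants of the columns chosen by a colouring. Every vertex occurs at exactly \<open>D\<close>
  places, so the sum over its colour turns the factors that belong to it into a power sum of degree
  \<open>D\<close>, which is a coordinate of \<open>g w\<close> up to a constant.
\<close>

lemma bracket_polynomial:
  fixes S :: "'j \<Rightarrow> 'n::finite \<Rightarrow> 'v"
  assumes fin: "finite J" "finite V" and S: "\<And>j i. j \<in> J \<Longrightarrow> S j i \<in> V"
    and deg: "\<And>v. v \<in> V \<Longrightarrow> card {p \<in> J \<times> UNIV. S (fst p) (snd p) = v} = D"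
  obtains F :: "('n, complex) mpoly \<Rightarrow> complex" where "polynomial_fun F" "\<And>t f. F (Const t * f) = t ^ card V * F f"
    "\<And>g. F (act g (fermat D)) = det g ^ card J * bracket_value J V S"
proof -
  define fib where "fib = (\<lambda>v. {p \<in> J \<times> UNIV. S (fst p) (snd p) = v})"
  define P where "P = {p :: 'n \<Rightarrow> 'n. p permutes UNIV}"
  have finP: "finite P" unfolding P_def by (rule finite_permutations) simp
  have fin_fib: "finite (fib v)" for v using fin by (auto simp: fib_def)
  define \<mu> where "\<mu> = (\<lambda>\<sigma> v. word_monom (fib v) (\<lambda>p. (\<sigma> :: 'j \<Rightarrow> 'n \<Rightarrow> 'n) (fst p) (snd p)))"
  define F where "F = (\<lambda>f. \<Sum>\<sigma>\<in>J \<rightarrow>\<^sub>E P. (\<Prod>j\<in>J. of_int (sign (\<sigma> j))) *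
     (\<Prod>v\<in>V. Poly_Mapping.lookup f (\<mu> \<sigma> v) * (1 / of_nat (word_count D (\<mu> \<sigma> v)))) :: complex)"
  have "polynomial_fun F"
    unfolding F_def
    by (intro polynomial_fun_sum polynomial_fun_mult polynomial_fun_prod polynomial_fun_const polynomial_fun_lookup)
  moreover have "F (Const t * f) = t ^ card V * F f" for t f
    unfolding F_def lookup_Const_mult sum_distrib_left prod.distrib by (simp add: algebra_simps)
  moreover have "F (act g (fermat D)) = det g ^ card J * bracket_value J V S" for g
  proof -
    let ?h = "\<lambda>\<sigma> k p. g $ ((\<sigma> :: 'j \<Rightarrow> 'n \<Rightarrow> 'n) (fst p) (snd p)) $ (k (S (fst p) (snd p)))"
    have fibre: "Poly_Mapping.lookup (act g (fermat D)) (\<mu> \<sigma> v) * (1 / of_nat (word_count D (\<mu> \<sigma> v))) =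
        (\<Sum>c\<in>UNIV. \<Prod>p\<in>fib v. g $ (\<sigma> (fst p) (snd p)) $ c)" if "v \<in> V" for \<sigma> v
    proof -
      have "monom_degree (\<mu> \<sigma> v) = D"
        using deg [OF that] fin_fib by (simp add: \<mu>_def monom_degree_word) (simp add: fib_def)
      from word_count_pos [OF this] show ?thesis
        by (simp add: lookup_act_fermat) (simp add: \<mu>_def monom_val_word fin_fib)
    qed
    have "F (act g (fermat D)) = (\<Sum>\<sigma>\<in>J \<rightarrow>\<^sub>E P. (\<Prod>j\<in>J. of_int (sign (\<sigma> j))) *
       (\<Prod>v\<in>V. \<Sum>c\<in>UNIV. \<Prod>p\<in>fib v. g $ (\<sigma> (fst p) (snd p)) $ c))"
      unfolding F_def using fibre by (intro sum.cong arg_cong2 [of _ _ _ _ "(*)"] prod.cong refl)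
    also have "\<dots> = (\<Sum>\<sigma>\<in>J \<rightarrow>\<^sub>E P. (\<Prod>j\<in>J. of_int (sign (\<sigma> j))) *
       (\<Sum>k\<in>V \<rightarrow>\<^sub>E UNIV. \<Prod>v\<in>V. \<Prod>p\<in>fib v. g $ (\<sigma> (fst p) (snd p)) $ (k v)))"
      by (subst prod_sum_PiE) (use fin in auto)
    also have "\<dots> = (\<Sum>\<sigma>\<in>J \<rightarrow>\<^sub>E P. (\<Prod>j\<in>J. of_int (sign (\<sigma> j))) *
       (\<Sum>k\<in>V \<rightarrow>\<^sub>E UNIV. \<Prod>j\<in>J. \<Prod>i\<in>UNIV. g $ (\<sigma> j i) $ (k (S j i))))"
    proof (intro sum.cong arg_cong2 [of _ _ _ _ "(*)"] refl)
      fix \<sigma> and k :: "'v \<Rightarrow> 'n"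
      have "(\<Prod>v\<in>V. \<Prod>p\<in>fib v. g $ (\<sigma> (fst p) (snd p)) $ (k v)) = (\<Prod>v\<in>V. prod (?h \<sigma> k) {p \<in> J \<times> UNIV. S (fst p) (snd p) = v})"
        unfolding fib_def by (intro prod.cong refl) auto
      also have "\<dots> = prod (?h \<sigma> k) (J \<times> UNIV)"
        by (rule prod.group) (use fin S in auto)
      also have "\<dots> = (\<Prod>j\<in>J. \<Prod>i\<in>UNIV. g $ (\<sigma> j i) $ (k (S j i)))"
        by (simp add: prod.cartesian_product case_prod_unfold)
      finally show "(\<Prod>v\<in>V. \<Prod>p\<in>fib v. g $ (\<sigma> (fst p) (snd p)) $ (k v)) = (\<Prod>j\<in>J. \<Prod>i\<in>UNIV. g $ (\<sigma> j i) $ (k (S j i)))" .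
    qed
    also have "\<dots> = (\<Sum>k\<in>V \<rightarrow>\<^sub>E UNIV. \<Sum>\<sigma>\<in>J \<rightarrow>\<^sub>E P. \<Prod>j\<in>J. of_int (sign (\<sigma> j)) * (\<Prod>i\<in>UNIV. g $ (\<sigma> j i) $ (k (S j i))))"
      by (subst sum.swap) (simp add: sum_distrib_left prod.distrib)
    also have "\<dots> = (\<Sum>k\<in>V \<rightarrow>\<^sub>E UNIV. \<Prod>j\<in>J. \<Sum>p\<in>P. of_int (sign p) * (\<Prod>i\<in>UNIV. g $ (p i) $ (k (S j i))))"
      by (subst prod_sum_PiE) (use fin finP in auto)
    also have "\<dots> = (\<Sum>k\<in>V \<rightarrow>\<^sub>E UNIV. \<Prod>j\<in>J. det (\<chi> i t. g $ t $ (k (S j i))))"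
      by (simp add: det_def P_def)
    also have "\<dots> = det g ^ card J * bracket_value J V S"
      by (simp add: det_select_columns bracket_value_def prod.distrib sum_distrib_left mult_ac)
    finally show ?thesis .
  qed
  ultimately show ?thesis by (rule that)
qed

section \<open>Invariants and the stabilizer\<close>

lemma fermat_in_stab_iff: "g \<in> stab (fermat D) \<longleftrightarrow> det g \<noteq> 0 \<and> act g (fermat D) = fermat D"
  by (auto simp: stab_def GL_iff)

lemma stab_det_power_eq_1:
  fixes F :: "('n::finite, complex) mpoly \<Rightarrow> complex" and g :: "complex^'n^'n"
  assumes "\<And>g. F (act g (fermat D)) = det g ^ b * z" "z \<noteq> 0" "g \<in> stab (fermat D)"
  shows "det g ^ b = 1"
proof -
  have "det g ^ b * z = F (fermat D)"
    using assms(1) [of g] assms(3) by (simp add: fermat_in_stab_iff)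
  also have "F (fermat D) = z"
    using assms(1) [of "mat 1"] by (simp add: act_mat1_fermat)
  finally show ?thesis using assms(2) by simp
qed

lemma diagonal_in_stab:
  fixes c :: "'n::finite \<Rightarrow> complex"
  assumes "\<And>i. c i ^ D = 1" "D > 0"
  shows "(\<chi> i j. if i = j then c i else 0) \<in> stab (fermat D)"
    and "det (\<chi> i j. if i = j then c i else 0) = (\<Prod>i\<in>UNIV. c i)"
proof -
  let ?g = "(\<chi> i j. if i = j then c i else 0) :: complex^'n^'n"
  show det: "det ?g = (\<Prod>i\<in>UNIV. c i)" by (subst det_diagonal) auto
  have "c i \<noteq> 0" for i using assms(1) [of i] assms(2) by (auto simp: power_0_left)
  hence "det ?g \<noteq> 0" unfolding det by simp
  moreover have "column_form ?g i = Const (c i) * Var i" for i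
  proof -
    have "column_form ?g i = (\<Sum>j\<in>UNIV. if j = i then Const (c i) * Var i else 0)"
      unfolding column_form_def by (rule sum.cong) auto
    thus ?thesis by simp
  qed
  hence "act ?g (fermat D) = fermat D"
    by (simp add: act_fermat power_mult_distrib assms flip: Const_power) (simp add: fermat_def)
  ultimately show "?g \<in> stab (fermat D)" by (simp add: fermat_in_stab_iff)
qed

lemma transposition_in_stab:
  assumes "a \<noteq> (b :: 'n::finite)"
  obtains g :: "complex^'n^'n" where "g \<in> stab (fermat D)" "det g = -1"
proof
  let ?\<tau> = "Transposition.transpose a b"
  let ?g = "(\<chi> i j. if ?\<tau> i = j then 1 else 0) :: complex^'n^'n"
  show det: "det ?g = -1"
    using index_det_permute_arg [OF assms, of "\<lambda>i. i"] by (simp add: index_det_id) (simp add: index_det_def)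
  have "column_form ?g i = Var (?\<tau> i)" for i
  proof -
    have "column_form ?g i = (\<Sum>j\<in>UNIV. if j = ?\<tau> i then Var j else 0)"
      unfolding column_form_def by (rule sum.cong) (auto simp: transpose_def)
    thus ?thesis by simp
  qed
  hence "act ?g (fermat D) = (\<Sum>i\<in>UNIV. Var (?\<tau> i) ^ D)" by (simp add: act_fermat)
  also have "\<dots> = fermat D" unfolding fermat_def
    by (rule sum.reindex_bij_betw [of ?\<tau> UNIV UNIV]) simp
  finally show "?g \<in> stab (fermat D)" using det by (simp add: fermat_in_stab_iff)
qed

lemma stab_mult:
  assumes "g \<in> stab (fermat D)" "h \<in> stab (fermat D)"
  shows "g ** h \<in> stab (fermat D)"
  using assms act_act_fermat [of g h D] by (simp add: fermat_in_stab_iff det_mul)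

lemma root_of_unity_in_det_stab:
  assumes "z ^ D = 1" "D > 0"
  shows "\<exists>g \<in> stab (fermat D :: ('n::finite, complex) mpoly). det g = z"
proof -
  obtain i0 :: 'n where True by blast
  let ?c = "\<lambda>i :: 'n. if i = i0 then z else 1"
  have "?c i ^ D = 1" for i using assms(1) by simp
  note diag = diagonal_in_stab [of ?c D, OF this assms(2)]
  have "(\<Prod>i\<in>UNIV. ?c i) = z" by simp
  with diag show ?thesis by (intro bexI [OF _ diag(1)]) simp
qed

lemma det_stab_even:
  assumes "D > 0" "\<And>g. g \<in> stab (fermat D :: ('n::finite, complex) mpoly) \<Longrightarrow> det g ^ D = 1"
  shows "det ` stab (fermat D :: ('n, complex) mpoly) = {z. z ^ D = 1}"
  using assms root_of_unity_in_det_stab [of _ D, where 'n = 'n] by blast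

text \<open>
  For odd \<open>D\<close> a root of \<open>z ^ (2 D) = 1\<close> is a \<open>D\<close>-th root of unity up to sign, and a
  transposition of the variables supplies the sign.
\<close>

lemma det_stab_odd:
  assumes "odd D" "CARD('n) \<ge> 2"
    "\<And>g. g \<in> stab (fermat D :: ('n::finite, complex) mpoly) \<Longrightarrow> det g ^ (2 * D) = 1"
  shows "det ` stab (fermat D :: ('n, complex) mpoly) = {z. z ^ (2 * D) = 1}"
proof (intro equalityI subsetI)
  fix z assume "z \<in> {z. z ^ (2 * D) = (1 :: complex)}"
  hence "(z ^ D) ^ 2 = 1" by (simp add: power_mult [symmetric] mult.commute)
  hence "z ^ D = 1 \<or> (-z) ^ D = 1"
    using assms(1) by (auto simp: power2_eq_1_iff)
  moreover have "D > 0" using assms(1) by (rule odd_pos)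
  ultimately consider "\<exists>g \<in> stab (fermat D :: ('n, complex) mpoly). det g = z"
    | "\<exists>g \<in> stab (fermat D :: ('n, complex) mpoly). det g = -z"
    using root_of_unity_in_det_stab by metis
  thus "z \<in> det ` stab (fermat D :: ('n, complex) mpoly)"
  proof cases
    case 2
    then obtain g where g: "g \<in> stab (fermat D :: ('n, complex) mpoly)" "det g = -z" by blast
    obtain a b :: 'n where "a \<noteq> b"
      using assms(2) by (metis card_2_iff' card_le_Suc0_iff_eq finite_class.finite_UNIV not_less_eq_eq numeral_2_eq_2 UNIV_I)
    then obtain h :: "complex^'n^'n" where h: "h \<in> stab (fermat D)" "det h = -1"
      using transposition_in_stab by blast
    have "g ** h \<in> stab (fermat D)" "det (g ** h) = z"
      using stab_mult [OF g(1) h(1)] g h by (auto simp: det_mul)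
    thus ?thesis by (intro image_eqI [of _ _ "g ** h"]) auto
  qed auto
qed (use assms in auto)

lemma exists_root_power_card: "\<exists>t. t ^ CARD('n::finite) = (z :: complex)"
proof (cases "z = 0")
  case False
  have "exp (Ln z / of_nat CARD('n)) ^ CARD('n) = z"
    using False by (simp flip: exp_of_nat_mult)
  thus ?thesis by blast
qed (auto intro: exI [of _ 0])

text \<open>
  Write \<open>g\<close> as \<open>t\<close> times a matrix of determinant 1: invariance and homogeneity then compute the value
  at \<open>g w\<close> from the value at \<open>w\<close>. Were the latter \<open>0\<close>, the invariant would vanish on the orbit and
  therefore on its closure.
\<close>

lemma invariant_on_orbit:
  fixes \<phi> :: "('n::finite, complex) mpoly \<Rightarrow> complex"
  assumes "nonzero_invariant_of_degree d (orbit_closure D (fermat D)) \<phi>" and D: "D > 0"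
  obtains p :: "('n monom, complex) mpoly" where "eval_at_form p (fermat D) \<noteq> 0"
    "\<And>g t. det g \<noteq> 0 \<Longrightarrow> t ^ CARD('n) = det g \<Longrightarrow>
       eval_at_form p (act g (fermat D)) = t ^ (D * d) * eval_at_form p (fermat D)"
    "\<And>g t. det g \<noteq> 0 \<Longrightarrow> t \<noteq> 0 \<Longrightarrow>
       eval_at_form p (Const t * act g (fermat D)) = t ^ d * eval_at_form p (act g (fermat D))"
proof -
  let ?Z = "orbit_closure D (fermat D) :: ('n, complex) mpoly set"
  from assms(1) obtain p where p: "\<And>v. v \<in> ?Z \<Longrightarrow> \<phi> v = eval_at_form p v"
    unfolding nonzero_invariant_of_degree_def regular_on_def by blast
  have hom: "\<And>v t. v \<in> ?Z \<Longrightarrow> \<phi> (Const t * v) = t ^ d * \<phi> v"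
    and inv: "\<And>v g. v \<in> ?Z \<Longrightarrow> g \<in> SL \<Longrightarrow> \<phi> (act g v) = \<phi> v"
    and nz: "\<exists>v\<in>?Z. \<phi> v \<noteq> 0"
    using assms(1) unfolding nonzero_invariant_of_degree_def by blast+
  have orb: "act g (fermat D) \<in> ?Z" if "det g \<noteq> 0" for g :: "complex^'n^'n"
    using that act_fermat_in_orbit_closure by (auto simp: GL_iff)
  have scaled: "det (\<chi> i j. t * g $ i $ j) = t ^ CARD('n) * det g" for t and g :: "complex^'n^'n"
  proof -
    have "(\<chi> i j. t * g $ i $ j) = (\<chi> i. t *s g $ i)" by (simp add: vec_eq_iff)
    thus ?thesis using det_rows_mul [of "\<lambda>_. t" "\<lambda>i. g $ i"] by simp
  qed
  have w: "act (mat 1) (fermat D :: ('n, complex) mpoly) = fermat D" by (rule act_mat1_fermat)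
  have semi: "eval_at_form p (act g (fermat D)) = t ^ (D * d) * eval_at_form p (fermat D)"
    if g: "det g \<noteq> 0" "t ^ CARD('n) = det g" for g :: "complex^'n^'n" and t
  proof -
    have t: "t \<noteq> 0" using g by (auto simp: power_0_left)
    define s where "s = (\<chi> i j. inverse t * g $ i $ j)"
    have s: "s \<in> SL" using g t by (simp add: SL_def s_def scaled power_inverse)
    have "g = (\<chi> i j. t * s $ i $ j)" using t by (simp add: s_def vec_eq_iff)
    hence "act g (fermat D) = Const (t ^ D) * act s (fermat D)"
      using act_scale_fermat [of t s D] by simp
    moreover have "act s (fermat D) \<in> ?Z" using s by (intro orb) (simp add: SL_def)
    ultimately have "\<phi> (act g (fermat D)) = (t ^ D) ^ d * \<phi> (act s (fermat D))"
      using hom by simp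
    also have "\<phi> (act s (fermat D)) = \<phi> (fermat D)"
      using inv [OF _ s] orb [of "mat 1"] by (simp add: w)
    finally show ?thesis using p orb [OF g(1)] orb [of "mat 1"] by (simp add: w power_mult)
  qed
  have scale: "eval_at_form p (Const t * act g (fermat D)) = t ^ d * eval_at_form p (act g (fermat D))"
    if "det g \<noteq> 0" "t \<noteq> 0" for g :: "complex^'n^'n" and t
  proof -
    define s where "s = exp (Ln t / of_nat D)"
    have s: "s ^ D = t" "s \<noteq> 0" using that D by (auto simp: s_def simp flip: exp_of_nat_mult)
    have "Const t * act g (fermat D) = act (\<chi> i j. s * g $ i $ j) (fermat D)"
      by (simp add: act_scale_fermat s)
    moreover have "\<dots> \<in> ?Z" by (rule orb) (use that s in \<open>simp add: scaled\<close>)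
    ultimately show ?thesis using hom [of "act g (fermat D)" t] p orb [OF that(1)] by simp
  qed
  have w_nz: "eval_at_form p (fermat D) \<noteq> 0"
  proof
    assume 0: "eval_at_form p (fermat D) = 0"
    have "eval_at_form p (act g (fermat D)) = 0" if g: "g \<in> GL" for g :: "complex^'n^'n"
      using exists_root_power_card [where 'n = 'n, of "det g"] semi [of g] g 0 by (auto simp: GL_iff)
    hence "\<phi> v = 0" if "v \<in> ?Z" for v
      using that p [OF that] by (auto simp: orbit_closure_def)
    with nz show False by blast
  qed
  show ?thesis by (rule that [OF w_nz semi scale])
qed

text \<open>
  Take an element of the stabilizer whose determinant is a primitive root of unity of order \<open>e D\<close>.
  The corresponding \<open>t\<close> is a primitive root of order \<open>e D m\<close>, and the invariant is unchanged, so
  \<open>t ^ (D d) = 1\<close>.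
\<close>

lemma invariant_degree_dvd:
  fixes \<phi> :: "('n::finite, complex) mpoly \<Rightarrow> complex"
  assumes inv: "nonzero_invariant_of_degree d (orbit_closure D (fermat D)) \<phi>" and D: "D > 0" and e: "e > 0"
    and det: "det ` stab (fermat D :: ('n, complex) mpoly) = {z. z ^ (e * D) = 1}"
  shows "e * CARD('n) dvd d"
proof -
  define n where "n = e * D * CARD('n)"
  have n: "n > 0" using D e by (simp add: n_def)
  define t where "t = exp (2 * of_real pi * \<i> / of_nat n)"
  have power_t: "t ^ k = exp (2 * of_real pi * \<i> * of_nat k / of_nat n)" for k
    unfolding t_def exp_of_nat_mult [symmetric] by (rule arg_cong [of _ _ exp]) simp
  have t1: "t ^ k = 1 \<longleftrightarrow> n dvd k" for k
    unfolding power_t using complex_root_unity_eq_1 [of n k] n by simp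
  have "(t ^ CARD('n)) ^ (e * D) = 1"
    using t1 [of n] unfolding power_mult [symmetric] by (simp add: n_def mult.commute)
  hence "t ^ CARD('n) \<in> det ` stab (fermat D :: ('n, complex) mpoly)" unfolding det by simp
  then obtain g :: "complex^'n^'n" where g: "g \<in> stab (fermat D)" "t ^ CARD('n) = det g"
    by (rule imageE) (rule that)
  obtain p where p: "eval_at_form p (fermat D :: ('n, complex) mpoly) \<noteq> 0"
    "\<And>(g :: complex^'n^'n) t. det g \<noteq> 0 \<Longrightarrow> t ^ CARD('n) = det g \<Longrightarrow>
       eval_at_form p (act g (fermat D)) = t ^ (D * d) * eval_at_form p (fermat D)"
    by (rule invariant_on_orbit [OF inv D]) (rule that)
  have "t ^ (D * d) = 1"
    using p(2) [OF _ g(2)] p(1) g(1) unfolding fermat_in_stab_iff by simp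
  hence "n dvd D * d" by (simp only: t1)
  hence "D * (e * CARD('n)) dvd D * d" by (simp add: n_def ac_simps)
  thus ?thesis using D by simp
qed

lemma degree_period_fermat:
  assumes D: "D > 0" and e: "e > 0"
    and det: "det ` stab (fermat D :: ('n::finite, complex) mpoly) = {z. z ^ (e * D) = 1}"
  shows "degree_period D (fermat D :: ('n, complex) mpoly) = of_nat (e * CARD('n))"
proof -
  have "stabilizer_period (fermat D :: ('n, complex) mpoly) = e * D"
    using D e by (simp add: stabilizer_period_def det card_roots_unity_eq)
  thus ?thesis using D by (simp add: degree_period_def field_simps)
qed

section \<open>Brackets with explicit nonzero values\<close>

lemma bracket_invariant:
  fixes S :: "'j \<Rightarrow> 'n::finite \<Rightarrow> 'v"
  assumes "finite J" "finite V" "\<And>j i. j \<in> J \<Longrightarrow> S j i \<in> V"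
    "\<And>v. v \<in> V \<Longrightarrow> card {p \<in> J \<times> UNIV. S (fst p) (snd p) = v} = D"
    and nz: "bracket_value J V S \<noteq> 0"
  shows "\<exists>\<phi>. nonzero_invariant_of_degree (card V) (orbit_closure D (fermat D :: ('n, complex) mpoly)) \<phi>"
    and "\<And>g. g \<in> stab (fermat D :: ('n, complex) mpoly) \<Longrightarrow> det g ^ card J = 1"
proof -
  obtain F :: "('n, complex) mpoly \<Rightarrow> complex" where F: "polynomial_fun F" "\<And>t f. F (Const t * f) = t ^ card V * F f"
    "\<And>g. F (act g (fermat D)) = det g ^ card J * bracket_value J V S"
    by (rule bracket_polynomial [OF assms(1-4)]; (assumption | (rule that; assumption)))
  show "\<exists>\<phi>. nonzero_invariant_of_degree (card V) (orbit_closure D (fermat D :: ('n, complex) mpoly)) \<phi>"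
    using invariant_of_semiinvariant [OF F nz] by blast
  show "\<And>g. g \<in> stab (fermat D :: ('n, complex) mpoly) \<Longrightarrow> det g ^ card J = 1"
    by (rule stab_det_power_eq_1 [OF F(3) nz])
qed

lemma bracket_value_even:
  fixes D :: nat
  assumes "even D" "D > 0"
  shows "bracket_value {..<D} (UNIV :: 'n::finite set) (\<lambda>j i. i) = fact CARD('n)"
proof -
  have "bracket_value {..<D} (UNIV :: 'n set) (\<lambda>j i. i) = (\<Sum>k\<in>(UNIV :: ('n \<Rightarrow> 'n) set). index_det k ^ D)"
    by (simp add: bracket_value_def PiE_UNIV_domain)
  also have "\<dots> = fact CARD('n)" by (rule sum_index_det_even_power [OF assms])
  finally show ?thesis .
qed

lemma card_bracket_degree_even:
  "card {p \<in> {..<D} \<times> (UNIV :: 'n::finite set). snd p = v} = D"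
proof -
  have "{p \<in> {..<D} \<times> (UNIV :: 'n set). snd p = v} = (\<lambda>j. (j, v)) ` {..<D}" by auto
  thus ?thesis by (simp add: card_image inj_on_def)
qed

text \<open>
  Half of the \<open>D\<close>-subsets of a set of size \<open>2 D\<close> contain a given element, and no two of those are
  complementary.
\<close>

lemma choose_half_sets:
  assumes "D > 0" "2 * CARD('n::finite) \<le> (2 * D) choose D"
  obtains A :: "'n::finite \<Rightarrow> nat set" where "inj A"
    "\<And>i. A i \<subseteq> {..<2 * D}" "\<And>i. card (A i) = D" "\<And>i. 0 \<in> A i"
proof -
  obtain E where E: "D = Suc E" using assms(1) by (cases D) auto
  define T where "T = {1..<2 * D}"
  have "card {B. B \<subseteq> T \<and> card B = E} = (2 * D - 1) choose E"
    by (subst n_subsets) (auto simp: T_def)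
  moreover have "2 * ((2 * D - 1) choose E) = (2 * D) choose D"
  proof -
    have "(2 * D) choose D = ((2 * D - 1) choose E) + ((2 * D - 1) choose (Suc E))"
      unfolding E by simp
    also have "(2 * D - 1) choose (Suc E) = (2 * D - 1) choose E"
      unfolding E by (subst binomial_symmetric) auto
    finally show ?thesis by simp
  qed
  ultimately have card_le: "CARD('n) \<le> card {B. B \<subseteq> T \<and> card B = E}" using assms(2) by linarith
  have finT: "finite {B. B \<subseteq> T \<and> card B = E}"
    by (rule finite_subset [of _ "Pow T"]) (auto simp: T_def)
  obtain f :: "'n \<Rightarrow> nat set" where f: "f ` UNIV \<subseteq> {B. B \<subseteq> T \<and> card B = E}" "inj f"
    using card_le_inj [OF finite_class.finite_UNIV finT card_le] by blast
  have sub: "f i \<subseteq> T" and card_f: "card (f i) = E" for i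
    using f(1) by blast+
  have finf: "finite (f i)" for i
    by (rule finite_subset [OF sub]) (simp add: T_def)
  have n0: "0 \<notin> f i" for i using subsetD [OF sub, of 0 i] by (auto simp: T_def)
  have "inj (\<lambda>i. insert 0 (f i))"
  proof (rule injI)
    fix i j assume "insert 0 (f i) = insert 0 (f j)"
    hence "f i = f j" by (simp only: insert_ident [OF n0 n0])
    thus "i = j" by (rule injD [OF f(2)])
  qed
  moreover have "insert 0 (f i) \<subseteq> {..<2 * D}" for i
  proof -
    have "T \<subseteq> {..<2 * D}" by (auto simp: T_def)
    hence "f i \<subseteq> {..<2 * D}" by (rule subset_trans [OF sub])
    thus ?thesis using assms(1) by simp
  qed
  moreover have "card (insert 0 (f i)) = D" for i
    by (simp add: n0 finf card_f E)
  ultimately show ?thesis by (rule that [of "\<lambda>i. insert 0 (f i)"]) simp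
qed

text \<open>
  The vertex \<open>(i, True)\<close> lies in the blocks from \<open>A i\<close> and \<open>(i, False)\<close> in the others. If no block
  vanishes under a colouring, then each colour occurs once in every block. So the block sets of the
  vertices of one colour partition the set of blocks, and having \<open>D\<close> elements they form a
  complementary pair. This pair must be \<open>A i\<close> and its complement for a single \<open>i\<close>, because the \<open>A i\<close>
  are distinct and all contain \<open>0\<close>. Hence all blocks carry the same permutation, and the product of
  the \<open>2 D\<close> signs is 1.
\<close>

lemma bracket_value_halves:
  fixes A :: "'n::finite \<Rightarrow> nat set"
  assumes D: "D > 0" and A: "inj A" "\<And>i. A i \<subseteq> {..<2 * D}" "\<And>i. card (A i) = D" "\<And>i. 0 \<in> A i"
  shows "bracket_value {..<2 * D} UNIV (\<lambda>j i. (i, j \<in> A i)) = fact CARD('n)"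
proof -
  define H where "H = (\<lambda>(i, b). if b then A i else {..<2 * D} - A i)"
  have finA: "finite (A i)" for i using A(2) finite_subset by blast
  have cardH: "card (H v) = D" for v
    using A(2) A(3) finA by (cases v) (auto simp: H_def card_Diff_subset)
  have H_sub: "H v \<subseteq> {..<2 * D}" for v using A(2) by (cases v) (auto simp: H_def)
  have finH: "finite (H v)" for v using H_sub finite_subset by blast
  have inH: "j \<in> H (i, j \<in> A i)" if "j < 2 * D" for j i using that by (auto simp: H_def)
  have H0: "0 \<in> H (i, b) \<longleftrightarrow> b" for i b using A(4) D by (auto simp: H_def)
  have injH: "v = v'" if "H v = H v'" for v v'
  proof -
    obtain i b i' b' where v: "v = (i, b)" "v' = (i', b')" by (metis surj_pair)
    have b: "b = b'" using that H0 unfolding v by blast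
    have dd: "{..<2 * D} - ({..<2 * D} - A l) = A l" for l
      using A(2) [of l] by (simp add: double_diff)
    have "A i = A i'"
    proof (cases b')
      case True
      thus ?thesis using that unfolding v b by (simp add: H_def)
    next
      case False
      hence "{..<2 * D} - A i = {..<2 * D} - A i'" using that unfolding v b by (simp add: H_def)
      hence "{..<2 * D} - ({..<2 * D} - A i) = {..<2 * D} - ({..<2 * D} - A i')" by (rule arg_cong)
      thus ?thesis unfolding dd .
    qed
    with A(1) show ?thesis unfolding v b by (simp add: inj_eq)
  qed
  have compl: "H (i, \<not> b) = {..<2 * D} - H (i, b)" for i b
    using A(2) [of i] by (cases b) (simp_all add: H_def double_diff)
  \<comment> \<open>A colouring for which no block vanishes has complementary colour classes.\<close>
  have pair: "k (i, \<not> b) = k (i, b)" if k: "\<And>j. j < 2 * D \<Longrightarrow> inj (\<lambda>i. k (i, j \<in> A i))"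
    for k :: "'n \<times> bool \<Rightarrow> 'n" and i b
  proof -
    have neq: "H (i, b) \<noteq> {..<2 * D}"
    proof
      assume "H (i, b) = {..<2 * D}"
      hence "card (H (i, b)) = 2 * D" by (simp only: card_lessThan)
      thus False using D unfolding cardH by simp
    qed
    have "\<exists>j. j \<in> {..<2 * D} - H (i, b)" using H_sub [of "(i, b)"] neq by blast
    then obtain j where j: "j < 2 * D" "j \<notin> H (i, b)" by blast
    have "surj (\<lambda>i. k (i, j \<in> A i))"
      using finite_UNIV_inj_surj [OF finite_class.finite_UNIV k [OF j(1)]] .
    then obtain i' where i': "k (i, b) = k (i', j \<in> A i')" by (rule surjE)
    define b' where "b' = (j \<in> A i')"
    have "H (i', b') \<inter> H (i, b) = {}"
    proof (rule ccontr)
      assume "H (i', b') \<inter> H (i, b) \<noteq> {}"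
      then obtain l where l: "l \<in> H (i', b')" "l \<in> H (i, b)" by blast
      have l2: "l < 2 * D" using subsetD [OF H_sub l(1)] by simp
      have memb: "(l \<in> A i) = b" if "l \<in> H (i, b)" for i b
        using that by (cases b) (simp_all add: H_def)
      have "k (i', l \<in> A i') = k (i, l \<in> A i)"
        unfolding memb [OF l(1)] memb [OF l(2)] unfolding b'_def by (rule i' [symmetric])
      hence ii: "i' = i" by (rule injD [OF k [OF l2]])
      have "b' = b" using memb [OF l(1)] memb [OF l(2)] unfolding ii by blast
      hence e: "(j \<in> A i') = b" unfolding b'_def .
      have "j \<in> H (i, b)" using inH [OF j(1), of i'] unfolding e unfolding ii .
      with j show False by blast
    qed
    hence "H (i', b') \<subseteq> H (i, \<not> b)" using H_sub [of "(i', b')"] unfolding compl by blast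
    hence "H (i', b') = H (i, \<not> b)" by (rule card_subset_eq [OF finH]) (simp only: cardH)
    hence eq: "(i', b') = (i, \<not> b)" by (rule injH)
    have "k (i', b') = k (i, b)" unfolding b'_def by (rule i' [symmetric])
    thus ?thesis unfolding eq .
  qed
  define G where "G = (\<lambda>k :: 'n \<times> bool \<Rightarrow> 'n. \<Prod>j<2 * D. index_det (\<lambda>i. k (i, j \<in> A i)))"
  \<comment> \<open>The colourings that agree on complementary vertices.\<close>
  define \<iota> where "\<iota> = (\<lambda>x :: 'n \<Rightarrow> 'n. \<lambda>v :: 'n \<times> bool. x (fst v))"
  have "bracket_value {..<2 * D} UNIV (\<lambda>j i. (i, j \<in> A i)) = (\<Sum>k\<in>UNIV. G k)"
    by (simp add: bracket_value_def PiE_UNIV_domain G_def)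
  also have "\<dots> = (\<Sum>k\<in>range \<iota>. G k)"
  proof (rule sum.mono_neutral_right)
    show "\<forall>k\<in>UNIV - range \<iota>. G k = 0"
    proof
      fix k assume k: "k \<in> UNIV - range \<iota>"
      have "\<exists>j<2 * D. \<not> inj (\<lambda>i. k (i, j \<in> A i))"
      proof (rule ccontr)
        assume "\<not> ?thesis"
        hence eq: "k (i, \<not> b) = k (i, b)" for i b using pair [of k i b] by blast
        have "k = \<iota> (\<lambda>i. k (i, True))"
        proof
          fix v :: "'n \<times> bool"
          obtain i b where v: "v = (i, b)" by (metis surj_pair)
          show "k v = \<iota> (\<lambda>i. k (i, True)) v"
            using eq [of i True] unfolding v \<iota>_def by (cases b) simp_all
        qed
        with k show False by blast
      qed
      thus "G k = 0" unfolding G_def by (intro prod_zero) (auto intro: index_det_not_inj)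
    qed
  qed auto
  also have "\<dots> = (\<Sum>x\<in>UNIV. G (\<iota> x))"
    by (rule sum.reindex_cong [of \<iota> UNIV]) (auto simp: inj_def \<iota>_def fun_eq_iff)
  also have "\<dots> = (\<Sum>x\<in>(UNIV :: ('n \<Rightarrow> 'n) set). index_det x ^ (2 * D))"
    by (simp add: G_def \<iota>_def)
  also have "\<dots> = fact CARD('n)" using D by (intro sum_index_det_even_power) auto
  finally show ?thesis .
qed

lemma card_bracket_degree_halves:
  fixes A :: "'n::finite \<Rightarrow> nat set"
  assumes "\<And>i. A i \<subseteq> {..<2 * D}" "\<And>i. card (A i) = D"
  shows "card {p \<in> {..<2 * D} \<times> UNIV. (snd p, fst p \<in> A (snd p)) = v} = D"
proof -
  obtain i b where v: "v = (i, b)" by (metis surj_pair)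
  have "{p \<in> {..<2 * D} \<times> UNIV. (snd p, fst p \<in> A (snd p)) = v} =
      (\<lambda>j. (j, i)) ` (if b then A i else {..<2 * D} - A i)"
    unfolding v using assms(1) [of i] by auto
  moreover have "finite (A i)" using assms(1) finite_subset by blast
  ultimately show ?thesis
    using assms by (simp add: card_image inj_on_def card_Diff_subset)
qed

section \<open>Cayley's omega process\<close>

text \<open>
  The cells are the places in \<open>K\<close> determinants of size \<open>m\<close>.
\<close>

definition cells :: "nat \<Rightarrow> (nat \<times> 'n::finite) set" where
  "cells K = {..<K} \<times> UNIV"

definition block_sign :: "nat \<Rightarrow> (nat \<times> 'n::finite \<Rightarrow> 'n) \<Rightarrow> complex" where
  "block_sign K u = (\<Prod>j<K. index_det (\<lambda>i. u (j, i)))"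

text \<open>
  Column \<open>i\<close> is the sum of the unit vectors \<open>u (j, i)\<close> over the cells of \<open>B\<close> in that column. Letting
  \<open>B\<close> vary polarizes a polynomial in the columns.
\<close>

definition cell_matrix :: "nat \<Rightarrow> (nat \<times> 'n::finite) set \<Rightarrow> (nat \<times> 'n \<Rightarrow> 'n) \<Rightarrow> complex^'n^'n" where
  "cell_matrix K B u = (\<chi> t i. \<Sum>j<K. if (j, i) \<in> B \<and> u (j, i) = t then 1 else 0)"

text \<open>
  On a polynomial that is homogeneous of degree \<open>K\<close> in each column this is, up to sign, the derivative in the directions
  prescribed by the word \<open>u\<close>; the alternating sum is that of Ryser's formula for the permanent.
\<close>

definition polar :: "nat \<Rightarrow> (complex^'n^'n::finite \<Rightarrow> complex) \<Rightarrow> (nat \<times> 'n \<Rightarrow> 'n) \<Rightarrow> complex" where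
  "polar K F u = (\<Sum>B\<in>Pow (cells K). (-1) ^ card B * F (cell_matrix K B u))"

text \<open>
  Up to sign, Cayley's operator \<open>det(\<partial>) ^ K\<close>: the word \<open>u\<close> selects a term from each of the \<open>K\<close>
  determinants, and \<^const>\<open>block_sign\<close> is its sign.
\<close>

definition omega_process :: "nat \<Rightarrow> (complex^'n^'n::finite \<Rightarrow> complex) \<Rightarrow> complex" where
  "omega_process K F = (\<Sum>u\<in>cells K \<rightarrow>\<^sub>E UNIV. block_sign K u * polar K F u)"

lemma finite_cells [simp]: "finite (cells K)"
  by (simp add: cells_def)

lemma card_cells: "card (cells K :: (nat \<times> 'n::finite) set) = K * CARD('n)"
  by (simp add: cells_def card_cartesian_product)

lemma alternating_sum_supersets:
  assumes "finite Y" "X \<subseteq> Y"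
  shows "(\<Sum>B\<in>Pow Y. (-1) ^ card B * (if X \<subseteq> B then 1 else 0)) =
    (if X = Y then (-1) ^ card Y else (0 :: complex))"
proof (cases "X = Y")
  case True
  have "(\<Sum>B\<in>Pow Y. (-1) ^ card B * (if X \<subseteq> B then 1 else 0)) = (\<Sum>B\<in>{Y}. (-1 :: complex) ^ card B)"
    by (rule sum.mono_neutral_cong_right) (use assms True in auto)
  thus ?thesis using True by simp
next
  case False
  with assms obtain y where y: "y \<in> Y" "y \<notin> X" by blast
  define f where "f = (\<lambda>B. (-1) ^ card B * (if X \<subseteq> B then 1 else 0 :: complex))"
  define Y' where "Y' = Y - {y}"
  have Y: "Y = insert y Y'" "y \<notin> Y'" "finite Y'" using y assms by (auto simp: Y'_def)
  have "sum f (Pow Y) = sum f (Pow Y') + sum f (insert y ` Pow Y')"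
    unfolding Y(1) Pow_insert using Y by (intro sum.union_disjoint) auto
  also have "sum f (insert y ` Pow Y') = (\<Sum>B\<in>Pow Y'. f (insert y B))"
    by (rule sum.reindex_cong [of "insert y"]) (use Y(2) in \<open>auto simp: inj_on_def\<close>)
  also have "\<dots> = (\<Sum>B\<in>Pow Y'. - f B)"
  proof (rule sum.cong)
    fix B assume B: "B \<in> Pow Y'"
    hence "finite B" "y \<notin> B" using Y finite_subset by auto
    moreover have "X \<subseteq> insert y B \<longleftrightarrow> X \<subseteq> B" using y by blast
    ultimately show "f (insert y B) = - f B" by (simp add: f_def)
  qed auto
  finally show ?thesis using False by (simp add: f_def sum_negf)
qed

text \<open>
  As in Ryser's formula: after the product is multiplied out, the alternating sum over \<open>B\<close> keeps only
  those choices \<open>\<gamma>\<close> of blocks for the factors that hit every cell.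
\<close>

lemma polar_word_product:
  fixes v \<kappa> :: "'x \<Rightarrow> 'n::finite"
  assumes "finite X"
  shows "polar K (\<lambda>h. \<Prod>x\<in>X. h $ v x $ \<kappa> x) u = (-1) ^ card (cells K :: (nat \<times> 'n) set) *
    (\<Sum>\<gamma>\<in>X \<rightarrow>\<^sub>E {..<K}. if (\<lambda>x. (\<gamma> x, \<kappa> x)) ` X = cells K \<and> (\<forall>x\<in>X. u (\<gamma> x, \<kappa> x) = v x) then 1 else 0)"
proof -
  let ?\<theta> = "\<lambda>\<gamma> x. (\<gamma> x, \<kappa> x)"
  let ?c = "\<lambda>\<gamma>. if \<forall>x\<in>X. u (\<gamma> x, \<kappa> x) = v x then 1 else 0 :: complex"
  have prod: "(\<Prod>x\<in>X. cell_matrix K B u $ v x $ \<kappa> x) =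
      (\<Sum>\<gamma>\<in>X \<rightarrow>\<^sub>E {..<K}. ?c \<gamma> * (if ?\<theta> \<gamma> ` X \<subseteq> B then 1 else 0))" for B
  proof -
    have "(\<Prod>x\<in>X. cell_matrix K B u $ v x $ \<kappa> x) =
        (\<Sum>\<gamma>\<in>X \<rightarrow>\<^sub>E {..<K}. \<Prod>x\<in>X. if (\<gamma> x, \<kappa> x) \<in> B \<and> u (\<gamma> x, \<kappa> x) = v x then 1 else 0)"
      using assms by (simp add: cell_matrix_def prod_sum_PiE)
    also have "\<dots> = (\<Sum>\<gamma>\<in>X \<rightarrow>\<^sub>E {..<K}. ?c \<gamma> * (if ?\<theta> \<gamma> ` X \<subseteq> B then 1 else 0))"
    proof (rule sum.cong [OF refl])
      fix \<gamma>
      show "(\<Prod>x\<in>X. if (\<gamma> x, \<kappa> x) \<in> B \<and> u (\<gamma> x, \<kappa> x) = v x then 1 else 0) =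
          ?c \<gamma> * (if ?\<theta> \<gamma> ` X \<subseteq> B then 1 else 0)"
      proof (cases "\<forall>x\<in>X. (\<gamma> x, \<kappa> x) \<in> B \<and> u (\<gamma> x, \<kappa> x) = v x")
        case True
        hence "?\<theta> \<gamma> ` X \<subseteq> B" "\<forall>x\<in>X. u (\<gamma> x, \<kappa> x) = v x" by blast+
        with True show ?thesis by simp
      next
        case False
        then obtain x where "x \<in> X" "\<not> ((\<gamma> x, \<kappa> x) \<in> B \<and> u (\<gamma> x, \<kappa> x) = v x)" by blast
        hence "(\<Prod>x\<in>X. if (\<gamma> x, \<kappa> x) \<in> B \<and> u (\<gamma> x, \<kappa> x) = v x then 1 else 0 :: complex) = 0"
          using assms by (intro prod_zero) auto
        moreover have "\<not> (?\<theta> \<gamma> ` X \<subseteq> B \<and> (\<forall>x\<in>X. u (\<gamma> x, \<kappa> x) = v x))" using False by blast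
        hence "?c \<gamma> * (if ?\<theta> \<gamma> ` X \<subseteq> B then 1 else 0) = 0" by auto
        ultimately show ?thesis by simp
      qed
    qed
    finally show ?thesis .
  qed
  have "polar K (\<lambda>h. \<Prod>x\<in>X. h $ v x $ \<kappa> x) u =
      (\<Sum>B\<in>Pow (cells K). \<Sum>\<gamma>\<in>X \<rightarrow>\<^sub>E {..<K}. ?c \<gamma> * ((-1) ^ card B * (if ?\<theta> \<gamma> ` X \<subseteq> B then 1 else 0)))"
    unfolding polar_def prod sum_distrib_left by (intro sum.cong refl) (simp only: mult.left_commute)
  also have "\<dots> = (\<Sum>\<gamma>\<in>X \<rightarrow>\<^sub>E {..<K}. ?c \<gamma> * (\<Sum>B\<in>Pow (cells K). (-1) ^ card B * (if ?\<theta> \<gamma> ` X \<subseteq> B then 1 else 0)))"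
    by (subst sum.swap) (simp only: sum_distrib_left)
  also have "\<dots> = (\<Sum>\<gamma>\<in>X \<rightarrow>\<^sub>E {..<K}. ?c \<gamma> * (if ?\<theta> \<gamma> ` X = cells K then (-1) ^ card (cells K :: (nat \<times> 'n) set) else 0))"
  proof (intro sum.cong refl arg_cong2 [of _ _ _ _ "(*)"])
    fix \<gamma> assume "\<gamma> \<in> X \<rightarrow>\<^sub>E {..<K}"
    hence "?\<theta> \<gamma> ` X \<subseteq> cells K" by (auto simp: cells_def)
    thus "(\<Sum>B\<in>Pow (cells K). (-1) ^ card B * (if ?\<theta> \<gamma> ` X \<subseteq> B then 1 else 0)) =
      (if ?\<theta> \<gamma> ` X = cells K then (-1) ^ card (cells K :: (nat \<times> 'n) set) else (0 :: complex))"
      by (rule alternating_sum_supersets [OF finite_cells])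
  qed
  also have "\<dots> = (-1) ^ card (cells K :: (nat \<times> 'n) set) *
    (\<Sum>\<gamma>\<in>X \<rightarrow>\<^sub>E {..<K}. if ?\<theta> \<gamma> ` X = cells K \<and> (\<forall>x\<in>X. u (\<gamma> x, \<kappa> x) = v x) then 1 else 0)"
    unfolding sum_distrib_left by (intro sum.cong refl) simp
  finally show ?thesis .
qed

lemma polar_sum: "polar K (\<lambda>h. \<Sum>a\<in>I. F a h) u = (\<Sum>a\<in>I. polar K (F a) u)"
  unfolding polar_def sum_distrib_left by (rule sum.swap)

lemma polar_scale: "polar K (\<lambda>h. c * F h) u = c * polar K F u"
  unfolding polar_def sum_distrib_left by (intro sum.cong refl) (simp only: mult.left_commute)

lemma omega_sum: "omega_process K (\<lambda>h. \<Sum>a\<in>I. F a h) = (\<Sum>a\<in>I. omega_process K (F a))"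
  unfolding omega_process_def polar_sum sum_distrib_left by (rule sum.swap)

lemma omega_scale: "omega_process K (\<lambda>h. c * F h) = c * omega_process K F"
  unfolding omega_process_def polar_scale sum_distrib_left by (intro sum.cong refl) (simp only: mult.left_commute)

lemma block_sign_cong:
  "(\<And>y. y \<in> cells K \<Longrightarrow> u y = u' y) \<Longrightarrow> block_sign K u = block_sign K u'"
  unfolding block_sign_def by (intro prod.cong refl arg_cong [of _ _ index_det] ext) (auto simp: cells_def)

lemma compose_permutes_PiE:
  assumes "\<theta> permutes Y" "u \<in> Y \<rightarrow>\<^sub>E UNIV"
  shows "u \<circ> \<theta> \<in> Y \<rightarrow>\<^sub>E UNIV"
  using assms by (auto simp: PiE_def extensional_def permutes_not_in)

lemma sum_reindex_permutes:
  fixes \<theta> :: "'a \<Rightarrow> 'a" and f :: "('a \<Rightarrow> 'b) \<Rightarrow> 'c::comm_monoid_add"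
  assumes "\<theta> permutes Y"
  shows "(\<Sum>u\<in>Y \<rightarrow>\<^sub>E UNIV. f (u \<circ> \<theta>)) = (\<Sum>u\<in>Y \<rightarrow>\<^sub>E UNIV. f u)"
proof (rule sum.reindex_bij_witness [of _ "\<lambda>u. u \<circ> inv \<theta>" "\<lambda>u. u \<circ> \<theta>"])
  fix u :: "'a \<Rightarrow> 'b" assume u: "u \<in> Y \<rightarrow>\<^sub>E UNIV"
  show "u \<circ> \<theta> \<circ> inv \<theta> = u" "(u \<circ> inv \<theta>) \<circ> \<theta> = u"
    using assms by (simp_all add: comp_assoc permutes_inv_o)
  show "u \<circ> \<theta> \<in> Y \<rightarrow>\<^sub>E UNIV" "u \<circ> inv \<theta> \<in> Y \<rightarrow>\<^sub>E UNIV"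
    using assms u by (simp_all only: compose_permutes_PiE permutes_inv)
qed auto

lemma block_sign_swap:
  assumes "p \<noteq> q" "A \<subseteq> {..<K}"
  shows "block_sign K (\<lambda>y. u (if fst y \<in> A then (fst y, Transposition.transpose p q (snd y)) else y)) =
    (-1) ^ card A * block_sign K u"
proof -
  have "block_sign K (\<lambda>y. u (if fst y \<in> A then (fst y, Transposition.transpose p q (snd y)) else y)) =
      (\<Prod>j<K. (if j \<in> A then -1 else 1) * index_det (\<lambda>i. u (j, i)))"
    unfolding block_sign_def
  proof (rule prod.cong [OF refl])
    fix j
    show "index_det (\<lambda>i. u (if fst (j, i) \<in> A then (fst (j, i), Transposition.transpose p q (snd (j, i))) else (j, i))) =
        (if j \<in> A then -1 else 1) * index_det (\<lambda>i. u (j, i))"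
      using index_det_permute_arg [OF assms(1), of "\<lambda>i. u (j, i)"] by simp
  qed
  also have "\<dots> = (\<Prod>j<K. if j \<in> A then -1 else 1) * block_sign K u"
    by (simp add: prod.distrib block_sign_def)
  also have "(\<Prod>j<K. if j \<in> A then -1 else 1) = ((-1) ^ card A :: complex)"
    using assms(2) by (simp add: prod.If_cases Int_absorb1)
  finally show ?thesis .
qed

text \<open>
  Expansion gives a sum over the columns \<open>k a\<close> chosen in the \<open>N\<close> power sums and over the blocks
  \<open>\<gamma> (a, r)\<close> to which their letters are assigned. Fix \<open>\<gamma>\<close>. In a nonzero term every power sum meets
  exactly \<open>D\<close> blocks. There are fewer than \<open>N\<close> sets of \<open>D\<close> blocks, so two power sums \<open>a\<close> and \<open>b\<close>
  meet the same ones. Exchanging \<open>k a\<close> and \<open>k b\<close> exchanges two columns in each of these \<open>D\<close> blocks,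
  and as \<open>D\<close> is odd the term changes its sign. So the sum over \<open>k\<close> vanishes.
\<close>

lemma omega_power_sum_product:
  fixes v :: "nat \<times> nat \<Rightarrow> 'n::finite"
  assumes D: "odd D" and N: "N * D = 2 * D * CARD('n)" and big: "N > (2 * D) choose D"
  shows "omega_process (2 * D) (\<lambda>h. \<Prod>a<N. \<Sum>c\<in>UNIV. \<Prod>r<D. h $ v (a, r) $ c) = 0"
proof -
  define X where "X = {..<N} \<times> {..<D}"
  define Y where "Y = (cells (2 * D) :: (nat \<times> 'n) set)"
  have finX: "finite X" and finY: "finite Y" by (auto simp: X_def Y_def)
  have cardXY: "card X = card Y"
    using N by (simp add: X_def Y_def card_cells card_cartesian_product)
  have D0: "D > 0" using D by (rule odd_pos)
  define \<theta> where "\<theta> = (\<lambda>(\<gamma> :: nat \<times> nat \<Rightarrow> nat) (k :: nat \<Rightarrow> 'n) x. (\<gamma> x, k (fst x)))"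
  define T where "T = (\<lambda>\<gamma> k. \<Sum>u\<in>Y \<rightarrow>\<^sub>E UNIV. block_sign (2 * D) u *
    (if \<theta> \<gamma> k ` X = Y \<and> (\<forall>x\<in>X. u (\<theta> \<gamma> k x) = v x) then 1 else 0))"
  have expand: "(\<Prod>a<N. \<Sum>c\<in>UNIV. \<Prod>r<D. h $ v (a, r) $ c) =
      (\<Sum>k\<in>{..<N} \<rightarrow>\<^sub>E UNIV. \<Prod>x\<in>X. h $ v x $ k (fst x))" for h :: "complex^'n^'n"
    by (subst prod_sum_PiE) (auto simp: X_def prod.cartesian_product case_prod_unfold)
  have "omega_process (2 * D) (\<lambda>h. \<Prod>a<N. \<Sum>c\<in>UNIV. \<Prod>r<D. h $ v (a, r) $ c) =
      (-1) ^ card Y * (\<Sum>k\<in>{..<N} \<rightarrow>\<^sub>E UNIV. \<Sum>\<gamma>\<in>X \<rightarrow>\<^sub>E {..<2 * D}. T \<gamma> k)"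
  proof -
    have "omega_process (2 * D) (\<lambda>h. \<Prod>x\<in>X. h $ v x $ k (fst x)) =
        (-1) ^ card Y * (\<Sum>\<gamma>\<in>X \<rightarrow>\<^sub>E {..<2 * D}. T \<gamma> k)" for k :: "nat \<Rightarrow> 'n"
    proof -
      have "omega_process (2 * D) (\<lambda>h. \<Prod>x\<in>X. h $ v x $ k (fst x)) =
        (\<Sum>u\<in>Y \<rightarrow>\<^sub>E UNIV. \<Sum>\<gamma>\<in>X \<rightarrow>\<^sub>E {..<2 * D}. (-1) ^ card Y * (block_sign (2 * D) u *
          (if \<theta> \<gamma> k ` X = Y \<and> (\<forall>x\<in>X. u (\<theta> \<gamma> k x) = v x) then 1 else 0)))"
        unfolding omega_process_def polar_word_product [OF finX] Y_def [symmetric] \<theta>_def sum_distrib_left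
        by (simp only: mult.left_commute)
      also have "\<dots> = (-1) ^ card Y * (\<Sum>\<gamma>\<in>X \<rightarrow>\<^sub>E {..<2 * D}. T \<gamma> k)"
        unfolding T_def sum_distrib_left by (rule sum.swap)
      finally show ?thesis .
    qed
    thus ?thesis unfolding expand omega_sum by (simp only: sum_distrib_left)
  qed
  also have "(\<Sum>k\<in>{..<N} \<rightarrow>\<^sub>E UNIV. \<Sum>\<gamma>\<in>X \<rightarrow>\<^sub>E {..<2 * D}. T \<gamma> k) =
      (\<Sum>\<gamma>\<in>X \<rightarrow>\<^sub>E {..<2 * D}. \<Sum>k\<in>{..<N} \<rightarrow>\<^sub>E UNIV. T \<gamma> k)"
    by (rule sum.swap)
  also have "\<dots> = 0"
  proof (rule sum.neutral, rule ballI)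
    fix \<gamma> assume \<gamma>: "\<gamma> \<in> X \<rightarrow>\<^sub>E {..<2 * D}"
    show "(\<Sum>k\<in>{..<N} \<rightarrow>\<^sub>E UNIV. T \<gamma> k) = 0"
    proof (cases "\<exists>k. \<theta> \<gamma> k ` X = Y")
      case False
      hence "T \<gamma> k = 0" for k by (simp add: T_def)
      thus ?thesis by simp
    next
      case True
      define R where "R = (\<lambda>a. (\<lambda>r. \<gamma> (a, r)) ` {..<D})"
      have inj_\<theta>: "inj_on (\<theta> \<gamma> k) X" if "\<theta> \<gamma> k ` X = Y" for k
        using finX cardXY that by (intro eq_card_imp_inj_on) simp_all
      have inj_\<gamma>: "inj_on (\<lambda>r. \<gamma> (a, r)) {..<D}" if a: "a < N" for a
      proof (rule inj_onI)
        fix r r' assume r: "r \<in> {..<D}" "r' \<in> {..<D}" "\<gamma> (a, r) = \<gamma> (a, r')"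
        from True obtain k where k: "\<theta> \<gamma> k ` X = Y" by blast
        have "\<theta> \<gamma> k (a, r) = \<theta> \<gamma> k (a, r')" using r(3) by (simp add: \<theta>_def)
        moreover have "(a, r) \<in> X" "(a, r') \<in> X" using r a by (simp_all add: X_def)
        ultimately have "(a, r) = (a, r')" by (rule inj_onD [OF inj_\<theta> [OF k]])
        thus "r = r'" by simp
      qed
      have cardR: "card (R a) = D" if "a < N" for a
        unfolding R_def by (subst card_image [OF inj_\<gamma> [OF that]]) simp
      have R_sub: "R a \<subseteq> {..<2 * D}" if "a < N" for a
      proof
        fix j assume "j \<in> R a"
        then obtain r where "r < D" "j = \<gamma> (a, r)" unfolding R_def by blast
        thus "j \<in> {..<2 * D}" using PiE_mem [OF \<gamma>, of "(a, r)"] that by (simp add: X_def)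
      qed
      have "\<not> inj_on R {..<N}"
      proof (rule pigeonhole)
        have "card (R ` {..<N}) \<le> card {B. B \<subseteq> {..<2 * D} \<and> card B = D}"
          by (rule card_mono) (use R_sub cardR in \<open>auto intro: finite_subset [of _ "Pow {..<2 * D}"]\<close>)
        also have "\<dots> = (2 * D) choose D" by (subst n_subsets) simp_all
        finally show "card (R ` {..<N}) < card {..<N}" using big by simp
      qed
      then obtain a b where ab: "a < N" "b < N" "a \<noteq> b" "R a = R b"
        unfolding inj_on_def by blast
      define \<tau> where "\<tau> = Transposition.transpose a b"
      have \<tau>_less: "\<tau> c < N \<longleftrightarrow> c < N" for c
        using ab by (simp add: \<tau>_def Transposition.transpose_def)
      have \<tau>_fix: "\<tau> c = c" if "c \<ge> N" for c
        using ab that by (simp add: \<tau>_def Transposition.transpose_def)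
      have \<tau>\<tau>: "k \<circ> \<tau> \<circ> \<tau> = k" for k :: "nat \<Rightarrow> 'n" by (simp add: \<tau>_def comp_assoc)
      have R_swap: "\<exists>r'<D. \<gamma> (a, r) = \<gamma> (b, r')" "\<exists>r'<D. \<gamma> (b, r) = \<gamma> (a, r')" if r: "r < D" for r
      proof -
        have "\<gamma> (a, r) \<in> R b" unfolding ab(4) [symmetric] using r by (simp add: R_def)
        thus "\<exists>r'<D. \<gamma> (a, r) = \<gamma> (b, r')" unfolding R_def by blast
        have "\<gamma> (b, r) \<in> R a" unfolding ab(4) using r by (simp add: R_def)
        thus "\<exists>r'<D. \<gamma> (b, r) = \<gamma> (a, r')" unfolding R_def by blast
      qed
      have image_sub: "\<theta> \<gamma> (k \<circ> \<tau>) ` X \<subseteq> \<theta> \<gamma> k ` X" for k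
      proof
        fix y assume "y \<in> \<theta> \<gamma> (k \<circ> \<tau>) ` X"
        then obtain c r where cr: "c < N" "r < D" "y = (\<gamma> (c, r), k (\<tau> c))"
          unfolding X_def \<theta>_def by auto
        have "\<exists>r'<D. \<gamma> (c, r) = \<gamma> (\<tau> c, r')"
          using R_swap [OF cr(2)] cr(2) by (cases "c = a"; cases "c = b") (auto simp: \<tau>_def)
        then obtain r' where "r' < D" "y = \<theta> \<gamma> k (\<tau> c, r')" using cr(3) by (auto simp: \<theta>_def)
        moreover have "\<tau> c < N" using cr(1) by (simp add: \<tau>_less)
        ultimately show "y \<in> \<theta> \<gamma> k ` X" by (simp add: X_def)
      qed
      have image_eq: "\<theta> \<gamma> (k \<circ> \<tau>) ` X = \<theta> \<gamma> k ` X" for k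
        using image_sub [of k] image_sub [of "k \<circ> \<tau>"] unfolding \<tau>\<tau> by (rule subset_antisym)
      have anti: "T \<gamma> (k \<circ> \<tau>) = - T \<gamma> k" for k
      proof (cases "\<theta> \<gamma> k ` X = Y")
        case False
        thus ?thesis by (simp add: T_def image_eq)
      next
        case k: True
        have kab: "k a \<noteq> k b"
        proof
          assume eq: "k a = k b"
          obtain r' where r': "r' < D" "\<gamma> (a, 0) = \<gamma> (b, r')" using R_swap(1) [OF D0] by blast
          have "\<theta> \<gamma> k (a, 0) = \<theta> \<gamma> k (b, r')" using r' eq by (simp add: \<theta>_def)
          moreover have "(a, 0) \<in> X" "(b, r') \<in> X" using ab r' D0 by (simp_all add: X_def)
          ultimately have "(a, 0) = (b, r')" by (rule inj_onD [OF inj_\<theta> [OF k]])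
          with ab show False by simp
        qed
        \<comment> \<open>On the cells, exchanging \<open>k a\<close> and \<open>k b\<close> is this permutation.\<close>
        define \<xi> where "\<xi> = (\<lambda>y :: nat \<times> 'n. if fst y \<in> R a then (fst y, Transposition.transpose (k a) (k b) (snd y)) else y)"
        have \<xi>\<xi>: "\<xi> (\<xi> y) = y" for y by (simp add: \<xi>_def)
        have \<xi>: "\<xi> permutes Y"
        proof (rule bij_imp_permutes)
          have "\<xi> y \<in> Y" if "y \<in> Y" for y using that by (auto simp: \<xi>_def Y_def cells_def)
          thus "bij_betw \<xi> Y Y" by (intro bij_betw_byWitness [of _ \<xi>]) (auto simp: \<xi>\<xi>)
          fix y assume "y \<notin> Y"
          hence "fst y \<notin> R a" using R_sub [OF ab(1)] by (cases y) (auto simp: Y_def cells_def)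
          thus "\<xi> y = y" by (simp add: \<xi>_def)
        qed
        have \<theta>_swap: "\<theta> \<gamma> (k \<circ> \<tau>) x = \<xi> (\<theta> \<gamma> k x)" if x: "x \<in> X" for x
        proof -
          obtain c r where cr: "x = (c, r)" "c < N" "r < D" using x by (auto simp: X_def)
          consider "c = a" | "c = b" | "c \<noteq> a" "c \<noteq> b" by blast
          thus ?thesis
          proof cases
            case 1
            have "\<gamma> (a, r) \<in> R a" using cr by (simp add: R_def)
            thus ?thesis using 1 cr by (simp add: \<theta>_def \<xi>_def \<tau>_def)
          next
            case 2
            have "\<gamma> (b, r) \<in> R a" unfolding ab(4) using cr by (simp add: R_def)
            thus ?thesis using 2 cr by (simp add: \<theta>_def \<xi>_def \<tau>_def)
          next
            case 3
            have "k c \<noteq> k d" if d: "d = a \<or> d = b" and m: "\<gamma> (c, r) \<in> R a" for d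
            proof
              assume eq: "k c = k d"
              have "\<gamma> (c, r) \<in> R d" using d m ab(4) by auto
              then obtain r' where r': "r' < D" "\<gamma> (c, r) = \<gamma> (d, r')" unfolding R_def by blast
              have "\<theta> \<gamma> k (c, r) = \<theta> \<gamma> k (d, r')" using r' eq by (simp add: \<theta>_def)
              moreover have "(c, r) \<in> X" "(d, r') \<in> X" using cr r' d ab by (auto simp: X_def)
              ultimately have "(c, r) = (d, r')" by (rule inj_onD [OF inj_\<theta> [OF k]])
              with 3 d show False by auto
            qed
            hence "\<xi> (\<gamma> (c, r), k c) = (\<gamma> (c, r), k c)" by (simp add: \<xi>_def Transposition.transpose_def)
            thus ?thesis using 3 cr by (simp add: \<theta>_def \<tau>_def)
          qed
        qed
        have "T \<gamma> (k \<circ> \<tau>) = (\<Sum>u\<in>Y \<rightarrow>\<^sub>E UNIV. block_sign (2 * D) u *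
            (if \<forall>x\<in>X. (u \<circ> \<xi>) (\<theta> \<gamma> k x) = v x then 1 else 0))"
        proof -
          have "(\<forall>x\<in>X. u (\<theta> \<gamma> (k \<circ> \<tau>) x) = v x) \<longleftrightarrow> (\<forall>x\<in>X. (u \<circ> \<xi>) (\<theta> \<gamma> k x) = v x)" for u
            using \<theta>_swap by simp
          thus ?thesis unfolding T_def image_eq by (simp only: k simp_thms)
        qed
        also have "\<dots> = (\<Sum>u\<in>Y \<rightarrow>\<^sub>E UNIV. block_sign (2 * D) (u \<circ> \<xi>) *
            (if \<forall>x\<in>X. (u \<circ> \<xi> \<circ> \<xi>) (\<theta> \<gamma> k x) = v x then 1 else 0))"
          by (rule sum_reindex_permutes [OF \<xi>, symmetric])
        also have "\<dots> = (\<Sum>u\<in>Y \<rightarrow>\<^sub>E UNIV. - (block_sign (2 * D) u *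
            (if \<forall>x\<in>X. u (\<theta> \<gamma> k x) = v x then 1 else 0)))"
        proof (rule sum.cong [OF refl])
          fix u
          have "block_sign (2 * D) (u \<circ> \<xi>) = - block_sign (2 * D) u"
            using block_sign_swap [OF kab R_sub [OF ab(1)], of u] cardR [OF ab(1)] D
            by (simp add: \<xi>_def o_def)
          thus "block_sign (2 * D) (u \<circ> \<xi>) * (if \<forall>x\<in>X. (u \<circ> \<xi> \<circ> \<xi>) (\<theta> \<gamma> k x) = v x then 1 else 0) =
            - (block_sign (2 * D) u * (if \<forall>x\<in>X. u (\<theta> \<gamma> k x) = v x then 1 else 0))"
            by (simp add: \<xi>\<xi>)
        qed
        also have "\<dots> = - T \<gamma> k" by (simp add: T_def k sum_negf)
        finally show ?thesis .
      qed
      have "\<tau> permutes {..<N}" unfolding \<tau>_def using ab by (intro permutes_swap_id) auto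
      from sum_reindex_permutes [OF this, of "T \<gamma>"]
      have "(\<Sum>k\<in>{..<N} \<rightarrow>\<^sub>E UNIV. T \<gamma> k) = - (\<Sum>k\<in>{..<N} \<rightarrow>\<^sub>E UNIV. T \<gamma> k)"
        unfolding anti by (simp add: sum_negf)
      thus ?thesis by simp
    qed
  qed
  finally show ?thesis by simp
qed

lemma index_det_real: "\<exists>r. index_det x = complex_of_real r"
proof (cases "x permutes UNIV")
  case True
  thus ?thesis by (intro exI [of _ "of_int (sign x)"]) (simp add: index_det_permutes)
next
  case False
  thus ?thesis by (intro exI [of _ 0]) (simp add: index_det_not_inj inj_permutes_UNIV)
qed

lemma block_sign_in_Reals: "block_sign K u \<in> \<real>"
  unfolding block_sign_def
proof (rule prod_in_Reals)
  fix j show "index_det (\<lambda>i. u (j, i)) \<in> \<real>"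
    using index_det_real [of "\<lambda>i. u (j, i)"] by auto
qed

definition column_perms :: "nat \<Rightarrow> (nat \<times> 'n::finite \<Rightarrow> nat \<times> 'n) set" where
  "column_perms K = {\<theta>. \<theta> permutes cells K \<and> (\<forall>y. snd (\<theta> y) = snd y)}"

lemma finite_column_perms: "finite (column_perms K)"
  by (rule finite_subset [OF _ finite_permutations [OF finite_cells [of K]]]) (auto simp: column_perms_def)

lemma column_perms_compose:
  "\<theta> \<in> column_perms K \<Longrightarrow> \<delta> \<in> column_perms K \<Longrightarrow> \<theta> \<circ> \<delta> \<in> column_perms K"
  unfolding column_perms_def mem_Collect_eq by (metis o_apply permutes_compose)

lemma column_perms_inv:
  assumes "\<theta> \<in> column_perms K"
  shows "inv \<theta> \<in> column_perms K"
proof -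
  have \<theta>: "\<theta> permutes cells K" "\<And>y. snd (\<theta> y) = snd y" using assms by (auto simp: column_perms_def)
  have "snd (inv \<theta> y) = snd y" for y
    using \<theta>(2) [of "inv \<theta> y"] permutes_inverses(1) [OF \<theta>(1), of y] by simp
  thus ?thesis using permutes_inv [OF \<theta>(1)] by (auto simp: column_perms_def)
qed

lemma sum_column_perms_translate:
  fixes f :: "(nat \<times> 'n::finite \<Rightarrow> nat \<times> 'n) \<Rightarrow> complex"
  assumes "\<delta> \<in> column_perms K"
  shows "(\<Sum>\<theta>\<in>column_perms K. f (\<delta> \<circ> \<theta>)) = (\<Sum>\<theta>\<in>column_perms K. f \<theta>)"
proof (rule sum.reindex_bij_witness [of _ "\<lambda>\<theta>. inv \<delta> \<circ> \<theta>" "\<lambda>\<theta>. \<delta> \<circ> \<theta>"])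
  have \<delta>: "\<delta> permutes cells K" using assms by (auto simp: column_perms_def)
  fix \<theta> :: "nat \<times> 'n \<Rightarrow> nat \<times> 'n" assume \<theta>: "\<theta> \<in> column_perms K"
  show "inv \<delta> \<circ> (\<delta> \<circ> \<theta>) = \<theta>" "\<delta> \<circ> (inv \<delta> \<circ> \<theta>) = \<theta>"
    using \<delta> by (simp_all add: permutes_inv_o flip: comp_assoc)
  show "\<delta> \<circ> \<theta> \<in> column_perms K" "inv \<delta> \<circ> \<theta> \<in> column_perms K"
    using assms \<theta> by (simp_all add: column_perms_compose column_perms_inv)
qed auto

text \<open>
  This replaces the index set that \<open>polar_word_product\<close> produces by a group.
\<close>

lemma sum_maps_onto_cells:
  fixes G :: "(nat \<times> 'n::finite \<Rightarrow> nat \<times> 'n) \<Rightarrow> complex"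
  assumes "\<And>\<theta> \<theta>'. (\<And>y. y \<in> cells K \<Longrightarrow> \<theta> y = \<theta>' y) \<Longrightarrow> G \<theta> = G \<theta>'"
  shows "(\<Sum>\<gamma>\<in>{\<gamma> \<in> cells K \<rightarrow>\<^sub>E {..<K}. (\<lambda>y. (\<gamma> y, snd y)) ` cells K = (cells K :: (nat \<times> 'n) set)}.
      G (\<lambda>y. (\<gamma> y, snd y))) = (\<Sum>\<theta>\<in>column_perms K. G \<theta>)"
proof -
  let ?Y = "cells K :: (nat \<times> 'n) set"
  define j where "j = (\<lambda>\<gamma> (y :: nat \<times> 'n). if y \<in> ?Y then (\<gamma> y :: nat, snd y) else y)"
  define i where "i = (\<lambda>\<theta> :: nat \<times> 'n \<Rightarrow> nat \<times> 'n. restrict (\<lambda>y. fst (\<theta> y)) ?Y)"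
  show ?thesis
  proof (rule sum.reindex_bij_witness [of _ i j])
    fix \<gamma> :: "nat \<times> 'n \<Rightarrow> nat" assume "\<gamma> \<in> {\<gamma> \<in> ?Y \<rightarrow>\<^sub>E {..<K}. (\<lambda>y. (\<gamma> y, snd y)) ` ?Y = ?Y}"
    hence \<gamma>: "\<gamma> \<in> ?Y \<rightarrow>\<^sub>E {..<K}" "(\<lambda>y. (\<gamma> y, snd y)) ` ?Y = ?Y" by blast+
    show "i (j \<gamma>) = \<gamma>"
      unfolding i_def j_def using \<gamma>(1) by (intro ext) (auto simp: PiE_def extensional_def)
    have im: "j \<gamma> ` ?Y = ?Y" using \<gamma>(2) by (simp add: j_def cong: image_cong)
    hence "bij_betw (j \<gamma>) ?Y ?Y"
      by (simp add: bij_betw_def eq_card_imp_inj_on)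
    hence "j \<gamma> permutes ?Y" by (rule bij_imp_permutes) (simp add: j_def)
    thus "j \<gamma> \<in> column_perms K" by (simp add: column_perms_def j_def)
    show "G (j \<gamma>) = G (\<lambda>y. (\<gamma> y, snd y))" by (rule assms) (simp add: j_def)
  next
    fix \<theta> :: "nat \<times> 'n \<Rightarrow> nat \<times> 'n" assume "\<theta> \<in> column_perms K"
    hence \<theta>: "\<theta> permutes ?Y" "\<And>y. snd (\<theta> y) = snd y" by (auto simp: column_perms_def)
    have eq: "(i \<theta> y, snd y) = \<theta> y" if "y \<in> ?Y" for y
      using that \<theta>(2) [of y] by (simp add: i_def prod_eq_iff)
    show "j (i \<theta>) = \<theta>"
    proof
      fix y show "j (i \<theta>) y = \<theta> y"
        using eq [of y] permutes_not_in [OF \<theta>(1), of y] by (simp add: j_def)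
    qed
    have mem: "\<theta> y \<in> ?Y" if "y \<in> ?Y" for y using that permutes_in_image [OF \<theta>(1)] by blast
    have fst_less: "fst z < K" if "z \<in> ?Y" for z using that by (auto simp: cells_def)
    have "i \<theta> \<in> ?Y \<rightarrow>\<^sub>E {..<K}"
      unfolding i_def using fst_less [OF mem] by (simp add: restrict_PiE_iff)
    moreover have "(\<lambda>y. (i \<theta> y, snd y)) ` ?Y = \<theta> ` ?Y"
      by (rule image_cong [OF refl]) (rule eq)
    ultimately show "i \<theta> \<in> {\<gamma> \<in> ?Y \<rightarrow>\<^sub>E {..<K}. (\<lambda>y. (\<gamma> y, snd y)) ` ?Y = ?Y}"
      using permutes_image [OF \<theta>(1)] by simp
  qed
qed

lemma block_sign_expand:
  fixes u :: "nat \<times> 'n::finite \<Rightarrow> 'n"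
  shows "block_sign K u = (\<Sum>\<sigma>\<in>{..<K} \<rightarrow>\<^sub>E {p. p permutes UNIV}. (\<Prod>j<K. of_int (sign (\<sigma> j))) *
      (if \<forall>y\<in>cells K. u y = \<sigma> (fst y) (snd y) then 1 else 0))"
proof -
  have "block_sign K u = (\<Sum>\<sigma>\<in>{..<K} \<rightarrow>\<^sub>E {p. p permutes UNIV}.
      \<Prod>j<K. of_int (sign (\<sigma> j)) * (if \<forall>i. u (j, i) = \<sigma> j i then 1 else 0))"
    unfolding block_sign_def index_det_expand by (rule prod_sum_PiE) (auto simp: finite_permutations)
  also have "\<dots> = (\<Sum>\<sigma>\<in>{..<K} \<rightarrow>\<^sub>E {p. p permutes UNIV}. (\<Prod>j<K. of_int (sign (\<sigma> j))) *
      (if \<forall>y\<in>cells K. u y = \<sigma> (fst y) (snd y) then 1 else 0))"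
  proof (rule sum.cong [OF refl])
    fix \<sigma> :: "nat \<Rightarrow> 'n \<Rightarrow> 'n"
    have eq: "(\<Prod>j<K. if \<forall>i. u (j, i) = \<sigma> j i then 1 else 0 :: complex) =
        (if \<forall>y\<in>cells K. u y = \<sigma> (fst y) (snd y) then 1 else 0)"
    proof (cases "\<forall>j<K. \<forall>i. u (j, i) = \<sigma> j i")
      case True
      hence "\<forall>y\<in>cells K. u y = \<sigma> (fst y) (snd y)" by (auto simp: cells_def)
      thus ?thesis using True by simp
    next
      case False
      then obtain j i where ji: "j < K" "u (j, i) \<noteq> \<sigma> j i" by blast
      hence "(\<Prod>j<K. if \<forall>i. u (j, i) = \<sigma> j i then 1 else 0 :: complex) = 0"
        by (intro prod_zero bexI [of _ j]) auto
      moreover have "\<not> (\<forall>y\<in>cells K. u y = \<sigma> (fst y) (snd y))"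
        using ji by (auto simp: cells_def intro!: bexI [of _ "(j, i)"])
      ultimately show ?thesis by (simp only: if_False)
    qed
    show "(\<Prod>j<K. of_int (sign (\<sigma> j)) * (if \<forall>i. u (j, i) = \<sigma> j i then 1 else 0)) =
      (\<Prod>j<K. of_int (sign (\<sigma> j))) * (if \<forall>y\<in>cells K. u y = \<sigma> (fst y) (snd y) then 1 else (0 :: complex))"
      unfolding prod.distrib eq ..
  qed
  finally show ?thesis .
qed

text \<open>
  Polarizing \<open>det ^ K\<close> at \<open>u\<close> yields the sum of the signs of the rearrangements of \<open>u\<close> within the
  columns. As these rearrangements form a group, one may also symmetrize the other factor of
  \<^const>\<open>omega_process\<close>, and the value becomes, up to sign and a positive factor, a sum of squares of
  real numbers. The word \<open>u (j, i) = i\<close>, which is fixed by the group, contributes a nonzero square.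
\<close>

lemma omega_det_power:
  "omega_process K (\<lambda>h :: complex^'n^'n::finite. det h ^ K) \<noteq> 0"
proof -
  define Y where "Y = (cells K :: (nat \<times> 'n) set)"
  define P where "P = {p :: 'n \<Rightarrow> 'n. p permutes UNIV}"
  define S where "S = (\<lambda>u :: nat \<times> 'n \<Rightarrow> 'n. \<Sum>\<theta>\<in>column_perms K. block_sign K (u \<circ> \<theta>))"
  have finP: "finite P" by (simp add: P_def finite_permutations)
  have finY: "finite Y" by (simp add: Y_def)
  have det: "det h ^ K = (\<Sum>\<sigma>\<in>{..<K} \<rightarrow>\<^sub>E P. (\<Prod>j<K. of_int (sign (\<sigma> j))) *
      (\<Prod>y\<in>Y. h $ \<sigma> (fst y) (snd y) $ snd y))" for h :: "complex^'n^'n"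
  proof -
    have "det h ^ K = det (Finite_Cartesian_Product.transpose h) ^ K" by (simp add: det_transpose)
    also have "\<dots> = (\<Prod>j<K. \<Sum>p\<in>P. of_int (sign p) * (\<Prod>i\<in>UNIV. h $ p i $ i))"
      by (simp add: det_def P_def Finite_Cartesian_Product.transpose_def)
    also have "\<dots> = (\<Sum>\<sigma>\<in>{..<K} \<rightarrow>\<^sub>E P. \<Prod>j<K. of_int (sign (\<sigma> j)) * (\<Prod>i\<in>UNIV. h $ \<sigma> j i $ i))"
      by (rule prod_sum_PiE) (auto simp: finP)
    also have "\<dots> = (\<Sum>\<sigma>\<in>{..<K} \<rightarrow>\<^sub>E P. (\<Prod>j<K. of_int (sign (\<sigma> j))) *
        (\<Prod>y\<in>Y. h $ \<sigma> (fst y) (snd y) $ snd y))"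
      by (simp add: prod.distrib Y_def cells_def prod.cartesian_product case_prod_unfold)
    finally show ?thesis .
  qed
  define \<Gamma> where "\<Gamma> = {\<gamma> \<in> Y \<rightarrow>\<^sub>E {..<K}. (\<lambda>y. (\<gamma> y, snd y)) ` Y = Y}"
  have fin\<Gamma>: "finite (Y \<rightarrow>\<^sub>E {..<K})" using finY by (intro finite_PiE) auto
  have polar: "polar K (\<lambda>h. det h ^ K) u = (-1) ^ card Y * S u" for u :: "nat \<times> 'n \<Rightarrow> 'n"
  proof -
    have "polar K (\<lambda>h. det h ^ K) u = (\<Sum>\<sigma>\<in>{..<K} \<rightarrow>\<^sub>E P. (\<Prod>j<K. of_int (sign (\<sigma> j))) * ((-1) ^ card Y *
        (\<Sum>\<gamma>\<in>Y \<rightarrow>\<^sub>E {..<K}. if (\<lambda>y. (\<gamma> y, snd y)) ` Y = Y \<and> (\<forall>y\<in>Y. u (\<gamma> y, snd y) = \<sigma> (fst y) (snd y)) then 1 else 0)))"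
      unfolding det polar_sum polar_scale polar_word_product [OF finY] Y_def [symmetric] ..
    also have "\<dots> = (\<Sum>\<sigma>\<in>{..<K} \<rightarrow>\<^sub>E P. \<Sum>\<gamma>\<in>Y \<rightarrow>\<^sub>E {..<K}. (-1) ^ card Y *
        (if (\<lambda>y. (\<gamma> y, snd y)) ` Y = Y then (\<Prod>j<K. of_int (sign (\<sigma> j))) *
          (if \<forall>y\<in>Y. u (\<gamma> y, snd y) = \<sigma> (fst y) (snd y) then 1 else 0) else 0))"
      unfolding sum_distrib_left by (intro sum.cong refl) simp
    also have "\<dots> = (\<Sum>\<gamma>\<in>Y \<rightarrow>\<^sub>E {..<K}. (-1) ^ card Y *
        (if (\<lambda>y. (\<gamma> y, snd y)) ` Y = Y then block_sign K (\<lambda>y. u (\<gamma> y, snd y)) else 0))"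
      unfolding block_sign_expand P_def [symmetric] Y_def [symmetric]
      by (subst sum.swap) (auto simp: sum_distrib_left intro!: sum.cong)
    also have "\<dots> = (-1) ^ card Y * (\<Sum>\<gamma>\<in>\<Gamma>. block_sign K (u \<circ> (\<lambda>y. (\<gamma> y, snd y))))"
      unfolding \<Gamma>_def sum_distrib_left [symmetric] by (simp add: sum.inter_filter [OF fin\<Gamma>] o_def)
    also have "(\<Sum>\<gamma>\<in>\<Gamma>. block_sign K (u \<circ> (\<lambda>y. (\<gamma> y, snd y)))) = S u"
      unfolding \<Gamma>_def S_def Y_def
      by (rule sum_maps_onto_cells) (rule block_sign_cong, simp)
    finally show ?thesis .
  qed
  define Q where "Q = (\<Sum>u\<in>Y \<rightarrow>\<^sub>E UNIV. block_sign K u * S u)"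
  have omega_process: "omega_process K (\<lambda>h :: complex^'n^'n. det h ^ K) = (-1) ^ card Y * Q"
    unfolding omega_process_def polar Q_def Y_def [symmetric] sum_distrib_left
    by (intro sum.cong refl) (simp only: mult.left_commute)
  have S_inv: "S (u \<circ> \<delta>) = S u" if "\<delta> \<in> column_perms K" for u \<delta>
    using sum_column_perms_translate [OF that, of "\<lambda>\<theta>. block_sign K (u \<circ> \<theta>)"]
    by (simp add: S_def comp_assoc)
  have "of_nat (card (column_perms K :: (nat \<times> 'n \<Rightarrow> _) set)) * Q =
      (\<Sum>\<delta>\<in>column_perms K. \<Sum>u\<in>Y \<rightarrow>\<^sub>E UNIV. block_sign K (u \<circ> \<delta>) * S (u \<circ> \<delta>))"
  proof -
    have "(\<Sum>u\<in>Y \<rightarrow>\<^sub>E UNIV. block_sign K (u \<circ> \<delta>) * S (u \<circ> \<delta>)) = Q" if "\<delta> \<in> column_perms K" for \<delta>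
      unfolding Q_def using that
      by (intro sum_reindex_permutes [of \<delta> Y "\<lambda>u. block_sign K u * S u"]) (auto simp: column_perms_def Y_def)
    thus ?thesis by simp
  qed
  also have "\<dots> = (\<Sum>\<delta>\<in>column_perms K. \<Sum>u\<in>Y \<rightarrow>\<^sub>E UNIV. block_sign K (u \<circ> \<delta>) * S u)"
    by (intro sum.cong refl) (simp only: S_inv)
  also have "\<dots> = (\<Sum>u\<in>Y \<rightarrow>\<^sub>E UNIV. S u ^ 2)"
    by (subst sum.swap) (simp add: S_def power2_eq_square sum_distrib_right)
  also have "\<dots> = (\<Sum>u\<in>Y \<rightarrow>\<^sub>E UNIV. complex_of_real (Re (S u) ^ 2))"
  proof (rule sum.cong [OF refl])
    fix u show "S u ^ 2 = complex_of_real (Re (S u) ^ 2)"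
    proof -
      have "S u \<in> \<real>" unfolding S_def by (intro sum_in_Reals block_sign_in_Reals)
      thus ?thesis by (simp add: of_real_Re)
    qed
  qed
  also have "\<dots> = complex_of_real (\<Sum>u\<in>Y \<rightarrow>\<^sub>E UNIV. Re (S u) ^ 2)" by simp
  also have "\<dots> \<noteq> 0"
  proof -
    define u0 where "u0 = restrict snd Y"
    have u0: "u0 \<in> Y \<rightarrow>\<^sub>E UNIV" by (simp add: u0_def restrict_PiE_iff)
    have "block_sign K (u0 \<circ> \<theta>) = 1" if "\<theta> \<in> column_perms K" for \<theta>
    proof -
      have \<theta>: "\<theta> permutes Y" "\<And>y. snd (\<theta> y) = snd y" using that by (auto simp: column_perms_def Y_def)
      have "block_sign K (u0 \<circ> \<theta>) = block_sign K (snd :: nat \<times> 'n \<Rightarrow> 'n)"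
      proof (rule block_sign_cong)
        fix y :: "nat \<times> 'n" assume "y \<in> cells K"
        hence "\<theta> y \<in> Y" using permutes_in_image [OF \<theta>(1)] by (simp add: Y_def)
        thus "(u0 \<circ> \<theta>) y = snd y" by (simp add: u0_def \<theta>(2))
      qed
      thus ?thesis by (simp add: block_sign_def index_det_id)
    qed
    hence "S u0 = of_nat (card (column_perms K :: (nat \<times> 'n \<Rightarrow> _) set))" by (simp add: S_def)
    moreover have "id \<in> (column_perms K :: (nat \<times> 'n \<Rightarrow> _) set)" by (simp add: column_perms_def permutes_id)
    hence "card (column_perms K :: (nat \<times> 'n \<Rightarrow> nat \<times> 'n) set) > 0"
      using finite_column_perms card_gt_0_iff by blast
    ultimately have "Re (S u0) ^ 2 > 0" by simp
    also have "Re (S u0) ^ 2 \<le> (\<Sum>u\<in>Y \<rightarrow>\<^sub>E UNIV. Re (S u) ^ 2)"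
      using finY u0 by (intro member_le_sum) (auto intro: finite_PiE)
    finally have "(\<Sum>u\<in>Y \<rightarrow>\<^sub>E UNIV. Re (S u) ^ 2) \<noteq> 0" by simp
    thus ?thesis by (simp only: of_real_eq_0_iff not_False_eq_True)
  qed
  finally have "Q \<noteq> 0" by auto
  thus ?thesis by (simp add: omega_process)
qed

section \<open>The absence of invariants of degree 2m\<close>

definition shift_matrix :: "complex^'n^'n::finite \<Rightarrow> complex \<Rightarrow> complex^'n^'n" where
  "shift_matrix A s = (\<chi> i j. A $ i $ j + (if i = j then s else 0))"

text \<open>
  The determinant of \<open>1 + s A\<close> is a polynomial in \<open>s\<close> with the value 1 at \<open>0\<close>, so it has finitely many
  zeros; apart from \<open>0\<close>, the singular shifts are their inverses.
\<close>

lemma finite_singular_shifts: "finite {s. det (shift_matrix A s) = 0}"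
proof -
  define q where "q = (\<Sum>p\<in>{p. p permutes (UNIV :: 'a set)}. of_int (sign p) *
    (\<Prod>i\<in>UNIV. [:if i = p i then 1 else 0, A $ i $ p i:]))"
  have q: "poly q s = det (\<chi> i j. (if i = j then 1 else 0) + s * A $ i $ j)" for s
    unfolding q_def det_def by (simp add: poly_sum poly_prod of_int_poly)
  have "poly q 0 = det (mat 1 :: complex^'a^'a)"
    unfolding q by (rule arg_cong [of _ _ det]) (simp add: mat_def vec_eq_iff)
  hence "q \<noteq> 0" by auto
  hence fin: "finite {x. poly q x = 0}" by (rule poly_roots_finite)
  have "{s. det (shift_matrix A s) = 0} \<subseteq> insert 0 (inverse ` {x. poly q x = 0})"
  proof
    fix s assume s: "s \<in> {s. det (shift_matrix A s) = 0}"
    show "s \<in> insert 0 (inverse ` {x. poly q x = 0})"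
    proof (cases "s = 0")
      case False
      have "shift_matrix A s = (\<chi> i. s *s (\<chi> j. (if i = j then 1 else 0) + inverse s * A $ i $ j))"
        using False by (simp add: shift_matrix_def vec_eq_iff distrib_left)
      also have "det \<dots> = s ^ CARD('a) * poly q (inverse s)"
        using det_rows_mul [of "\<lambda>_. s" "\<lambda>i. \<chi> j. (if i = j then 1 else 0) + inverse s * A $ i $ j"] by (simp add: q)
      finally have "poly q (inverse s) = 0" using s False by simp
      thus ?thesis by (intro insertI2 image_eqI [of _ _ "inverse s"]) auto
    qed simp
  qed
  thus ?thesis by (rule finite_subset) (simp add: fin)
qed

text \<open>
  The matrices used in the omega process may be singular. Shifting a matrix by a multiple of the
  identity makes it invertible for all but finitely many multiples.
\<close>

lemma vanishing_extends_to_singular_matrices: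
  fixes F :: "complex^'n^'n::finite \<Rightarrow> complex"
  assumes cont: "isCont (\<lambda>s. F (shift_matrix A s)) 0" and zero: "\<And>h. det h \<noteq> 0 \<Longrightarrow> F h = 0"
  shows "F A = 0"
proof -
  define S where "S = {s. det (shift_matrix A s) = 0} - {0}"
  have "finite S" unfolding S_def using finite_singular_shifts by (rule finite_Diff)
  hence "open (- S)" by (intro open_Compl finite_imp_closed)
  hence "\<forall>\<^sub>F s in at 0. s \<in> - S" by (rule eventually_at_in_open') (simp add: S_def)
  moreover have "\<forall>\<^sub>F s in at (0 :: complex). s \<noteq> 0" by (rule eventually_neq_at_within)
  ultimately have "\<forall>\<^sub>F s in at 0. F (shift_matrix A s) = 0"
    by eventually_elim (auto simp: S_def intro: zero)
  hence "((\<lambda>s. F (shift_matrix A s)) \<longlongrightarrow> 0) (at 0)" by (rule tendsto_eventually)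
  moreover have "((\<lambda>s. F (shift_matrix A s)) \<longlongrightarrow> F (shift_matrix A 0)) (at 0)"
    using cont by (simp add: isCont_def)
  ultimately have "F (shift_matrix A 0) = 0" by (rule LIM_unique [rotated])
  moreover have "shift_matrix A 0 = A" by (simp add: shift_matrix_def vec_eq_iff)
  ultimately show ?thesis by simp
qed

lemma isCont_shift_entry: "isCont (\<lambda>s. shift_matrix A s $ i $ j) x"
  unfolding shift_matrix_def by (cases "i = j") simp_all

lemma isCont_det_shift: "isCont (\<lambda>s. det (shift_matrix A s)) x"
  unfolding det_def by (intro continuous_intros isCont_shift_entry)

text \<open>
  Extracts the part of degree \<open>N\<close> from a sum of homogeneous parts that scales like this part.
\<close>

lemma homogeneous_part_eq:
  fixes c :: "'k \<Rightarrow> complex" and d :: "'k \<Rightarrow> nat"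
  assumes "finite I" and eq: "\<And>t. t \<noteq> 0 \<Longrightarrow> (\<Sum>M\<in>I. c M * t ^ d M) = t ^ N * P"
  shows "(\<Sum>M\<in>{M \<in> I. d M = N}. c M) = P"
proof -
  define q where "q = (\<Sum>M\<in>I. monom (c M) (d M)) - monom P N"
  have "poly q t = 0" if "t \<noteq> 0" for t
    using eq [OF that] by (simp add: q_def poly_sum poly_monom mult.commute)
  hence "UNIV - {0} \<subseteq> {t. poly q t = 0}" by auto
  moreover have "infinite (UNIV - {0 :: complex})" by (simp add: infinite_UNIV_char_0)
  ultimately have "infinite {t. poly q t = 0}" using finite_subset by blast
  hence "q = 0" using poly_roots_finite by blast
  hence "coeff q N = 0" by simp
  thus ?thesis using assms(1) by (simp add: q_def coeff_sum sum.inter_filter)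
qed

lemma monomial_on_orbit:
  fixes M :: "'n::finite monom monom"
  assumes "monom_degree M = N"
  obtains e :: complex and v :: "nat \<times> nat \<Rightarrow> 'n" where
    "\<And>h. monom_val (Poly_Mapping.lookup (act h (fermat D))) M =
       e * (\<Prod>a<N. \<Sum>c\<in>UNIV. \<Prod>r<D. h $ v (a, r) $ c)"
proof -
  obtain \<mu> where \<mu>: "M = word_monom {..<N} \<mu>" using monom_eq_word [OF assms] by blast
  define e :: complex where "e = (\<Prod>a<N. of_nat (word_count D (\<mu> a)))"
  have val: "monom_val (Poly_Mapping.lookup (act h (fermat D))) M =
      e * (\<Prod>a<N. \<Sum>c\<in>UNIV. monom_val (\<lambda>j. h $ j $ c) (\<mu> a))" for h :: "complex^'n^'n"
    by (simp add: \<mu> monom_val_word lookup_act_fermat prod.distrib e_def)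
  show ?thesis
  proof (cases "\<forall>a<N. monom_degree (\<mu> a) = D")
    case True
    hence "\<forall>a. \<exists>u. a < N \<longrightarrow> \<mu> a = word_monom {..<D} u" using monom_eq_word by blast
    then obtain u where u: "\<And>a. a < N \<Longrightarrow> \<mu> a = word_monom {..<D} (u a)" by metis
    show ?thesis
    proof (rule that [of e "\<lambda>(a, r). u a r"])
      fix h :: "complex^'n^'n"
      show "monom_val (Poly_Mapping.lookup (act h (fermat D))) M =
         e * (\<Prod>a<N. \<Sum>c\<in>UNIV. \<Prod>r<D. h $ (case (a, r) of (a, r) \<Rightarrow> u a r) $ c)"
        unfolding val by (simp add: u monom_val_word)
    qed
  next
    case False
    then obtain a where a: "a < N" "word_count D (\<mu> a) = 0" using word_count_eq_0 by blast
    hence "e = 0" unfolding e_def by (intro prod_zero) auto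
    thus ?thesis by (intro that [of 0]) (simp add: val)
  qed
qed

text \<open>
  By homogeneity only the part of \<open>p\<close> of degree \<open>2 m\<close> matters. On the orbit it is a combination of
  products of \<open>2 m\<close> power sums, so the omega process annihilates it, whereas it does not annihilate
  \<open>det ^ (2 D)\<close>.
\<close>

lemma no_semiinvariant_of_double_degree:
  fixes p :: "('n::finite monom, complex) mpoly"
  assumes D: "odd D" and big: "2 * CARD('n) > (2 * D) choose D"
    and semi: "\<And>g. det g \<noteq> 0 \<Longrightarrow> eval_at_form p (act g (fermat D)) = det g ^ (2 * D) * z"
    and hom: "\<And>g t. det g \<noteq> 0 \<Longrightarrow> t \<noteq> 0 \<Longrightarrow>
       eval_at_form p (Const t * act g (fermat D)) = t ^ (2 * CARD('n)) * eval_at_form p (act g (fermat D))"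
  shows "z = 0"
proof -
  define N where "N = 2 * CARD('n)"
  define I where "I = {M \<in> Poly_Mapping.keys p. monom_degree M = N}"
  define c where "c = Poly_Mapping.lookup p"
  have "\<forall>M. \<exists>e v. monom_degree M = N \<longrightarrow> (\<forall>h. monom_val (Poly_Mapping.lookup (act h (fermat D))) M =
       e * (\<Prod>a<N. \<Sum>c\<in>UNIV. \<Prod>r<D. h $ (v :: nat \<times> nat \<Rightarrow> 'n) (a, r) $ c))"
    using monomial_on_orbit [where D = D and N = N] by metis
  then obtain e v where ev: "\<And>M h. monom_degree M = N \<Longrightarrow> monom_val (Poly_Mapping.lookup (act h (fermat D))) M =
       e M * (\<Prod>a<N. \<Sum>c\<in>UNIV. \<Prod>r<D. h $ (v M :: nat \<times> nat \<Rightarrow> 'n) (a, r) $ c)"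
    by metis
  define F where "F = (\<lambda>h :: complex^'n^'n. \<Sum>M\<in>I. (c M * e M) * (\<Prod>a<N. \<Sum>c\<in>UNIV. \<Prod>r<D. h $ v M (a, r) $ c))"
  have F_inv: "F h = det h ^ (2 * D) * z" if h: "det h \<noteq> 0" for h
  proof -
    let ?f = "act h (fermat D) :: ('n, complex) mpoly"
    have val: "eval_at_form p (Const t * ?f) = (\<Sum>M\<in>Poly_Mapping.keys p. (c M * monom_val (Poly_Mapping.lookup ?f) M) * t ^ monom_degree M)" for t
    proof -
      have "monom_val (Poly_Mapping.lookup (Const t * ?f)) M = t ^ monom_degree M * monom_val (Poly_Mapping.lookup ?f) M" for M
        by (simp add: monom_val_def lookup_Const_mult power_mult_distrib prod.distrib monom_degree_def power_sum)
      thus ?thesis unfolding eval_at_form_def insertion_eq_monom_val c_def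
        by (intro sum.cong refl) simp
    qed
    have "(\<Sum>M\<in>I. c M * monom_val (Poly_Mapping.lookup ?f) M) = eval_at_form p ?f"
      unfolding I_def
      by (rule homogeneous_part_eq) (use hom [OF h] in \<open>simp_all add: N_def flip: val\<close>)
    moreover have "(\<Sum>M\<in>I. c M * monom_val (Poly_Mapping.lookup ?f) M) = F h"
      unfolding F_def by (intro sum.cong refl) (simp add: I_def ev)
    ultimately show ?thesis using semi [OF h] by simp
  qed
  have F_all: "F h = z * det h ^ (2 * D)" for h
  proof -
    have "F h - z * det h ^ (2 * D) = 0"
    proof (rule vanishing_extends_to_singular_matrices [of "\<lambda>h. F h - z * det h ^ (2 * D)" h])
      show "isCont (\<lambda>s. F (shift_matrix h s) - z * det (shift_matrix h s) ^ (2 * D)) 0"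
      proof (intro continuous_intros isCont_det_shift)
        show "isCont (\<lambda>s. F (shift_matrix h s)) 0"
          unfolding F_def by (intro continuous_intros isCont_shift_entry)
      qed
    qed (simp add: F_inv)
    thus ?thesis by simp
  qed
  have "omega_process (2 * D) F = 0"
  proof -
    have "N * D = 2 * D * CARD('n)" by (simp add: N_def)
    from omega_power_sum_product [OF D this big [folded N_def]] show ?thesis
      unfolding F_def omega_sum omega_scale by simp
  qed
  moreover have "omega_process (2 * D) F = z * omega_process (2 * D) (\<lambda>h :: complex^'n^'n. det h ^ (2 * D))"
    unfolding omega_scale [symmetric] using F_all by (intro arg_cong [of _ _ "omega_process (2 * D)"] ext)
  ultimately show ?thesis using omega_det_power [of "2 * D", where 'n = 'n] by simp
qed

section \<open>Hadamard's inequality\<close>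

lemma norm_square_vec: "(norm (x :: complex^'n::finite))\<^sup>2 = (\<Sum>j\<in>UNIV. (cmod (x $ j))\<^sup>2)"
  by (simp add: norm_vec_def L2_set_def sum_nonneg)

lemma det_cnj: "det (\<chi> i j. cnj (A $ i $ j)) = cnj (det (A :: complex^'n^'n::finite))"
  unfolding det_def by (simp add: cnj_sum cnj_prod)

text \<open>
  On the compact set of matrices with rows of norm at most 1 let \<open>\<bar>det\<bar>\<close> be maximal at \<open>B\<close>, with a
  value above 1. The rows of \<open>B\<close> are then orthonormal: subtracting from a row its projection to
  another row preserves the determinant, and if this made the row shorter, it could be scaled up to
  increase the determinant. But an orthonormal matrix has a determinant of modulus 1.
\<close>

lemma hadamard:
  fixes A :: "complex^'n^'n::finite"
  assumes "\<And>i. norm (A $ i) \<le> 1"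
  shows "cmod (det A) \<le> 1"
proof -
  define K where "K = {A :: complex^'n^'n. \<forall>i. norm (A $ i) \<le> 1}"
  have "bounded K"
  proof (rule boundedI)
    fix A assume "A \<in> K"
    have "norm A \<le> (\<Sum>i\<in>UNIV. norm (A $ i))"
      unfolding norm_vec_def by (rule L2_set_le_sum) simp
    also have "\<dots> \<le> (\<Sum>i\<in>(UNIV :: 'n set). 1)"
      using \<open>A \<in> K\<close> by (intro sum_mono) (simp add: K_def)
    finally show "norm A \<le> real CARD('n)" by simp
  qed
  moreover have "closed K"
    unfolding K_def by (intro closed_Collect_all closed_Collect_le continuous_intros)
  ultimately have "compact K" by (simp add: compact_eq_bounded_closed)
  moreover have "A \<in> K" using assms by (simp add: K_def)
  hence "K \<noteq> {}" by blast
  moreover have "continuous_on K (\<lambda>A. cmod (det A))"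
    unfolding det_def by (intro continuous_intros)
  ultimately obtain B where B: "B \<in> K" "\<And>A. A \<in> K \<Longrightarrow> cmod (det A) \<le> cmod (det B)"
    using continuous_attains_sup [of K "\<lambda>A. cmod (det A)"] by blast
  show ?thesis
  proof (rule ccontr)
    assume "\<not> ?thesis"
    hence large: "cmod (det B) > 1" using B(2) [OF \<open>A \<in> K\<close>] by linarith
    hence nz: "det B \<noteq> 0" by auto
    \<comment> \<open>Replacing a row without changing the determinant cannot shorten it.\<close>
    have long: "norm x \<ge> 1" if x: "det (\<chi> k. if k = i then x else B $ k) = det B" for i x
    proof (rule ccontr)
      assume short: "\<not> norm x \<ge> 1"
      have "x \<noteq> 0"
      proof
        assume "x = 0"
        hence "det (\<chi> k. if k = i then x else B $ k) = 0"
          by (intro det_zero_row(1) [of i]) (simp add: row_def vec_eq_iff)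
        with x nz show False by simp
      qed
      define c where "c = complex_of_real (inverse (norm x))"
      have "(\<chi> k. if k = i then c *s x else B $ k) \<in> K"
      proof -
        have "(norm (c *s x))\<^sup>2 = (inverse (norm x))\<^sup>2 * (norm x)\<^sup>2"
          unfolding norm_square_vec sum_distrib_left
          by (intro sum.cong refl) (simp add: c_def norm_mult power_mult_distrib norm_inverse)
        hence "(norm (c *s x))\<^sup>2 = 1" using \<open>x \<noteq> 0\<close> by (simp add: field_simps)
        hence "norm (c *s x) = 1" by (simp add: power2_eq_1_iff) (metis norm_ge_zero not_one_le_zero neg_0_le_iff_le zero_le_one)
        thus ?thesis using B(1) by (simp add: K_def)
      qed
      hence "cmod (det (\<chi> k. if k = i then c *s x else B $ k)) \<le> cmod (det B)" by (rule B(2))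
      also have "det (\<chi> k. if k = i then c *s x else B $ k) = c * det B"
        using det_row_mul [of i c "\<lambda>_. x" "\<lambda>k. B $ k"] x by simp
      finally have "inverse (norm x) * cmod (det B) \<le> cmod (det B)"
        by (simp add: norm_mult c_def norm_inverse)
      moreover have "1 < inverse (norm x)"
        using short \<open>x \<noteq> 0\<close> by (intro one_less_inverse) simp_all
      hence "1 * cmod (det B) < inverse (norm x) * cmod (det B)"
        by (rule mult_strict_right_mono) (use nz in simp)
      ultimately show False by simp
    qed
    have unit: "norm (B $ i) = 1" for i
    proof -
      have "(\<chi> k. if k = i then B $ i else B $ k) = B" by (simp add: vec_eq_iff)
      hence "norm (B $ i) \<ge> 1" by (intro long [of i]) simp
      moreover have "norm (B $ i) \<le> 1" using B(1) by (simp add: K_def)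
      ultimately show ?thesis by simp
    qed
    have self: "(\<Sum>j\<in>UNIV. B $ i $ j * cnj (B $ i $ j)) = 1" for i
    proof -
      have "(\<Sum>j\<in>UNIV. B $ i $ j * cnj (B $ i $ j)) = of_real ((norm (B $ i))\<^sup>2)"
        unfolding norm_square_vec of_real_sum complex_norm_square ..
      thus ?thesis by (simp add: unit)
    qed
    have orth: "(\<Sum>j\<in>UNIV. B $ i $ j * cnj (B $ k $ j)) = 0" if "i \<noteq> k" for i k
    proof -
      define s where "s = (\<Sum>j\<in>UNIV. B $ i $ j * cnj (B $ k $ j))"
      define x where "x = B $ i + (- s) *s B $ k"
      have cnj_s: "(\<Sum>j\<in>UNIV. B $ k $ j * cnj (B $ i $ j)) = cnj s"
        by (simp add: s_def cnj_sum mult.commute)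
      have "det (\<chi> l. if l = i then row i B + (- s) *s row k B else row l B) = det B"
        by (rule det_row_operation [OF that])
      moreover have row: "row l B = B $ l" for l by (simp add: row_def vec_lambda_eta)
      ultimately have "det (\<chi> l. if l = i then x else B $ l) = det B" unfolding x_def row by (simp only:)
      hence "norm x \<ge> 1" by (rule long)
      have "of_real ((norm x)\<^sup>2) = (\<Sum>j\<in>UNIV. x $ j * cnj (x $ j))"
        unfolding norm_square_vec of_real_sum complex_norm_square ..
      also have "\<dots> = (\<Sum>j\<in>UNIV. B $ i $ j * cnj (B $ i $ j)) - s * (\<Sum>j\<in>UNIV. B $ k $ j * cnj (B $ i $ j))
          - cnj s * (\<Sum>j\<in>UNIV. B $ i $ j * cnj (B $ k $ j)) + s * cnj s * (\<Sum>j\<in>UNIV. B $ k $ j * cnj (B $ k $ j))"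
        unfolding sum_distrib_left sum_subtractf [symmetric] sum.distrib [symmetric]
        by (intro sum.cong refl) (simp add: x_def algebra_simps)
      also have "\<dots> = 1 - s * cnj s"
        unfolding self cnj_s s_def [symmetric] by (simp add: algebra_simps)
      also have "\<dots> = of_real (1 - (cmod s)\<^sup>2)"
        unfolding of_real_diff complex_norm_square by simp
      finally have "(norm x)\<^sup>2 = 1 - (cmod s)\<^sup>2" by (simp only: of_real_eq_iff)
      moreover have "(norm x)\<^sup>2 \<ge> 1" using \<open>norm x \<ge> 1\<close> by simp
      ultimately have "(cmod s)\<^sup>2 \<le> 0" by linarith
      thus ?thesis by (simp add: s_def)
    qed
    have "B ** Finite_Cartesian_Product.transpose (\<chi> i j. cnj (B $ i $ j)) = mat 1"
      unfolding matrix_matrix_mult_def Finite_Cartesian_Product.transpose_def mat_def vec_eq_iff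
      using self orth by simp
    hence "det B * cnj (det B) = 1"
      by (metis det_mul det_transpose det_cnj det_I)
    hence "(cmod (det B))\<^sup>2 = 1" by (metis complex_norm_square of_real_eq_1_iff)
    thus False using large by (simp add: power2_eq_1_iff)
  qed
qed

section \<open>Entropy bounds for multinomial coefficients\<close>

definition stirling_ratio :: "nat \<Rightarrow> real" where
  "stirling_ratio k = real k ^ k / fact k"

lemma stirling_ratio_0 [simp]: "stirling_ratio 0 = 1"
  by (simp add: stirling_ratio_def)

lemma stirling_ratio_pos: "stirling_ratio k > 0"
  by (cases k) (simp_all add: stirling_ratio_def)

lemma stirling_ratio_Suc:
  assumes "k > 0"
  shows "stirling_ratio (Suc k) = stirling_ratio k * (1 + 1 / real k) ^ k"
proof -
  have "1 + 1 / real k = real (Suc k) / real k" using assms by (simp add: field_simps)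
  hence "stirling_ratio k * (1 + 1 / real k) ^ k = real (Suc k) ^ k / fact k"
    using assms by (simp add: stirling_ratio_def power_divide)
  also have "\<dots> = (real (Suc k) * real (Suc k) ^ k) / (real (Suc k) * fact k)"
    by (rule mult_divide_mult_cancel_left [symmetric]) simp
  also have "\<dots> = stirling_ratio (Suc k)" by (simp only: stirling_ratio_def power_Suc fact_Suc of_nat_mult of_nat_fact)
  finally show ?thesis ..
qed

lemma stirling_ratio_Suc_le: "stirling_ratio (Suc k) \<le> exp 1 * stirling_ratio k"
proof (cases "k = 0")
  case False
  have "(1 + 1 / real k) ^ k \<le> exp (1 / real k) ^ k"
    by (intro power_mono) (use exp_ge_add_one_self [of "1 / real k"] in auto)
  also have "\<dots> = exp 1" using False by (simp flip: exp_of_nat_mult)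
  finally show ?thesis
    using False stirling_ratio_pos [of k] by (simp add: stirling_ratio_Suc mult.commute)
next
  case True
  thus ?thesis using exp_ge_add_one_self [of 1] by (simp add: stirling_ratio_def)
qed

lemma stirling_ratio_add_le: "stirling_ratio (k + t) \<le> exp (real t) * stirling_ratio k"
proof (induction t)
  case (Suc t)
  have "stirling_ratio (k + Suc t) \<le> exp 1 * stirling_ratio (k + t)"
    using stirling_ratio_Suc_le [of "k + t"] by simp
  also have "\<dots> \<le> exp 1 * (exp (real t) * stirling_ratio k)"
    using Suc by (intro mult_left_mono) auto
  finally show ?case by (simp add: exp_add mult_ac)
qed simp

lemma exp_le_stirling_ratio:
  assumes "k > 0"
  shows "exp (real k) \<le> exp 1 * real k * stirling_ratio k"
  using assms
proof (induction k rule: nat_induct_non_zero)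
  case 1
  thus ?case by (simp add: stirling_ratio_def)
next
  case (Suc k)
  have "exp (1 / real (Suc k)) \<le> 1 + 1 / real k"
  proof -
    have "exp (- (1 / real (Suc k))) \<ge> 1 - 1 / real (Suc k)"
      using exp_ge_add_one_self [of "- (1 / real (Suc k))"] by simp
    moreover have "1 - 1 / real (Suc k) = 1 / (1 + 1 / real k)" using Suc.hyps by (simp add: field_simps)
    ultimately have "1 / (1 + 1 / real k) \<le> 1 / exp (1 / real (Suc k))"
      by (simp add: exp_minus inverse_eq_divide)
    thus ?thesis using Suc.hyps by (simp add: field_simps add_pos_pos)
  qed
  hence "exp (1 / real (Suc k)) ^ Suc k \<le> (1 + 1 / real k) ^ Suc k" by (intro power_mono) auto
  moreover have "exp (1 / real (Suc k)) ^ Suc k = exp 1"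
    unfolding exp_of_nat_mult [symmetric] by (simp del: of_nat_Suc)
  ultimately have e: "exp 1 \<le> (1 + 1 / real k) ^ Suc k" by simp
  have "exp (real (Suc k)) = exp 1 * exp (real k)" by (simp add: exp_add)
  also have "\<dots> \<le> (1 + 1 / real k) ^ Suc k * (exp 1 * real k * stirling_ratio k)"
    using e Suc.IH by (intro mult_mono) auto
  also have "\<dots> = exp 1 * ((1 + 1 / real k) * real k) * (stirling_ratio k * (1 + 1 / real k) ^ k)" by simp
  also have "\<dots> = exp 1 * real (Suc k) * stirling_ratio (Suc k)"
    using Suc.hyps by (simp add: stirling_ratio_Suc field_simps)
  finally show ?case .
qed

text \<open>
  The price of a letter that occurs \<open>k\<close> times when a multinomial coefficient is compared with its
  entropy bound.
\<close>

definition entropy_weight :: "nat \<Rightarrow> real" where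
  "entropy_weight k = (if k = 0 then 1 else exp 1 * real k)"

lemma entropy_weight_pos: "entropy_weight k > 0"
  by (simp add: entropy_weight_def)

lemma exp_le_entropy_weight: "exp (real k) \<le> entropy_weight k * stirling_ratio k"
  using exp_le_stirling_ratio [of k] by (cases "k = 0") (auto simp: entropy_weight_def)

text \<open>
  Equivalently, the multinomial coefficient of \<open>\<alpha>\<close> is at least \<open>n ^ n / \<Prod>\<^sub>c \<alpha>\<^sub>c ^ \<alpha>\<^sub>c\<close> up to a factor
  that grows linearly in each \<open>\<alpha>\<^sub>c\<close> with \<open>c \<noteq> c0\<close>. The letter \<open>c0\<close> is free of charge; taking the
  most frequent letter keeps the factor bounded for words that are nearly constant.
\<close>

lemma multinomial_entropy_bound:
  fixes \<alpha> :: "'n::finite \<Rightarrow> nat"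
  shows "stirling_ratio (\<Sum>c\<in>UNIV. \<alpha> c) \<le>
    (\<Prod>c\<in>UNIV. stirling_ratio (\<alpha> c)) * (\<Prod>c\<in>UNIV - {c0}. entropy_weight (\<alpha> c))"
proof -
  have "stirling_ratio (\<Sum>c\<in>UNIV. \<alpha> c) = stirling_ratio (\<alpha> c0 + (\<Sum>c\<in>UNIV - {c0}. \<alpha> c))"
    by (simp add: sum.remove [of UNIV c0])
  also have "\<dots> \<le> exp (real (\<Sum>c\<in>UNIV - {c0}. \<alpha> c)) * stirling_ratio (\<alpha> c0)"
    by (rule stirling_ratio_add_le)
  also have "exp (real (\<Sum>c\<in>UNIV - {c0}. \<alpha> c)) = (\<Prod>c\<in>UNIV - {c0}. exp (real (\<alpha> c)))"
    by (simp add: exp_sum)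
  also have "\<dots> * stirling_ratio (\<alpha> c0) \<le>
      (\<Prod>c\<in>UNIV - {c0}. entropy_weight (\<alpha> c) * stirling_ratio (\<alpha> c)) * stirling_ratio (\<alpha> c0)"
    by (intro mult_right_mono prod_mono conjI exp_le_entropy_weight)
       (simp_all add: less_imp_le stirling_ratio_pos)
  also have "\<dots> = (\<Prod>c\<in>UNIV. stirling_ratio (\<alpha> c)) * (\<Prod>c\<in>UNIV - {c0}. entropy_weight (\<alpha> c))"
    by (simp add: prod.distrib prod.remove [of UNIV c0])
  finally show ?thesis .
qed

text \<open>
  One of the \<open>k\<close> factors \<open>sqrt (k / q)\<close> of a summand gives the decay in \<open>q\<close>. The others are at most
  \<open>sqrt (1 / 2)\<close> and make the sum converge.
\<close>

lemma tail_sum_bound: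
  obtains C where "C > 0" "\<And>q. q > 0 \<Longrightarrow>
    (\<Sum>k\<in>{1..q div 2}. real k * sqrt (real k / real q) ^ k) \<le> C / sqrt (real q)"
proof -
  define s where "s = sqrt (1 / 2)"
  have s: "0 < s" "s \<le> 3 / 4"
  proof -
    show "s \<le> 3 / 4" unfolding s_def by (rule real_le_lsqrt) (simp_all add: power2_eq_square)
  qed (simp add: s_def)
  define f where "f = (\<lambda>k. real k ^ 2 * s ^ (k - 1))"
  have "summable f"
  proof (rule summable_ratio_test [of "99 / 100" 10])
    fix n :: nat assume n: "10 \<le> n"
    then obtain n' where n': "n = Suc n'" by (cases n) auto
    have "real (Suc n) ^ 2 \<le> (11 / 10 * real n) ^ 2" using n by (intro power_mono) auto
    hence "real (Suc n) ^ 2 \<le> 121 / 100 * real n ^ 2" by (simp add: power_mult_distrib power2_eq_square)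
    hence "real (Suc n) ^ 2 * s \<le> (121 / 100 * real n ^ 2) * (3 / 4)" using s by (intro mult_mono) auto
    also have "\<dots> \<le> 99 / 100 * real n ^ 2" by simp
    finally have "(real (Suc n) ^ 2 * s) * s ^ n' \<le> (99 / 100 * real n ^ 2) * s ^ n'"
      using s by (intro mult_right_mono) auto
    thus "norm (f (Suc n)) \<le> 99 / 100 * norm (f n)" using s by (simp add: f_def n' mult_ac)
  qed simp
  define C where "C = suminf f + 1"
  have f_nonneg: "f k \<ge> 0" for k using s by (simp add: f_def)
  have "C > 0" using suminf_nonneg [OF \<open>summable f\<close> f_nonneg] by (simp add: C_def)
  moreover have "(\<Sum>k\<in>{1..q div 2}. real k * sqrt (real k / real q) ^ k) \<le> C / sqrt (real q)" if q: "q > 0" for q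
  proof -
    have "(\<Sum>k\<in>{1..q div 2}. real k * sqrt (real k / real q) ^ k) \<le> (\<Sum>k\<in>{1..q div 2}. f k / sqrt (real q))"
    proof (rule sum_mono)
      fix k assume k: "k \<in> {1..q div 2}"
      then obtain k' where k': "k = Suc k'" by (cases k) auto
      have "2 * k \<le> q" using k by auto
      hence "real k / real q \<le> 1 / 2" using q by (simp add: field_simps flip: of_nat_mult)
      hence "sqrt (real k / real q) \<le> s" unfolding s_def by (rule real_sqrt_le_mono)
      hence "sqrt (real k / real q) ^ k' \<le> s ^ k'" by (intro power_mono) auto
      moreover have "sqrt (real k / real q) \<le> real k / sqrt (real q)"
      proof -
        have "real k * 1 \<le> real k * real k" using k by (intro mult_left_mono) auto
        hence "sqrt (real k) \<le> real k" by (intro real_le_lsqrt) (auto simp: power2_eq_square)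
        thus ?thesis by (simp add: real_sqrt_divide divide_right_mono)
      qed
      ultimately have "sqrt (real k / real q) * sqrt (real k / real q) ^ k' \<le> real k / sqrt (real q) * s ^ k'"
        by (intro mult_mono) auto
      hence "real k * (sqrt (real k / real q) * sqrt (real k / real q) ^ k') \<le> real k * (real k / sqrt (real q) * s ^ k')"
        by (intro mult_left_mono) auto
      thus "real k * sqrt (real k / real q) ^ k \<le> f k / sqrt (real q)"
        by (simp add: f_def k' power2_eq_square mult_ac)
    qed
    also have "\<dots> = (\<Sum>k\<in>{1..q div 2}. f k) / sqrt (real q)" by (simp add: sum_divide_distrib)
    also have "\<dots> \<le> C / sqrt (real q)"
      using sum_le_suminf [OF \<open>summable f\<close>, of "{1..q div 2}"] f_nonneg
      by (intro divide_right_mono) (auto simp: C_def)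
    finally show ?thesis .
  qed
  ultimately show ?thesis by (rule that)
qed

section \<open>Words, rearrangements and roots of unity\<close>

definition letter_count :: "'j set \<Rightarrow> ('j \<Rightarrow> 'n) \<Rightarrow> 'n \<Rightarrow> nat" where
  "letter_count J u c = card {j \<in> J. u j = c}"

lemma letter_count_le: "finite J \<Longrightarrow> letter_count J u c \<le> card J"
  unfolding letter_count_def by (rule card_mono) auto

lemma sum_letter_count:
  fixes u :: "'j \<Rightarrow> 'n::finite"
  assumes "finite J"
  shows "(\<Sum>c\<in>UNIV. letter_count J u c) = card J"
  using sum.group [OF assms finite_class.finite_UNIV, of u "\<lambda>_. 1 :: nat"] by (simp add: letter_count_def)

lemma prod_letters:
  fixes u :: "'j \<Rightarrow> 'n::finite" and y :: "'n \<Rightarrow> 'a::comm_monoid_mult"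
  assumes "finite J"
  shows "(\<Prod>j\<in>J. y (u j)) = (\<Prod>c\<in>UNIV. y c ^ letter_count J u c)"
proof -
  have "(\<Prod>j\<in>J. y (u j)) = (\<Prod>c\<in>UNIV. \<Prod>j\<in>{j \<in> J. u j = c}. y (u j))"
    by (rule prod.group [symmetric]) (use assms in auto)
  also have "\<dots> = (\<Prod>c\<in>UNIV. \<Prod>j\<in>{j \<in> J. u j = c}. y c)"
    by (intro prod.cong refl) auto
  finally show ?thesis by (simp add: letter_count_def)
qed

definition rearrangements :: "'j set \<Rightarrow> ('j \<Rightarrow> 'n) \<Rightarrow> ('j \<Rightarrow> 'n) \<Rightarrow> ('j \<Rightarrow> 'j) set" where
  "rearrangements J v u = {\<pi>. \<pi> permutes J \<and> (\<forall>j\<in>J. v (\<pi> j) = u j)}"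

lemma rearrangements_empty:
  assumes "finite J" "letter_count J v \<noteq> letter_count J u"
  shows "rearrangements J v u = {}"
proof (rule ccontr)
  assume "rearrangements J v u \<noteq> {}"
  then obtain \<pi> where \<pi>: "\<pi> permutes J" "\<And>j. j \<in> J \<Longrightarrow> v (\<pi> j) = u j"
    by (auto simp: rearrangements_def)
  have "letter_count J v c = letter_count J u c" for c
  proof -
    have "{j \<in> J. v j = c} = \<pi> ` {j \<in> J. u j = c}"
    proof (intro equalityI subsetI)
      fix j assume j: "j \<in> {j \<in> J. v j = c}"
      then obtain i where i: "i \<in> J" "j = \<pi> i" using permutes_image [OF \<pi>(1)] by blast
      thus "j \<in> \<pi> ` {j \<in> J. u j = c}" using j \<pi>(2) [OF i(1)] by auto
    next
      fix j assume "j \<in> \<pi> ` {j \<in> J. u j = c}"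
      then obtain i where "i \<in> J" "u i = c" "j = \<pi> i" by blast
      thus "j \<in> {j \<in> J. v j = c}" using \<pi>(2) permutes_in_image [OF \<pi>(1)] by simp
    qed
    thus ?thesis unfolding letter_count_def
      by (simp add: card_image inj_on_subset [OF permutes_inj [OF \<pi>(1)]])
  qed
  with assms(2) show False by blast
qed

lemma card_rearrangements_eq:
  fixes u v :: "'a \<Rightarrow> 'b"
  assumes "finite J" "letter_count J v = letter_count J u"
  shows "card (rearrangements J v u) = card (rearrangements J v v)"
proof -
  have "image_mset v (mset_set J) = image_mset u (mset_set J)"
  proof (rule multiset_eqI)
    fix c :: 'b
    have "count (image_mset f (mset_set J)) c = letter_count J f c" for f :: "'a \<Rightarrow> 'b"
      using assms(1) by (simp add: count_image_mset_eq_card_vimage letter_count_def)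
    thus "count (image_mset v (mset_set J)) c = count (image_mset u (mset_set J)) c"
      using assms(2) by simp
  qed
  hence "image_mset u (mset_set J) = image_mset v (mset_set J)" ..
  then obtain \<pi>0 where \<pi>0: "\<pi>0 permutes J" "\<forall>j\<in>J. u j = v (\<pi>0 j)"
    using image_mset_eq_implies_permutes [OF assms(1)] by metis
  have "bij_betw (\<lambda>\<rho>. \<rho> \<circ> \<pi>0) (rearrangements J v v) (rearrangements J v u)"
  proof (rule bij_betw_byWitness [of _ "\<lambda>\<pi>. \<pi> \<circ> inv \<pi>0"])
    show "\<forall>\<rho>\<in>rearrangements J v v. \<rho> \<circ> \<pi>0 \<circ> inv \<pi>0 = \<rho>"
      using \<pi>0(1) by (simp add: comp_assoc permutes_inv_o)
    show "\<forall>\<pi>\<in>rearrangements J v u. \<pi> \<circ> inv \<pi>0 \<circ> \<pi>0 = \<pi>"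
      using \<pi>0(1) by (simp add: comp_assoc permutes_inv_o)
    show "(\<lambda>\<rho>. \<rho> \<circ> \<pi>0) ` rearrangements J v v \<subseteq> rearrangements J v u"
    proof
      fix \<pi> assume "\<pi> \<in> (\<lambda>\<rho>. \<rho> \<circ> \<pi>0) ` rearrangements J v v"
      then obtain \<rho> where \<rho>: "\<pi> = \<rho> \<circ> \<pi>0" "\<rho> \<in> rearrangements J v v" by (rule imageE)
      have \<rho>': "\<rho> permutes J" "\<And>j. j \<in> J \<Longrightarrow> v (\<rho> j) = v j"
        using \<rho>(2) unfolding rearrangements_def by blast+
      have "v (\<pi> j) = u j" if "j \<in> J" for j
      proof -
        have "\<pi>0 j \<in> J" using permutes_in_image [OF \<pi>0(1)] that by blast
        hence "v (\<pi> j) = v (\<pi>0 j)" unfolding \<rho>(1) o_apply by (rule \<rho>'(2))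
        also have "\<dots> = u j" using \<pi>0(2) that by (metis)
        finally show ?thesis .
      qed
      moreover have "\<pi> permutes J" unfolding \<rho>(1) by (rule permutes_compose [OF \<pi>0(1) \<rho>'(1)])
      ultimately show "\<pi> \<in> rearrangements J v u" unfolding rearrangements_def by blast
    qed
    show "(\<lambda>\<pi>. \<pi> \<circ> inv \<pi>0) ` rearrangements J v u \<subseteq> rearrangements J v v"
    proof
      fix \<rho> assume "\<rho> \<in> (\<lambda>\<pi>. \<pi> \<circ> inv \<pi>0) ` rearrangements J v u"
      then obtain \<pi> where \<pi>: "\<rho> = \<pi> \<circ> inv \<pi>0" "\<pi> \<in> rearrangements J v u"
        by (rule imageE)
      have \<pi>': "\<pi> permutes J" "\<And>j. j \<in> J \<Longrightarrow> v (\<pi> j) = u j"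
        using \<pi>(2) unfolding rearrangements_def by blast+
      have "v (\<rho> j) = v j" if "j \<in> J" for j
      proof -
        have i: "inv \<pi>0 j \<in> J"
          using permutes_in_image [OF permutes_inv [OF \<pi>0(1)]] that by blast
        have "v (\<rho> j) = u (inv \<pi>0 j)" unfolding \<pi>(1) o_apply by (rule \<pi>'(2) [OF i])
        also have "\<dots> = v (\<pi>0 (inv \<pi>0 j))" using \<pi>0(2) i by blast
        also have "\<pi>0 (inv \<pi>0 j) = j" by (rule permutes_inverses(1) [OF \<pi>0(1)])
        finally show ?thesis .
      qed
      moreover have "\<rho> permutes J" unfolding \<pi>(1) by (rule permutes_compose [OF permutes_inv [OF \<pi>0(1)] \<pi>'(1)])
      ultimately show "\<rho> \<in> rearrangements J v v" unfolding rearrangements_def by blast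
    qed
  qed
  from bij_betw_same_card [OF this] show ?thesis ..
qed

lemma card_rearrangements_le:
  fixes v :: "'j \<Rightarrow> 'n::finite"
  assumes "finite J"
  shows "card (rearrangements J v v) \<le> (\<Prod>c\<in>UNIV. fact (letter_count J v c))"
proof -
  define R where "R = (\<lambda>(\<rho> :: 'j \<Rightarrow> 'j) c j. if j \<in> J \<and> v j = c then \<rho> j else j)"
  have "card (rearrangements J v v) \<le> card (PiE UNIV (\<lambda>c. {p. p permutes {j \<in> J. v j = c}}))"
  proof (rule card_inj_on_le)
    show "inj_on R (rearrangements J v v)"
    proof (rule inj_onI)
      fix \<rho> \<rho>' assume r: "\<rho> \<in> rearrangements J v v" "\<rho>' \<in> rearrangements J v v" and eq: "R \<rho> = R \<rho>'"
      show "\<rho> = \<rho>'"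
      proof
        fix j show "\<rho> j = \<rho>' j"
        proof (cases "j \<in> J")
          case True
          have "R \<rho> (v j) j = R \<rho>' (v j) j" by (simp only: eq)
          thus ?thesis using True by (simp add: R_def)
        next
          case False
          thus ?thesis using r by (auto simp: rearrangements_def permutes_not_in)
        qed
      qed
    qed
    show "R ` rearrangements J v v \<subseteq> PiE UNIV (\<lambda>c. {p. p permutes {j \<in> J. v j = c}})"
    proof
      fix f assume "f \<in> R ` rearrangements J v v"
      then obtain \<rho> where \<rho>: "f = R \<rho>" "\<rho> permutes J" "\<forall>j\<in>J. v (\<rho> j) = v j"
        by (auto simp: rearrangements_def)
      have "f c permutes {j \<in> J. v j = c}" for c
      proof (rule bij_imp_permutes)
        have inj: "inj_on (f c) {j \<in> J. v j = c}"
          using permutes_inj [OF \<rho>(2)] by (auto simp: \<rho>(1) R_def inj_on_def dest: injD)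
        moreover have "f c ` {j \<in> J. v j = c} \<subseteq> {j \<in> J. v j = c}"
          using permutes_in_image [OF \<rho>(2)] \<rho>(3) by (auto simp: \<rho>(1) R_def)
        moreover have "finite {j \<in> J. v j = c}" using assms by simp
        ultimately show "bij_betw (f c) {j \<in> J. v j = c} {j \<in> J. v j = c}"
          unfolding bij_betw_def by (simp add: endo_inj_surj)
        fix j assume "j \<notin> {j \<in> J. v j = c}"
        thus "f c j = j" by (auto simp: \<rho>(1) R_def)
      qed
      thus "f \<in> PiE UNIV (\<lambda>c. {p. p permutes {j \<in> J. v j = c}})" by (simp add: PiE_UNIV_domain)
    qed
    show "finite (PiE UNIV (\<lambda>c. {p. p permutes {j \<in> J. v j = c}}))"
      using assms by (intro finite_PiE finite_permutations) auto
  qed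
  also have "\<dots> = (\<Prod>c\<in>UNIV. card {p. p permutes {j \<in> J. v j = c}})"
    by (rule card_PiE) simp
  also have "\<dots> = (\<Prod>c\<in>UNIV. fact (letter_count J v c))"
    unfolding letter_count_def using assms by (intro prod.cong refl card_permutations) auto
  finally show ?thesis .
qed

definition root_phase :: "nat \<Rightarrow> nat \<Rightarrow> complex" where
  "root_phase M e = exp (2 * of_real pi * \<i> * of_nat e / of_nat M)"

lemma root_phase_norm [simp]: "cmod (root_phase M e) = 1"
proof -
  have "root_phase M e = exp (\<i> * of_real (2 * pi * real e / real M))"
    by (simp add: root_phase_def mult_ac)
  thus ?thesis by (simp only: norm_exp_i_times)
qed

lemma root_phase_sum:
  assumes "a < M" "b < M"
  shows "(\<Sum>e<M. root_phase M e ^ a * cnj (root_phase M e) ^ b) = (if a = b then of_nat M else 0)"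
proof (cases "a = b")
  case True
  have "root_phase M e ^ a * cnj (root_phase M e) ^ a = 1" for e
    using complex_norm_square [of "root_phase M e"] by (simp flip: power_mult_distrib)
  thus ?thesis using True by simp
next
  case False
  define x where "x = root_phase M a * cnj (root_phase M b)"
  have power: "root_phase M e ^ a = root_phase M a ^ e" for e a
    unfolding root_phase_def exp_of_nat_mult [symmetric] by (rule arg_cong [of _ _ exp]) simp
  have "x \<noteq> 1"
  proof
    assume "x = 1"
    hence "root_phase M a * cnj (root_phase M b) = 1" by (simp only: x_def)
    hence "root_phase M a * (cnj (root_phase M b) * root_phase M b) = root_phase M b"
      by (simp only: mult.assoc [symmetric] mult_1_left)
    moreover have "cnj (root_phase M b) * root_phase M b = 1"
      using complex_norm_square [of "root_phase M b"] by (simp add: mult.commute)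
    ultimately have "root_phase M a = root_phase M b" by (simp only: mult_1_right)
    hence "a mod M = b mod M"
      unfolding root_phase_def using assms by (subst (asm) complex_root_unity_eq) auto
    with assms False show False by simp
  qed
  moreover have "x ^ M = 1"
  proof -
    have "root_phase M k ^ M = 1" for k
    proof -
      have "root_phase M M = 1" using complex_root_unity_eq_1 [of M M] assms by (simp add: root_phase_def)
      thus ?thesis by (simp only: power [of k M] power_one)
    qed
    thus ?thesis unfolding x_def power_mult_distrib complex_cnj_power [symmetric] by simp
  qed
  ultimately have "(\<Sum>e<M. x ^ e) = 0" by (simp add: geometric_sum)
  moreover have "root_phase M e ^ a * cnj (root_phase M e) ^ b = x ^ e" for e
    unfolding x_def power_mult_distrib complex_cnj_power [symmetric] by (simp only: power [of e a] power [of e b])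
  ultimately show ?thesis using False by simp
qed

section \<open>The mass of the nonconstant words\<close>

definition phases :: "nat \<Rightarrow> ('n::finite \<Rightarrow> nat) set" where
  "phases M = UNIV \<rightarrow>\<^sub>E {..<M}"

lemma finite_phases [simp]: "finite (phases M)"
  unfolding phases_def by (intro finite_PiE) auto

lemma card_phases: "card (phases M :: ('n::finite \<Rightarrow> nat) set) = M ^ CARD('n)"
  by (simp add: phases_def card_PiE)

lemma phase_average:
  fixes \<alpha> \<beta> :: "'n::finite \<Rightarrow> nat"
  assumes "\<And>c. \<alpha> c < M" "\<And>c. \<beta> c < M"
  shows "(\<Sum>e\<in>phases M. \<Prod>c\<in>UNIV. root_phase M (e c) ^ \<beta> c * cnj (root_phase M (e c)) ^ \<alpha> c) =
    (if \<alpha> = \<beta> then of_nat M ^ CARD('n) else 0)"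
proof -
  have "(\<Sum>e\<in>phases M. \<Prod>c\<in>UNIV. root_phase M (e c) ^ \<beta> c * cnj (root_phase M (e c)) ^ \<alpha> c) =
      (\<Prod>c\<in>UNIV. \<Sum>k<M. root_phase M k ^ \<beta> c * cnj (root_phase M k) ^ \<alpha> c)"
    unfolding phases_def by (rule prod_sum_PiE [symmetric]) auto
  also have "\<dots> = (\<Prod>c\<in>UNIV. if \<beta> c = \<alpha> c then of_nat M else 0)"
    by (intro prod.cong refl root_phase_sum assms)
  also have "\<dots> = (if \<alpha> = \<beta> then of_nat M ^ CARD('n) else 0)"
  proof (cases "\<alpha> = \<beta>")
    case False
    then obtain c where "\<alpha> c \<noteq> \<beta> c" by blast
    hence "(\<Prod>c\<in>UNIV. if \<beta> c = \<alpha> c then of_nat M else (0 :: complex)) = 0"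
      by (intro prod_zero bexI [of _ c]) auto
    thus ?thesis using False by (simp only: if_False)
  qed simp
  finally show ?thesis .
qed

definition torus_point :: "('n \<Rightarrow> real) \<Rightarrow> nat \<Rightarrow> ('n \<Rightarrow> nat) \<Rightarrow> complex^'n::finite" where
  "torus_point r M e = (\<chi> c. of_real (r c) * root_phase M (e c))"

definition torus_weight :: "'j set \<Rightarrow> ('j \<Rightarrow> 'n::finite) \<Rightarrow> ('n \<Rightarrow> real) \<Rightarrow> nat \<Rightarrow> ('n \<Rightarrow> nat) \<Rightarrow> complex" where
  "torus_weight J v r M e = of_nat (card (rearrangements J v v)) / of_nat M ^ CARD('n) *
     (\<Prod>c\<in>UNIV. of_real ((1 / r c) ^ letter_count J v c) * cnj (root_phase M (e c)) ^ letter_count J v c)"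

text \<open>
  Coefficient extraction by an average over roots of unity: the number of rearrangements of \<open>v\<close> into
  \<open>u\<close> depends only on whether the letter counts agree, and the product of the coordinates of a torus
  point along \<open>u\<close> is a character of the letter counts of \<open>u\<close>. The radii \<open>r\<close> are free, which allows to
  trade the length of the points against the mass of the weights.
\<close>

lemma rearrangements_as_torus_average:
  fixes u v :: "'j \<Rightarrow> 'n::finite"
  assumes J: "finite J" "card J < M" and r: "\<And>c. letter_count J v c > 0 \<Longrightarrow> r c \<noteq> 0"
  shows "of_nat (card (rearrangements J v u)) =
    (\<Sum>e\<in>phases M. torus_weight J v r M e * (\<Prod>j\<in>J. torus_point r M e $ u j))"
proof -
  define \<alpha> where "\<alpha> = letter_count J v"
  define \<beta> where "\<beta> = letter_count J u"
  define S :: complex where "S = of_nat (card (rearrangements J v v))"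
  have less: "\<alpha> c < M" "\<beta> c < M" for c
    using le_less_trans [OF letter_count_le [OF J(1)] J(2)] by (simp_all add: \<alpha>_def \<beta>_def)
  have M: "M > 0" using J(2) by simp
  have summand: "torus_weight J v r M e * (\<Prod>j\<in>J. torus_point r M e $ u j) =
      S / of_nat M ^ CARD('n) * (\<Prod>c\<in>UNIV. of_real ((1 / r c) ^ \<alpha> c * r c ^ \<beta> c)) *
        (\<Prod>c\<in>UNIV. root_phase M (e c) ^ \<beta> c * cnj (root_phase M (e c)) ^ \<alpha> c)" for e
  proof -
    have "(\<Prod>j\<in>J. torus_point r M e $ u j) = (\<Prod>c\<in>UNIV. (torus_point r M e $ c) ^ \<beta> c)"
      unfolding \<beta>_def by (rule prod_letters [OF J(1)])
    thus ?thesis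
      unfolding torus_weight_def \<alpha>_def [symmetric] S_def [symmetric]
      by (simp add: torus_point_def power_mult_distrib prod.distrib mult_ac)
  qed
  have "(\<Sum>e\<in>phases M. torus_weight J v r M e * (\<Prod>j\<in>J. torus_point r M e $ u j)) =
      S / of_nat M ^ CARD('n) * (\<Prod>c\<in>UNIV. of_real ((1 / r c) ^ \<alpha> c * r c ^ \<beta> c)) *
        (if \<alpha> = \<beta> then of_nat M ^ CARD('n) else 0)"
    unfolding summand sum_distrib_left [symmetric] phase_average [OF less] ..
  also have "\<dots> = of_nat (card (rearrangements J v u))"
  proof (cases "\<alpha> = \<beta>")
    case True
    have "(1 / r c) ^ \<alpha> c * r c ^ \<beta> c = 1" for c
      using r [of c] True by (cases "\<alpha> c = 0") (auto simp: \<alpha>_def power_one_over field_simps)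
    moreover have "card (rearrangements J v u) = card (rearrangements J v v)"
      using True by (intro card_rearrangements_eq J(1)) (simp add: \<alpha>_def \<beta>_def)
    ultimately show ?thesis using True M by (simp add: S_def)
  next
    case False
    hence "rearrangements J v u = {}"
      by (intro rearrangements_empty J(1)) (simp add: \<alpha>_def \<beta>_def)
    thus ?thesis using False by simp
  qed
  finally show ?thesis ..
qed

lemma sum_norm_torus_weight:
  fixes v :: "'j \<Rightarrow> 'n::finite"
  assumes "finite J" "M > 0" "\<And>c. r c \<ge> 0"
  shows "(\<Sum>e\<in>phases M. cmod (torus_weight J v r M e)) \<le>
    (\<Prod>c\<in>UNIV. fact (letter_count J v c) * (1 / r c) ^ letter_count J v c)"
proof -
  define R where "R = (\<Prod>c\<in>UNIV. (1 / r c) ^ letter_count J v c)"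
  have R: "R \<ge> 0" unfolding R_def using assms(3) by (intro prod_nonneg zero_le_power) simp
  have norm: "cmod (torus_weight J v r M e) = real (card (rearrangements J v v)) / real M ^ CARD('n) * R" for e
  proof -
    have "cmod (of_real ((1 / r c) ^ k) * cnj (root_phase M (e c)) ^ k) = (1 / r c) ^ k" for c k
      unfolding norm_mult norm_power norm_of_real complex_mod_cnj root_phase_norm using assms(3) [of c] by simp
    hence "cmod (\<Prod>c\<in>UNIV. of_real ((1 / r c) ^ letter_count J v c) * cnj (root_phase M (e c)) ^ letter_count J v c) = R"
      unfolding prod_norm [symmetric] R_def by (simp only:)
    moreover have "cmod (of_nat (card (rearrangements J v v)) / of_nat M ^ CARD('n)) =
        real (card (rearrangements J v v)) / real M ^ CARD('n)"
      unfolding norm_divide norm_power norm_of_nat ..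
    ultimately show ?thesis unfolding torus_weight_def norm_mult by (simp only:)
  qed
  have "(\<Sum>e\<in>phases M. cmod (torus_weight J v r M e)) =
      real (card (phases M :: ('n \<Rightarrow> nat) set)) * (real (card (rearrangements J v v)) / real M ^ CARD('n) * R)"
    unfolding norm by (rule sum_constant)
  also have "\<dots> = real (card (rearrangements J v v)) * R"
    using assms(2) unfolding card_phases of_nat_power by simp
  also have "\<dots> \<le> real (\<Prod>c\<in>UNIV. fact (letter_count J v c)) * R"
    using R card_rearrangements_le [OF assms(1), of v] by (intro mult_right_mono of_nat_mono)
  also have "\<dots> = (\<Prod>c\<in>UNIV. fact (letter_count J v c) * (1 / r c) ^ letter_count J v c)"
    unfolding R_def of_nat_prod of_nat_fact prod.distrib ..
  finally show ?thesis .
qed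

text \<open>
  Among the radii with square sum 1 these maximize \<open>\<Prod>\<^sub>c r\<^sub>c ^ a\<^sub>c\<close>, which minimizes the mass of the
  weights.
\<close>

definition frequency_radius :: "nat \<Rightarrow> ('n \<Rightarrow> nat) \<Rightarrow> 'n \<Rightarrow> real" where
  "frequency_radius q a c = sqrt (real (a c) / real q)"

text \<open>
  A bound for the mass of \<^const>\<open>torus_weight\<close> relative to all permutations, for one word in which each
  letter \<open>c\<close> occurs \<open>D * a c\<close> times.
\<close>

definition row_weight :: "nat \<Rightarrow> nat \<Rightarrow> ('n::finite \<Rightarrow> nat) \<Rightarrow> real" where
  "row_weight D q a = (\<Prod>c\<in>UNIV. fact (D * a c) * (1 / frequency_radius q a c) ^ (D * a c)) / fact (D * q)"

text \<open>
  The left hand side is the probability of the letter counts \<open>a\<close> in \<open>q\<close> independent letters that are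
  drawn with frequencies \<open>a c / q\<close>.
\<close>

lemma card_words_with_letter_count:
  fixes a :: "'n::finite \<Rightarrow> nat"
  assumes "(\<Sum>c\<in>UNIV. a c) = q" "q > 0"
  shows "real (card {\<kappa> \<in> words q. letter_count {..<q} \<kappa> = a}) * (\<Prod>c\<in>UNIV. (real (a c) / real q) ^ a c) \<le> 1"
proof -
  let ?S = "{\<kappa> \<in> words q. letter_count {..<q} \<kappa> = a}"
  have "real (card ?S) * (\<Prod>c\<in>UNIV. (real (a c) / real q) ^ a c) =
      (\<Sum>\<kappa>\<in>?S. \<Prod>s<q. real (a (\<kappa> s)) / real q)"
  proof -
    have "(\<Prod>s<q. real (a (\<kappa> s)) / real q) = (\<Prod>c\<in>UNIV. (real (a c) / real q) ^ a c)"
      if "\<kappa> \<in> ?S" for \<kappa>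
    proof -
      have "letter_count {..<q} \<kappa> = a" using that by blast
      thus ?thesis using prod_letters [of "{..<q}" "\<lambda>c. real (a c) / real q" \<kappa>] by simp
    qed
    hence "(\<Sum>\<kappa>\<in>?S. \<Prod>s<q. real (a (\<kappa> s)) / real q) =
        (\<Sum>\<kappa>\<in>?S. \<Prod>c\<in>UNIV. (real (a c) / real q) ^ a c)"
      by (rule sum.cong [OF refl])
    thus ?thesis by (simp only: sum_constant)
  qed
  also have "\<dots> \<le> (\<Sum>\<kappa>\<in>words q. \<Prod>s<q. real (a (\<kappa> s)) / real q)"
  proof (rule sum_mono2)
    show "?S \<subseteq> words q" by blast
    fix \<kappa> :: "nat \<Rightarrow> 'n"
    show "0 \<le> (\<Prod>s<q. real (a (\<kappa> s)) / real q)" by (intro prod_nonneg) simp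
  qed (rule finite_words)
  also have "\<dots> = (\<Prod>s<q. \<Sum>c\<in>UNIV. real (a c) / real q)"
    by (rule prod_sum_PiE [symmetric]) simp_all
  also have "\<dots> = 1"
    unfolding sum_divide_distrib [symmetric] of_nat_sum [symmetric] assms(1) using assms(2) by simp
  finally show ?thesis .
qed

definition row_term :: "nat \<Rightarrow> nat \<Rightarrow> nat \<Rightarrow> real" where
  "row_term D q k = entropy_weight (D * k) * sqrt (real k / real q) ^ k"

text \<open>
  Let \<open>x c\<close> be the frequency radius of \<open>c\<close> to the power \<open>a c\<close>. At most \<open>1 / \<Prod>\<^sub>c x\<^sub>c ^ 2\<close> words have the
  letter counts \<open>a\<close>. By the entropy bound the weight of each is at most \<open>\<Prod>\<^sub>c x\<^sub>c ^ D\<close> times the entropy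
  weights. For \<open>D \<ge> 3\<close> a factor \<open>\<Prod>\<^sub>c x\<^sub>c\<close> is left, since \<open>x\<^sub>c \<le> 1\<close>.
\<close>

lemma row_weight_bound:
  fixes a :: "'n::finite \<Rightarrow> nat"
  assumes a: "(\<Sum>c\<in>UNIV. a c) = q" and q: "q > 0" and D: "D \<ge> 3"
  shows "real (card {\<kappa> \<in> words q. letter_count {..<q} \<kappa> = a}) * row_weight D q a \<le>
    (\<Prod>c\<in>UNIV - {c0}. row_term D q (a c))"
proof -
  define N where "N = real (card {\<kappa> \<in> words q. letter_count {..<q} \<kappa> = a})"
  define r where "r = frequency_radius q a"
  define x where "x = (\<lambda>c. r c ^ a c)"
  define \<psi> where "\<psi> = (\<Prod>c\<in>UNIV - {c0}. entropy_weight (D * a c))"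
  have \<psi>: "\<psi> \<ge> 0" unfolding \<psi>_def by (intro prod_nonneg) (simp add: less_imp_le entropy_weight_pos)
  have r_nonneg: "r c \<ge> 0" for c by (simp add: r_def frequency_radius_def)
  have r_sq: "(r c)\<^sup>2 = real (a c) / real q" for c by (simp add: r_def frequency_radius_def)
  have a_le: "a c \<le> q" for c using a member_le_sum [of c UNIV a] by simp
  have r_le: "r c \<le> 1" for c using a_le [of c] q by (simp add: r_def frequency_radius_def)
  have r_pos: "r c > 0" if "a c > 0" for c using that q by (simp add: r_def frequency_radius_def)
  have x_pos: "x c > 0" for c using r_pos [of c] by (cases "a c = 0") (simp_all add: x_def)
  have x_le: "x c \<le> 1" for c using r_nonneg r_le by (simp add: x_def power_le_one)
  have N0: "N \<ge> 0" by (simp add: N_def)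
  have Nx: "N * (\<Prod>c\<in>UNIV. x c ^ 2) \<le> 1"
  proof -
    have "x c ^ 2 = (real (a c) / real q) ^ a c" for c
      unfolding x_def power_mult [symmetric] r_sq [symmetric] by (simp add: mult.commute)
    thus ?thesis using card_words_with_letter_count [OF a q] by (simp add: N_def)
  qed
  have W: "row_weight D q a \<le> (\<Prod>c\<in>UNIV. x c ^ D) * \<psi>"
  proof -
    define n where "n = D * q"
    have n: "n > 0" using q D by (simp add: n_def)
    have sum: "(\<Sum>c\<in>UNIV. D * a c) = n" unfolding n_def a [symmetric] by (rule sum_distrib_left [symmetric])
    have "stirling_ratio n \<le> (\<Prod>c\<in>UNIV. stirling_ratio (D * a c)) * \<psi>"
      using multinomial_entropy_bound [of "\<lambda>c. D * a c" c0] unfolding sum \<psi>_def .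
    hence "real n ^ n / fact n \<le> (\<Prod>c\<in>UNIV. real (D * a c) ^ (D * a c)) / (\<Prod>c\<in>UNIV. fact (D * a c)) * \<psi>"
      by (simp only: stirling_ratio_def prod_dividef)
    moreover have "(\<Prod>c\<in>UNIV. fact (D * a c) :: real) > 0" by (intro prod_pos) simp
    ultimately have "(\<Prod>c\<in>UNIV. fact (D * a c)) / fact n \<le> (\<Prod>c\<in>UNIV. real (D * a c) ^ (D * a c)) / real n ^ n * \<psi>"
      using n by (simp add: field_simps)
    also have "(\<Prod>c\<in>UNIV. real (D * a c) ^ (D * a c)) / real n ^ n = (\<Prod>c\<in>UNIV. x c ^ (2 * D))"
    proof -
      have "real n ^ n = (\<Prod>c\<in>UNIV. real n ^ (D * a c))"
        unfolding power_sum [symmetric] sum ..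
      hence "(\<Prod>c\<in>UNIV. real (D * a c) ^ (D * a c)) / real n ^ n =
          (\<Prod>c\<in>UNIV. real (D * a c) ^ (D * a c) / real n ^ (D * a c))"
        by (simp only: prod_dividef)
      also have "\<dots> = (\<Prod>c\<in>UNIV. x c ^ (2 * D))"
      proof (intro prod.cong refl)
        fix c
        have "real (D * a c) / real n = (r c)\<^sup>2" using D by (simp add: n_def r_sq)
        hence "real (D * a c) ^ (D * a c) / real n ^ (D * a c) = ((r c)\<^sup>2) ^ (D * a c)"
          by (simp only: power_divide [symmetric])
        thus "real (D * a c) ^ (D * a c) / real n ^ (D * a c) = x c ^ (2 * D)"
          by (simp add: x_def mult_ac flip: power_mult)
      qed
      finally show ?thesis .
    qed
    finally have F: "(\<Prod>c\<in>UNIV. fact (D * a c)) / fact n \<le> (\<Prod>c\<in>UNIV. x c ^ (2 * D)) * \<psi>" .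
    have inv: "(1 / r c) ^ (D * a c) = (1 / x c) ^ D" for c
    proof -
      have "(1 / r c) ^ (D * a c) = ((1 / r c) ^ a c) ^ D" by (simp only: power_mult [symmetric] mult.commute)
      also have "(1 / r c) ^ a c = 1 / x c" by (simp only: x_def power_one_over)
      finally show ?thesis .
    qed
    have "row_weight D q a = ((\<Prod>c\<in>UNIV. fact (D * a c)) / fact n) * (\<Prod>c\<in>UNIV. (1 / x c) ^ D)"
      unfolding row_weight_def n_def r_def [symmetric] inv prod.distrib by (rule times_divide_eq_left [symmetric])
    also have "\<dots> \<le> ((\<Prod>c\<in>UNIV. x c ^ (2 * D)) * \<psi>) * (\<Prod>c\<in>UNIV. (1 / x c) ^ D)"
    proof (rule mult_right_mono [OF F], intro prod_nonneg)
      fix c show "0 \<le> (1 / x c) ^ D" using x_pos [of c] by simp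
    qed
    also have "\<dots> = (\<Prod>c\<in>UNIV. x c ^ (2 * D) * (1 / x c) ^ D) * \<psi>"
      by (simp only: prod.distrib mult_ac)
    also have "(\<Prod>c\<in>UNIV. x c ^ (2 * D) * (1 / x c) ^ D) = (\<Prod>c\<in>UNIV. x c ^ D)"
    proof (intro prod.cong refl)
      fix c show "x c ^ (2 * D) * (1 / x c) ^ D = x c ^ D"
        using x_pos [of c] by (simp add: mult_2 power_add power_one_over)
    qed
    finally show ?thesis .
  qed
  define P where "P = (\<Prod>c\<in>UNIV. x c)"
  define P' where "P' = (\<Prod>c\<in>UNIV - {c0}. x c)"
  have P': "P' \<ge> 0" unfolding P'_def by (intro prod_nonneg) (simp add: less_imp_le x_pos)
  have P: "P = x c0 * P'" unfolding P_def P'_def by (simp add: prod.remove [of UNIV c0])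
  have P_nonneg: "P \<ge> 0" unfolding P using P' x_pos [of c0] by simp
  have "(\<Prod>c\<in>UNIV. x c ^ D) \<le> (\<Prod>c\<in>UNIV. x c ^ 3)"
    using x_pos x_le D by (intro prod_mono conjI power_decreasing zero_le_power) (simp_all add: less_imp_le)
  also have "\<dots> = (\<Prod>c\<in>UNIV. x c ^ 2) * P"
    unfolding P_def prod.distrib [symmetric]
    by (intro prod.cong refl) (simp add: power2_eq_square power3_eq_cube)
  finally have xD: "(\<Prod>c\<in>UNIV. x c ^ D) \<le> (\<Prod>c\<in>UNIV. x c ^ 2) * P" .
  have "N * row_weight D q a \<le> N * ((\<Prod>c\<in>UNIV. x c ^ D) * \<psi>)"
    using W N0 by (rule mult_left_mono)
  also have "\<dots> \<le> N * (((\<Prod>c\<in>UNIV. x c ^ 2) * P) * \<psi>)"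
    by (rule mult_left_mono [OF mult_right_mono [OF xD \<psi>] N0])
  also have "\<dots> = (N * (\<Prod>c\<in>UNIV. x c ^ 2)) * (P * \<psi>)"
    by (simp only: mult_ac)
  also have "\<dots> \<le> 1 * (P * \<psi>)"
    by (rule mult_right_mono [OF Nx]) (simp add: P_nonneg \<psi>)
  also have "\<dots> \<le> P' * \<psi>"
    unfolding mult_1_left
    by (rule mult_right_mono [OF _ \<psi>]) (use x_le [of c0] P' in \<open>simp add: P mult_left_le_one_le x_pos less_imp_le\<close>)
  also have "P' * \<psi> = (\<Prod>c\<in>UNIV - {c0}. row_term D q (a c))"
    unfolding P'_def \<psi>_def row_term_def x_def r_def frequency_radius_def prod.distrib by (rule mult.commute)
  finally show ?thesis unfolding N_def .
qed

definition nonconstant_words :: "nat \<Rightarrow> (nat \<Rightarrow> 'n::finite) set" where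
  "nonconstant_words q = {\<kappa> \<in> words q. \<forall>c. letter_count {..<q} \<kappa> c < q}"

lemma finite_nonconstant_words [simp]: "finite (nonconstant_words q :: (nat \<Rightarrow> 'n::finite) set)"
  by (rule finite_subset [of _ "words q"]) (auto simp: nonconstant_words_def)

lemma row_term_0 [simp]: "row_term D q 0 = 1"
  by (simp add: row_term_def entropy_weight_def)

lemma row_term_nonneg: "row_term D q k \<ge> 0"
  by (simp add: row_term_def less_imp_le entropy_weight_pos)

text \<open>
  The letter counts are grouped by a most frequent letter, which is used as \<open>c0\<close>. Each other letter
  occurs at most \<open>q div 2\<close> times, and some other letter does occur; the latter explains the
  subtraction of 1, the term in which all other counts are \<open>0\<close>.
\<close>

lemma sum_row_weights_le:
  assumes q: "q > 0" and D: "D \<ge> 3"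
  shows "(\<Sum>\<kappa>\<in>nonconstant_words q. row_weight D q (letter_count {..<q} (\<kappa> :: nat \<Rightarrow> 'n::finite))) \<le>
    real CARD('n) * ((1 + (\<Sum>k\<in>{1..q div 2}. row_term D q k)) ^ (CARD('n) - 1) - 1)"
proof -
  define lc where "lc = (letter_count {..<q} :: (nat \<Rightarrow> 'n) \<Rightarrow> 'n \<Rightarrow> nat)"
  define NC where "NC = (nonconstant_words q :: (nat \<Rightarrow> 'n) set)"
  define A where "A = lc ` NC"
  have finNC: "finite NC" by (simp add: NC_def)
  have finA: "finite A" by (simp add: A_def finNC)
  have sumA: "(\<Sum>c\<in>UNIV. a c) = q" and ltA: "a c < q" if "a \<in> A" for a c
  proof -
    from that obtain \<kappa> where \<kappa>: "a = lc \<kappa>" "\<kappa> \<in> NC" unfolding A_def by blast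
    show "(\<Sum>c\<in>UNIV. a c) = q" unfolding \<kappa>(1) lc_def by (subst sum_letter_count) simp_all
    show "a c < q" using \<kappa>(2) unfolding \<kappa>(1) lc_def NC_def nonconstant_words_def by blast
  qed
  have "\<exists>c. \<forall>c'. a c' \<le> a c" for a :: "'n \<Rightarrow> nat"
  proof -
    have "Max (range a) \<in> range a" by (rule Max_in) simp_all
    then obtain c where c: "Max (range a) = a c" by (rule imageE)
    have "a c' \<le> a c" for c' unfolding c [symmetric] by (rule Max_ge) simp_all
    thus ?thesis by blast
  qed
  hence "\<forall>a :: 'n \<Rightarrow> nat. \<exists>c. \<forall>c'. a c' \<le> a c" by blast
  from choice [OF this] obtain top :: "('n \<Rightarrow> nat) \<Rightarrow> 'n" where top: "\<And>a c'. a c' \<le> a (top a)" by blast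
  define h where "h = (\<lambda>(c0, b). \<Prod>c\<in>UNIV - {c0}. row_term D q ((b :: 'n \<Rightarrow> nat) c))"
  have h_nonneg: "h p \<ge> 0" for p
    unfolding h_def case_prod_unfold by (intro prod_nonneg) (simp add: row_term_nonneg)
  define j where "j = (\<lambda>a. (top a, restrict a (UNIV - {top a})))"
  define full where "full = (\<lambda>c0 :: 'n. (UNIV - {c0}) \<rightarrow>\<^sub>E {0..q div 2})"
  define z where "z = (\<lambda>c0 :: 'n. restrict (\<lambda>_. 0 :: nat) (UNIV - {c0}))"
  have fin_full: "finite (full c0)" for c0 unfolding full_def by (intro finite_PiE) simp_all
  have z_full: "z c0 \<in> full c0" for c0 by (simp add: z_def full_def restrict_PiE_iff)
  have inj_j: "inj_on j A"
  proof (rule inj_onI)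
    fix a a' assume a: "a \<in> A" "a' \<in> A" "j a = j a'"
    have t: "top a = top a'" using a(3) by (simp add: j_def)
    have rest: "a c = a' c" if "c \<noteq> top a" for c
    proof -
      have "snd (j a) c = snd (j a') c" by (simp only: a(3))
      hence "restrict a (UNIV - {top a}) c = restrict a' (UNIV - {top a'}) c" unfolding j_def snd_conv .
      thus ?thesis using that t by simp
    qed
    have split: "b (top a) + (\<Sum>c\<in>UNIV - {top a}. b c) = q" if "b \<in> A" for b
      using sumA [OF that] by (simp add: sum.remove [of UNIV "top a"])
    have "(\<Sum>c\<in>UNIV - {top a}. a c) = (\<Sum>c\<in>UNIV - {top a}. a' c)" by (rule sum.cong) (simp_all add: rest)
    hence top_eq: "a (top a) = a' (top a)" using split [OF a(1)] split [OF a(2)] by simp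
    show "a = a'"
    proof
      fix c show "a c = a' c" by (cases "c = top a") (simp_all add: top_eq rest)
    qed
  qed
  have j_range: "j ` A \<subseteq> (SIGMA c0:UNIV. full c0 - {z c0})"
  proof
    fix p assume "p \<in> j ` A"
    then obtain a where a: "p = j a" "a \<in> A" by (rule imageE)
    have half: "a c \<le> q div 2" if "c \<noteq> top a" for c
    proof -
      have "a c + a (top a) = (\<Sum>c\<in>{c, top a}. a c)" using that by simp
      also have "\<dots> \<le> (\<Sum>c\<in>UNIV. a c)" by (rule sum_mono2) simp_all
      finally have "a c + a (top a) \<le> q" using sumA [OF a(2)] by simp
      moreover have "a c \<le> a (top a)" by (rule top)
      ultimately show ?thesis by linarith
    qed
    have "restrict a (UNIV - {top a}) \<in> full (top a)"
      unfolding full_def using half by (simp add: restrict_PiE_iff)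
    moreover have "restrict a (UNIV - {top a}) \<noteq> z (top a)"
    proof
      assume eq: "restrict a (UNIV - {top a}) = z (top a)"
      have "a c = 0" if "c \<noteq> top a" for c
        using fun_cong [OF eq, of c] that by (simp add: z_def)
      hence "(\<Sum>c\<in>UNIV - {top a}. a c) = 0" by simp
      hence "a (top a) = q" using sumA [OF a(2)] by (simp add: sum.remove [of UNIV "top a"])
      with ltA [OF a(2), of "top a"] show False by simp
    qed
    ultimately show "p \<in> (SIGMA c0:UNIV. full c0 - {z c0})" unfolding a(1) j_def by blast
  qed
  have "(\<Sum>\<kappa>\<in>NC. row_weight D q (lc \<kappa>)) = (\<Sum>a\<in>A. \<Sum>\<kappa>\<in>{\<kappa> \<in> NC. lc \<kappa> = a}. row_weight D q (lc \<kappa>))"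
    unfolding A_def by (rule sum.image_gen [OF finNC])
  also have "\<dots> \<le> (\<Sum>a\<in>A. h (j a))"
  proof (rule sum_mono)
    fix a assume a: "a \<in> A"
    have "{\<kappa> \<in> NC. lc \<kappa> = a} = {\<kappa> \<in> words q. letter_count {..<q} \<kappa> = a}"
      using ltA [OF a] unfolding NC_def nonconstant_words_def lc_def by blast
    moreover have "(\<Sum>\<kappa>\<in>{\<kappa> \<in> NC. lc \<kappa> = a}. row_weight D q (lc \<kappa>)) =
        (\<Sum>\<kappa>\<in>{\<kappa> \<in> NC. lc \<kappa> = a}. row_weight D q a)"
      by (rule sum.cong) simp_all
    ultimately have "(\<Sum>\<kappa>\<in>{\<kappa> \<in> NC. lc \<kappa> = a}. row_weight D q (lc \<kappa>)) =
        real (card {\<kappa> \<in> words q. letter_count {..<q} \<kappa> = a}) * row_weight D q a"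
      by (simp only: sum_constant)
    also have "\<dots> \<le> (\<Prod>c\<in>UNIV - {top a}. row_term D q (a c))"
      by (rule row_weight_bound [OF sumA [OF a] q D])
    also have "\<dots> = h (j a)" by (simp add: h_def j_def)
    finally show "(\<Sum>\<kappa>\<in>{\<kappa> \<in> NC. lc \<kappa> = a}. row_weight D q (lc \<kappa>)) \<le> h (j a)" .
  qed
  also have "\<dots> = sum h (j ` A)" using sum.reindex [OF inj_j, of h] by simp
  also have "\<dots> \<le> sum h (SIGMA c0:UNIV. full c0 - {z c0})"
    by (rule sum_mono2 [OF _ j_range]) (simp_all add: fin_full h_nonneg)
  also have "\<dots> = (\<Sum>c0\<in>UNIV. \<Sum>b\<in>full c0 - {z c0}. h (c0, b))"
    by (subst sum.Sigma) (simp_all add: fin_full)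
  also have "\<dots> = (\<Sum>c0\<in>(UNIV :: 'n set). (1 + (\<Sum>k\<in>{1..q div 2}. row_term D q k)) ^ (CARD('n) - 1) - 1)"
  proof (rule sum.cong [OF refl])
    fix c0 :: 'n
    have "(\<Sum>b\<in>full c0. h (c0, b)) = (\<Prod>c\<in>UNIV - {c0}. \<Sum>k\<in>{0..q div 2}. row_term D q k)"
      unfolding h_def full_def prod.case by (rule prod_sum_PiE [symmetric]) simp_all
    also have "\<dots> = (\<Sum>k\<in>{0..q div 2}. row_term D q k) ^ (CARD('n) - 1)" by (simp add: card_Diff_singleton)
    also have "(\<Sum>k\<in>{0..q div 2}. row_term D q k) = 1 + (\<Sum>k\<in>{1..q div 2}. row_term D q k)"
      by (simp add: sum.atLeast_Suc_atMost)
    finally have "(\<Sum>b\<in>full c0. h (c0, b)) = (1 + (\<Sum>k\<in>{1..q div 2}. row_term D q k)) ^ (CARD('n) - 1)" .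
    moreover have "h (c0, z c0) = 1" by (simp add: h_def z_def)
    ultimately show "(\<Sum>b\<in>full c0 - {z c0}. h (c0, b)) =
        (1 + (\<Sum>k\<in>{1..q div 2}. row_term D q k)) ^ (CARD('n) - 1) - 1"
      using sum.remove [OF fin_full z_full, of "\<lambda>b. h (c0, b)"] by simp
  qed
  also have "\<dots> = real CARD('n) * ((1 + (\<Sum>k\<in>{1..q div 2}. row_term D q k)) ^ (CARD('n) - 1) - 1)" by simp
  finally show ?thesis unfolding NC_def lc_def .
qed

lemma eventually_error_small:
  fixes D m :: nat
  assumes D: "D > 0"
  shows "\<exists>Q>0. \<forall>q\<ge>Q. (real m + real m * ((1 + (\<Sum>k\<in>{1..q div 2}. row_term D q k)) ^ (m - 1) - 1)) ^ m - real m ^ m < fact m"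
proof -
  obtain C where C: "C > 0" "\<And>q. q > 0 \<Longrightarrow>
      (\<Sum>k\<in>{1..q div 2}. real k * sqrt (real k / real q) ^ k) \<le> C / sqrt (real q)"
    using tail_sum_bound by blast
  define E where "E = exp 1 * real D * C"
  define g where "g = (\<lambda>x :: real. (real m + real m * ((1 + x) ^ (m - 1) - 1)) ^ m - real m ^ m)"
  have "filterlim (\<lambda>q. sqrt (real q)) at_top sequentially"
    by (rule filterlim_compose [OF sqrt_at_top filterlim_real_sequentially])
  hence "(\<lambda>q. E / sqrt (real q)) \<longlonglongrightarrow> 0" by (intro tendsto_divide_0 [OF tendsto_const] filterlim_at_top_imp_at_infinity)
  moreover have "isCont g 0" unfolding g_def by (intro continuous_intros)
  ultimately have "(\<lambda>q. g (E / sqrt (real q))) \<longlonglongrightarrow> g 0" by (rule isCont_tendsto_compose [rotated])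
  moreover have "g 0 < fact m" by (simp add: g_def)
  ultimately have "\<forall>\<^sub>F q in sequentially. g (E / sqrt (real q)) < fact m" by (rule order_tendstoD(2))
  then obtain Q where Q: "\<And>q. q \<ge> Q \<Longrightarrow> g (E / sqrt (real q)) < fact m"
    unfolding eventually_sequentially by blast
  have "(real m + real m * ((1 + (\<Sum>k\<in>{1..q div 2}. row_term D q k)) ^ (m - 1) - 1)) ^ m - real m ^ m < fact m"
    if q: "q \<ge> Suc Q" for q
  proof -
    define \<delta> where "\<delta> = (\<Sum>k\<in>{1..q div 2}. row_term D q k)"
    have \<delta>0: "\<delta> \<ge> 0" unfolding \<delta>_def by (intro sum_nonneg row_term_nonneg)
    have "\<delta> = exp 1 * real D * (\<Sum>k\<in>{1..q div 2}. real k * sqrt (real k / real q) ^ k)"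
      unfolding \<delta>_def sum_distrib_left
      using D by (intro sum.cong refl) (auto simp: row_term_def entropy_weight_def)
    also have "\<dots> \<le> exp 1 * real D * (C / sqrt (real q))"
      using q by (intro mult_left_mono C(2)) simp_all
    also have "\<dots> = E / sqrt (real q)" by (simp add: E_def)
    finally have le: "\<delta> \<le> E / sqrt (real q)" .
    have "(1 + \<delta>) ^ (m - 1) \<ge> 1" using \<delta>0 by (intro one_le_power) simp
    moreover have "(1 + \<delta>) ^ (m - 1) \<le> (1 + E / sqrt (real q)) ^ (m - 1)"
      using \<delta>0 le by (intro power_mono) simp_all
    ultimately have "real m + real m * ((1 + \<delta>) ^ (m - 1) - 1) \<le>
        real m + real m * ((1 + E / sqrt (real q)) ^ (m - 1) - 1)"
        and "0 \<le> real m + real m * ((1 + \<delta>) ^ (m - 1) - 1)"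
      by (simp_all add: mult_left_mono)
    hence "g \<delta> \<le> g (E / sqrt (real q))"
      unfolding g_def by (intro diff_right_mono) (rule power_mono)
    also have "\<dots> < fact m" using Q [of q] q by simp
    finally show ?thesis unfolding g_def \<delta>_def .
  qed
  thus ?thesis by (intro exI [of _ "Suc Q"]) simp
qed

section \<open>Brackets of large degree\<close>

lemma det_expand_index_det:
  fixes X :: "'n::finite \<Rightarrow> 'n \<Rightarrow> complex"
  shows "det (\<chi> i t. X i t) = (\<Sum>y\<in>UNIV. index_det y * (\<Prod>i\<in>UNIV. X i (y i)))"
proof -
  have "(\<Sum>y\<in>UNIV. index_det y * (\<Prod>i\<in>UNIV. X i (y i))) =
      (\<Sum>y\<in>{y. y permutes UNIV}. of_int (sign y) * (\<Prod>i\<in>UNIV. X i (y i)))"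
  proof (rule sum.mono_neutral_cong_right)
    show "\<forall>y\<in>UNIV - {y. y permutes UNIV}. index_det y * (\<Prod>i\<in>UNIV. X i (y i)) = 0"
      by (simp add: index_det_not_inj inj_permutes_UNIV)
  qed (simp_all add: index_det_permutes)
  thus ?thesis by (simp add: det_def)
qed

text \<open>
  The unit vectors, to which \<open>extended_weight\<close> gives weight 1, together with further points.
\<close>

definition extended_point :: "('p \<Rightarrow> complex^'n) \<Rightarrow> 'n + 'p \<Rightarrow> complex^'n::finite" where
  "extended_point x p = (case p of Inl c \<Rightarrow> axis c 1 | Inr a \<Rightarrow> x a)"

definition extended_weight :: "('p \<Rightarrow> complex) \<Rightarrow> 'n + 'p \<Rightarrow> complex" where
  "extended_weight y p = (case p of Inl c \<Rightarrow> 1 | Inr a \<Rightarrow> y a)"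

text \<open>
  The choices of unit vectors in all rows contribute \<open>m!\<close>. By Hadamard's inequality all others
  together contribute at most their mass, which is the difference of the total mass and that of the
  choices of unit vectors.
\<close>

lemma det_power_average_close_to_fact:
  fixes x :: "'p \<Rightarrow> complex^'n::finite" and y :: "'p \<Rightarrow> complex"
  assumes P: "finite P" and x: "\<And>p. p \<in> P \<Longrightarrow> norm (x p) \<le> 1"
    and \<epsilon>: "(\<Sum>p\<in>P. cmod (y p)) \<le> \<epsilon>" and n: "even n" "n > 0"
  shows "cmod ((\<Sum>f\<in>UNIV \<rightarrow>\<^sub>E (UNIV <+> P). (\<Prod>i\<in>UNIV. extended_weight y (f i)) *
      det (\<chi> i t. extended_point x (f i) $ t) ^ n) - fact CARD('n)) \<le>
    (real CARD('n) + \<epsilon>) ^ CARD('n) - real CARD('n) ^ CARD('n)"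
proof -
  define W where "W = (extended_weight y :: 'n + 'p \<Rightarrow> complex)"
  define T where "T = (\<lambda>f :: 'n \<Rightarrow> 'n + 'p. (\<Prod>i\<in>UNIV. W (f i)) * det (\<chi> i t. extended_point x (f i) $ t) ^ n)"
  define F where "F = (UNIV :: 'n set) \<rightarrow>\<^sub>E ((UNIV :: 'n set) <+> P)"
  define \<iota> where "\<iota> = (\<lambda>c (i :: 'n). Inl (c i) :: 'n + 'p)"
  define F0 where "F0 = range \<iota>"
  have finQ: "finite ((UNIV :: 'n set) <+> P)" using P by (intro finite_Plus) simp_all
  have finF: "finite F" unfolding F_def using finQ by (intro finite_PiE) simp_all
  have sub: "F0 \<subseteq> F" by (auto simp: F0_def F_def \<iota>_def PiE_UNIV_domain)
  have inj_\<iota>: "inj \<iota>" by (auto simp: inj_def \<iota>_def fun_eq_iff)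
  have "(\<Sum>f\<in>F0. T f) = (\<Sum>c\<in>(UNIV :: ('n \<Rightarrow> 'n) set). T (\<iota> c))"
    unfolding F0_def by (subst sum.reindex [OF inj_\<iota>]) simp
  also have "\<dots> = (\<Sum>c\<in>(UNIV :: ('n \<Rightarrow> 'n) set). index_det c ^ n)"
  proof (rule sum.cong [OF refl])
    fix c :: "'n \<Rightarrow> 'n"
    have "(\<chi> i t. extended_point x (\<iota> c i) $ t) = (\<chi> i t. if c i = t then 1 else 0)"
      by (simp add: vec_eq_iff extended_point_def \<iota>_def axis_def)
    thus "T (\<iota> c) = index_det c ^ n"
      by (simp add: T_def W_def index_det_def) (simp add: \<iota>_def extended_weight_def)
  qed
  also have "\<dots> = fact CARD('n)" by (rule sum_index_det_even_power [OF n])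
  finally have main: "(\<Sum>f\<in>F0. T f) = fact CARD('n)" .
  have "(\<Sum>f\<in>F. T f) - fact CARD('n) = (\<Sum>f\<in>F - F0. T f)"
    using sum.subset_diff [OF sub finF, of T] main by simp
  also have "cmod \<dots> \<le> (\<Sum>f\<in>F - F0. \<Prod>i\<in>UNIV. cmod (W (f i)))"
  proof (rule sum_norm_le)
    fix f assume "f \<in> F - F0"
    hence f: "f i \<in> UNIV <+> P" for i by (auto simp: F_def PiE_UNIV_domain)
    have "norm ((\<chi> i t. extended_point x (f i) $ t) $ i) \<le> 1" for i
      using f [of i] x by (auto simp: extended_point_def norm_axis_1 vec_lambda_eta split: sum.splits)
    hence "cmod (det (\<chi> i t. extended_point x (f i) $ t)) \<le> 1" by (rule hadamard)
    hence "cmod (det (\<chi> i t. extended_point x (f i) $ t)) ^ n \<le> 1" by (intro power_le_one) simp_all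
    hence "(\<Prod>i\<in>UNIV. cmod (W (f i))) * cmod (det (\<chi> i t. extended_point x (f i) $ t)) ^ n \<le> (\<Prod>i\<in>UNIV. cmod (W (f i))) * 1"
      by (rule mult_left_mono) (simp add: prod_nonneg)
    thus "cmod (T f) \<le> (\<Prod>i\<in>UNIV. cmod (W (f i)))"
      unfolding T_def norm_mult norm_power prod_norm by simp
  qed
  also have "\<dots> = (\<Sum>f\<in>F. \<Prod>i\<in>UNIV. cmod (W (f i))) - (\<Sum>f\<in>F0. \<Prod>i\<in>UNIV. cmod (W (f i)))"
    using sum.subset_diff [OF sub finF, of "\<lambda>f. \<Prod>i\<in>UNIV. cmod (W (f i))"] by simp
  also have "(\<Sum>f\<in>F0. \<Prod>i\<in>UNIV. cmod (W (f i))) = real CARD('n) ^ CARD('n)"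
  proof -
    have "(\<Prod>i\<in>UNIV. cmod (W (f i))) = 1" if "f \<in> F0" for f
      using that by (auto simp: F0_def \<iota>_def W_def extended_weight_def)
    moreover have "card F0 = CARD('n) ^ CARD('n)"
      unfolding F0_def by (simp add: card_image inj_\<iota> card_fun)
    ultimately show ?thesis by simp
  qed
  also have "(\<Sum>f\<in>F. \<Prod>i\<in>UNIV. cmod (W (f i))) = (\<Sum>p\<in>UNIV <+> P. cmod (W p)) ^ CARD('n)"
    unfolding F_def by (subst prod_sum_PiE [symmetric]) (simp_all add: P)
  also have "(\<Sum>p\<in>UNIV <+> P. cmod (W p)) = real CARD('n) + (\<Sum>p\<in>P. cmod (y p))"
    using P by (simp add: sum.Plus W_def extended_weight_def)
  also have "(real CARD('n) + (\<Sum>p\<in>P. cmod (y p))) ^ CARD('n) - real CARD('n) ^ CARD('n) \<le>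
      (real CARD('n) + \<epsilon>) ^ CARD('n) - real CARD('n) ^ CARD('n)"
    using \<epsilon> by (intro diff_right_mono power_mono add_left_mono add_nonneg_nonneg sum_nonneg) simp_all
  finally show ?thesis unfolding T_def F_def W_def .
qed

definition blocks :: "nat \<Rightarrow> nat \<Rightarrow> (nat \<times> nat) set" where
  "blocks q D = {..<q} \<times> {..<D}"

lemma finite_blocks [simp]: "finite (blocks q D)"
  by (simp add: blocks_def)

lemma card_blocks [simp]: "card (blocks q D) = q * D"
  by (simp add: blocks_def card_cartesian_product)

lemma letter_count_blocks:
  "letter_count (blocks q D) (\<lambda>j. \<kappa> (fst j)) c = D * letter_count {..<q} \<kappa> c"
proof -
  have "{j \<in> blocks q D. \<kappa> (fst j) = c} = {s \<in> {..<q}. \<kappa> s = c} \<times> {..<D}"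
    by (auto simp: blocks_def)
  thus ?thesis by (simp add: letter_count_def card_cartesian_product)
qed

text \<open>
  The number of ways in which the letters \<open>u\<close> of one row arise from a colouring of the vertices of the
  row, each of which is repeated \<open>D\<close> times, and an arrangement of these copies on the blocks.
\<close>

definition row_kernel :: "nat \<Rightarrow> nat \<Rightarrow> (nat \<times> nat \<Rightarrow> 'n::finite) \<Rightarrow> complex" where
  "row_kernel q D u = (\<Sum>\<kappa>\<in>words q. of_nat (card (rearrangements (blocks q D) (\<lambda>j. \<kappa> (fst j)) u)))"

definition kernel_points :: "nat \<Rightarrow> nat \<Rightarrow> ((nat \<Rightarrow> 'n::finite) \<times> ('n \<Rightarrow> nat)) set" where
  "kernel_points q D = nonconstant_words q \<times> phases (Suc (q * D))"

definition kernel_point :: "nat \<Rightarrow> nat \<Rightarrow> (nat \<Rightarrow> 'n::finite) \<times> ('n \<Rightarrow> nat) \<Rightarrow> complex^'n" where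
  "kernel_point q D p = torus_point (frequency_radius q (letter_count {..<q} (fst p))) (Suc (q * D)) (snd p)"

definition kernel_weight :: "nat \<Rightarrow> nat \<Rightarrow> (nat \<Rightarrow> 'n::finite) \<times> ('n \<Rightarrow> nat) \<Rightarrow> complex" where
  "kernel_weight q D p = torus_weight (blocks q D) (\<lambda>j. fst p (fst j))
     (frequency_radius q (letter_count {..<q} (fst p))) (Suc (q * D)) (snd p) / fact (q * D)"

lemma kernel_point_norm:
  assumes "q > 0"
  shows "norm (kernel_point q D p :: complex^'n::finite) \<le> 1"
proof -
  let ?a = "letter_count {..<q} (fst p)"
  have "(norm (kernel_point q D p))\<^sup>2 = (\<Sum>c\<in>UNIV. real (?a c) / real q)"
    unfolding norm_square_vec kernel_point_def torus_point_def frequency_radius_def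
    by (simp add: norm_mult power_mult_distrib)
  also have "\<dots> = 1"
    unfolding sum_divide_distrib [symmetric] of_nat_sum [symmetric]
    using assms by (subst sum_letter_count) simp_all
  finally show ?thesis by (simp add: power2_eq_1_iff) (smt (verit) norm_ge_zero)
qed

lemma sum_kernel_weight:
  assumes q: "q > 0"
  shows "(\<Sum>p\<in>kernel_points q D. cmod (kernel_weight q D (p :: (nat \<Rightarrow> 'n::finite) \<times> _))) \<le>
    (\<Sum>\<kappa>\<in>nonconstant_words q. row_weight D q (letter_count {..<q} (\<kappa> :: nat \<Rightarrow> 'n)))"
proof -
  have "(\<Sum>p\<in>kernel_points q D. cmod (kernel_weight q D (p :: (nat \<Rightarrow> 'n) \<times> _))) =
      (\<Sum>\<kappa>\<in>nonconstant_words q. \<Sum>e\<in>phases (Suc (q * D)). cmod (kernel_weight q D (\<kappa> :: nat \<Rightarrow> 'n, e)))"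
    unfolding kernel_points_def by (simp add: sum.cartesian_product case_prod_unfold)
  also have "\<dots> \<le> (\<Sum>\<kappa>\<in>nonconstant_words q. row_weight D q (letter_count {..<q} (\<kappa> :: nat \<Rightarrow> 'n)))"
  proof (rule sum_mono)
    fix \<kappa> :: "nat \<Rightarrow> 'n"
    let ?r = "frequency_radius q (letter_count {..<q} \<kappa>)"
    have "(\<Sum>e\<in>phases (Suc (q * D)). cmod (kernel_weight q D (\<kappa>, e))) =
        (\<Sum>e\<in>phases (Suc (q * D)). cmod (torus_weight (blocks q D) (\<lambda>j. \<kappa> (fst j)) ?r (Suc (q * D)) e)) / fact (q * D)"
      unfolding kernel_weight_def fst_conv snd_conv norm_divide norm_fact sum_divide_distrib ..
    also have "\<dots> \<le> (\<Prod>c\<in>UNIV. fact (letter_count (blocks q D) (\<lambda>j. \<kappa> (fst j)) c) *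
        (1 / ?r c) ^ letter_count (blocks q D) (\<lambda>j. \<kappa> (fst j)) c) / fact (q * D)"
      by (intro divide_right_mono sum_norm_torus_weight) (simp_all add: frequency_radius_def)
    also have "\<dots> = row_weight D q (letter_count {..<q} \<kappa>)"
      unfolding letter_count_blocks row_weight_def by (simp only: mult.commute [of q D])
    finally show "(\<Sum>e\<in>phases (Suc (q * D)). cmod (kernel_weight q D (\<kappa>, e))) \<le> row_weight D q (letter_count {..<q} \<kappa>)" .
  qed
  finally show ?thesis .
qed

lemma row_kernel_constant_part:
  fixes u :: "nat \<times> nat \<Rightarrow> 'n::finite"
  assumes q: "q > 0"
  shows "(\<Sum>\<kappa>\<in>words q - nonconstant_words q. of_nat (card (rearrangements (blocks q D) (\<lambda>j. \<kappa> (fst j)) u))) =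
    (\<Sum>c\<in>UNIV. fact (q * D) * (\<Prod>j\<in>blocks q D. axis c (1 :: complex) $ u j))"
proof -
  define k where "k = (\<lambda>c :: 'n. restrict (\<lambda>_. c) {..<q})"
  have inj_k: "inj k"
  proof (rule injI)
    fix c c' assume "k c = k c'"
    from fun_cong [OF this, of 0] show "c = c'" using q by (simp add: k_def)
  qed
  have "words q - nonconstant_words q = range k"
  proof (intro equalityI subsetI)
    fix \<kappa> :: "nat \<Rightarrow> 'n" assume \<kappa>: "\<kappa> \<in> words q - nonconstant_words q"
    then obtain c where "\<not> letter_count {..<q} \<kappa> c < q" unfolding nonconstant_words_def by blast
    hence "card {s \<in> {..<q}. \<kappa> s = c} \<ge> card {..<q}" by (simp add: letter_count_def)
    hence "{s \<in> {..<q}. \<kappa> s = c} = {..<q}" by (intro card_seteq) auto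
    hence const: "\<kappa> s = c" if "s < q" for s using that by blast
    have "\<kappa> = k c"
    proof
      fix s show "\<kappa> s = k c s"
        using const [of s] \<kappa> by (cases "s < q") (auto simp: k_def PiE_def extensional_def)
    qed
    thus "\<kappa> \<in> range k" by blast
  next
    fix \<kappa> assume "\<kappa> \<in> range k"
    then obtain c where c: "\<kappa> = k c" by blast
    have "{s \<in> {..<q}. k c s = c} = {..<q}" by (auto simp: k_def)
    hence "letter_count {..<q} \<kappa> c = q" by (simp add: letter_count_def c)
    hence "\<kappa> \<notin> nonconstant_words q"
      unfolding nonconstant_words_def mem_Collect_eq by (metis less_irrefl)
    moreover have "\<kappa> \<in> words q" unfolding c k_def by (rule restrict_in_words)
    ultimately show "\<kappa> \<in> words q - nonconstant_words q" by blast
  qed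
  hence "(\<Sum>\<kappa>\<in>words q - nonconstant_words q. of_nat (card (rearrangements (blocks q D) (\<lambda>j. \<kappa> (fst j)) u))) =
      (\<Sum>c\<in>UNIV. (of_nat (card (rearrangements (blocks q D) (\<lambda>j. k c (fst j)) u)) :: complex))"
    by (simp add: sum.reindex [OF inj_k])
  also have "\<dots> = (\<Sum>c\<in>UNIV. fact (q * D) * (\<Prod>j\<in>blocks q D. axis c (1 :: complex) $ u j))"
  proof (rule sum.cong [OF refl])
    fix c :: 'n
    have k_eq: "k c (fst (\<pi> j)) = c" if "\<pi> permutes blocks q D" "j \<in> blocks q D" for \<pi> j
    proof -
      have "\<pi> j \<in> blocks q D" using permutes_in_image [OF that(1)] that(2) by blast
      hence "fst (\<pi> j) < q" unfolding blocks_def mem_Times_iff by simp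
      thus ?thesis by (simp add: k_def)
    qed
    show "of_nat (card (rearrangements (blocks q D) (\<lambda>j. k c (fst j)) u)) =
        fact (q * D) * (\<Prod>j\<in>blocks q D. axis c (1 :: complex) $ u j)"
    proof (cases "\<forall>j\<in>blocks q D. u j = c")
      case True
      have "rearrangements (blocks q D) (\<lambda>j. k c (fst j)) u = {\<pi>. \<pi> permutes blocks q D}"
      proof (intro equalityI subsetI)
        fix \<pi> assume "\<pi> \<in> {\<pi>. \<pi> permutes blocks q D}"
        hence \<pi>: "\<pi> permutes blocks q D" by (rule CollectD)
        have "k c (fst (\<pi> j)) = u j" if j: "j \<in> blocks q D" for j
          unfolding k_eq [OF \<pi> j] by (rule bspec [OF True j, symmetric])
        thus "\<pi> \<in> rearrangements (blocks q D) (\<lambda>j. k c (fst j)) u"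
          unfolding rearrangements_def using \<pi> by blast
      qed (unfold rearrangements_def, blast)
      moreover have "card {\<pi>. \<pi> permutes blocks q D} = fact (q * D)"
        by (rule card_permutations) simp_all
      moreover have "(\<Prod>j\<in>blocks q D. axis c (1 :: complex) $ u j) = 1"
        using True by (intro prod.neutral) (simp add: axis_def)
      ultimately show ?thesis by simp
    next
      case False
      then obtain j where j: "j \<in> blocks q D" "u j \<noteq> c" by blast
      have "rearrangements (blocks q D) (\<lambda>j. k c (fst j)) u = {}"
      proof (rule equals0I)
        fix \<pi> assume "\<pi> \<in> rearrangements (blocks q D) (\<lambda>j. k c (fst j)) u"
        hence \<pi>: "\<pi> permutes blocks q D" "k c (fst (\<pi> j)) = u j"
          using j(1) unfolding rearrangements_def by blast+
        with k_eq [OF \<pi>(1) j(1)] j(2) show False by simp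
      qed
      moreover have "(\<Prod>j\<in>blocks q D. axis c (1 :: complex) $ u j) = 0"
        using j by (intro prod_zero bexI [of _ j]) (simp_all add: axis_def)
      ultimately show ?thesis by simp
    qed
  qed
  finally show ?thesis .
qed

text \<open>
  Constant colourings evaluate at the unit vectors, and the remaining ones at torus points.
\<close>

lemma row_kernel_eq:
  fixes u :: "nat \<times> nat \<Rightarrow> 'n::finite"
  assumes q: "q > 0"
  shows "row_kernel q D u = fact (q * D) * (\<Sum>p\<in>UNIV <+> kernel_points q D.
    extended_weight (kernel_weight q D) p * (\<Prod>j\<in>blocks q D. extended_point (kernel_point q D) p $ u j))"
proof -
  let ?J = "blocks q D"
  have "row_kernel q D u = (\<Sum>\<kappa>\<in>words q - nonconstant_words q. of_nat (card (rearrangements ?J (\<lambda>j. \<kappa> (fst j)) u))) +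
      (\<Sum>\<kappa>\<in>nonconstant_words q. of_nat (card (rearrangements ?J (\<lambda>j. \<kappa> (fst j)) u)))"
    unfolding row_kernel_def by (rule sum.subset_diff) (simp_all add: nonconstant_words_def)
  also have "(\<Sum>\<kappa>\<in>nonconstant_words q. of_nat (card (rearrangements ?J (\<lambda>j. \<kappa> (fst j)) u))) =
      (\<Sum>\<kappa>\<in>nonconstant_words q. \<Sum>e\<in>phases (Suc (q * D)). fact (q * D) * (kernel_weight q D (\<kappa>, e) * (\<Prod>j\<in>?J. kernel_point q D (\<kappa>, e) $ u j)))"
  proof (rule sum.cong [OF refl])
    fix \<kappa> :: "nat \<Rightarrow> 'n"
    have "of_nat (card (rearrangements ?J (\<lambda>j. \<kappa> (fst j)) u)) =
        (\<Sum>e\<in>phases (Suc (q * D)). torus_weight ?J (\<lambda>j. \<kappa> (fst j)) (frequency_radius q (letter_count {..<q} \<kappa>)) (Suc (q * D)) e *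
          (\<Prod>j\<in>?J. torus_point (frequency_radius q (letter_count {..<q} \<kappa>)) (Suc (q * D)) e $ u j))"
      by (rule rearrangements_as_torus_average) (use q in \<open>simp_all add: letter_count_blocks frequency_radius_def\<close>)
    thus "of_nat (card (rearrangements ?J (\<lambda>j. \<kappa> (fst j)) u)) =
        (\<Sum>e\<in>phases (Suc (q * D)). fact (q * D) * (kernel_weight q D (\<kappa>, e) * (\<Prod>j\<in>?J. kernel_point q D (\<kappa>, e) $ u j)))"
      by (simp add: kernel_weight_def kernel_point_def)
  qed
  also have "\<dots> = (\<Sum>p\<in>kernel_points q D. fact (q * D) * (kernel_weight q D p * (\<Prod>j\<in>?J. kernel_point q D p $ u j)))"
    unfolding kernel_points_def by (simp add: sum.cartesian_product case_prod_unfold)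
  finally show ?thesis
    unfolding row_kernel_constant_part [OF q]
    by (simp add: sum.Plus kernel_points_def extended_weight_def extended_point_def sum_distrib_left distrib_left)
qed

lemma sum_swap_rows_columns:
  fixes h :: "'j \<Rightarrow> ('n::finite \<Rightarrow> 'n) \<Rightarrow> complex"
  assumes J: "finite J"
  shows "(\<Sum>U\<in>UNIV \<rightarrow>\<^sub>E (J \<rightarrow>\<^sub>E UNIV). \<Prod>j\<in>J. h j (\<lambda>i. U i j)) = (\<Prod>j\<in>J. \<Sum>y\<in>UNIV. h j y)"
proof -
  have "(\<Prod>j\<in>J. \<Sum>y\<in>UNIV. h j y) = (\<Sum>Z\<in>J \<rightarrow>\<^sub>E UNIV. \<Prod>j\<in>J. h j (Z j))"
    by (rule prod_sum_PiE) (simp_all add: J)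
  also have "\<dots> = (\<Sum>U\<in>UNIV \<rightarrow>\<^sub>E (J \<rightarrow>\<^sub>E UNIV). \<Prod>j\<in>J. h j (\<lambda>i. U i j))"
  proof (rule sum.reindex_bij_witness [of _ "\<lambda>U. restrict (\<lambda>j i. U i j) J" "\<lambda>Z i. restrict (\<lambda>j. Z j i) J"])
    fix Z :: "'j \<Rightarrow> 'n \<Rightarrow> 'n" assume Z: "Z \<in> J \<rightarrow>\<^sub>E UNIV"
    show "restrict (\<lambda>j i. restrict (\<lambda>j. Z j i) J j) J = Z"
    proof
      fix j show "restrict (\<lambda>j i. restrict (\<lambda>j. Z j i) J j) J j = Z j"
        using PiE_arb [OF Z, of j] by (cases "j \<in> J") simp_all
    qed
    show "(\<lambda>i. restrict (\<lambda>j. Z j i) J) \<in> UNIV \<rightarrow>\<^sub>E (J \<rightarrow>\<^sub>E UNIV)"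
      by (simp add: PiE_UNIV_domain restrict_PiE_iff)
    show "(\<Prod>j\<in>J. h j (\<lambda>i. restrict (\<lambda>j. Z j i) J j)) = (\<Prod>j\<in>J. h j (Z j))"
      by (rule prod.cong) simp_all
  next
    fix U :: "'n \<Rightarrow> 'j \<Rightarrow> 'n" assume U: "U \<in> UNIV \<rightarrow>\<^sub>E (J \<rightarrow>\<^sub>E UNIV)"
    hence Ui: "U i \<in> J \<rightarrow>\<^sub>E UNIV" for i by (rule PiE_mem) simp
    show "(\<lambda>i. restrict (\<lambda>j. restrict (\<lambda>j i. U i j) J j i) J) = U"
    proof (intro ext)
      fix i j show "restrict (\<lambda>j. restrict (\<lambda>j i. U i j) J j i) J j = U i j"
        using PiE_arb [OF Ui, of j i] by (cases "j \<in> J") simp_all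
    qed
    show "restrict (\<lambda>j i. U i j) J \<in> J \<rightarrow>\<^sub>E UNIV" by (simp add: restrict_PiE_iff)
  qed
  finally show ?thesis ..
qed

lemma sum_over_words_of_rows:
  fixes wd :: "'w \<Rightarrow> 'j \<Rightarrow> 'n::finite" and \<Psi> :: "('n \<Rightarrow> 'j \<Rightarrow> 'n) \<Rightarrow> complex"
  assumes J: "finite J" and \<Omega>: "finite \<Omega>"
    and \<Psi>: "\<And>U U'. (\<And>i j. j \<in> J \<Longrightarrow> U i j = U' i j) \<Longrightarrow> \<Psi> U = \<Psi> U'"
  shows "(\<Sum>e\<in>UNIV \<rightarrow>\<^sub>E \<Omega>. \<Psi> (\<lambda>i. wd (e i))) =
    (\<Sum>U\<in>UNIV \<rightarrow>\<^sub>E (J \<rightarrow>\<^sub>E UNIV).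
      (\<Prod>i\<in>UNIV. of_nat (card {o' \<in> \<Omega>. \<forall>j\<in>J. wd o' j = U i j})) * \<Psi> U)"
proof -
  let ?W = "UNIV \<rightarrow>\<^sub>E (J \<rightarrow>\<^sub>E UNIV) :: ('n \<Rightarrow> 'j \<Rightarrow> 'n) set"
  have finW: "finite ?W" using J by (intro finite_PiE) simp_all
  have one: "\<Psi> (\<lambda>i. wd (e i)) = (\<Sum>U\<in>?W. (\<Prod>i\<in>UNIV. if \<forall>j\<in>J. wd (e i) j = U i j then 1 else 0) * \<Psi> U)" for e :: "'n \<Rightarrow> 'w"
  proof -
    define U0 where "U0 = (\<lambda>i. restrict (wd (e i)) J)"
    have U0: "U0 \<in> ?W" by (simp add: U0_def PiE_UNIV_domain restrict_PiE_iff)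
    have "(\<Sum>U\<in>?W. (\<Prod>i\<in>UNIV. if \<forall>j\<in>J. wd (e i) j = U i j then 1 else 0) * \<Psi> U) =
        (\<Sum>U\<in>?W. if U = U0 then \<Psi> U0 else 0)"
    proof (rule sum.cong [OF refl])
      fix U assume U: "U \<in> ?W"
      show "(\<Prod>i\<in>UNIV. if \<forall>j\<in>J. wd (e i) j = U i j then 1 else 0) * \<Psi> U = (if U = U0 then \<Psi> U0 else 0)"
      proof (cases "U = U0")
        case True
        thus ?thesis by (simp add: U0_def)
      next
        case False
        have "\<exists>i. \<not> (\<forall>j\<in>J. wd (e i) j = U i j)"
        proof (rule ccontr)
          assume "\<not> ?thesis"
          hence eq: "wd (e i) j = U i j" if "j \<in> J" for i j using that by blast
          have "U = U0"
          proof (intro ext)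
            fix i j
            have "U i \<in> J \<rightarrow>\<^sub>E UNIV" using U by (rule PiE_mem) simp
            thus "U i j = U0 i j" using eq [of j i] PiE_arb [of "U i" J _ j] by (cases "j \<in> J") (simp_all add: U0_def)
          qed
          with False show False by blast
        qed
        then obtain i where "\<not> (\<forall>j\<in>J. wd (e i) j = U i j)" by blast
        hence "(\<Prod>i\<in>UNIV. if \<forall>j\<in>J. wd (e i) j = U i j then 1 else 0 :: complex) = 0"
          by (intro prod_zero bexI [of _ i]) simp_all
        thus ?thesis using False by (simp only: mult_zero_left if_False)
      qed
    qed
    also have "\<dots> = \<Psi> U0" using finW U0 by simp
    also have "\<dots> = \<Psi> (\<lambda>i. wd (e i))" by (rule \<Psi>) (simp add: U0_def)
    finally show ?thesis ..
  qed
  have "(\<Sum>e\<in>UNIV \<rightarrow>\<^sub>E \<Omega>. \<Psi> (\<lambda>i. wd (e i))) =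
      (\<Sum>U\<in>?W. (\<Sum>e\<in>UNIV \<rightarrow>\<^sub>E \<Omega>. \<Prod>i\<in>UNIV. if \<forall>j\<in>J. wd (e i) j = U i j then 1 else 0) * \<Psi> U)"
    unfolding one sum_distrib_right by (rule sum.swap)
  also have "\<dots> = (\<Sum>U\<in>?W. (\<Prod>i\<in>UNIV. \<Sum>o'\<in>\<Omega>. if \<forall>j\<in>J. wd o' j = U i j then 1 else 0) * \<Psi> U)"
    by (subst prod_sum_PiE) (simp_all add: \<Omega>)
  also have "\<dots> = (\<Sum>U\<in>?W. (\<Prod>i\<in>UNIV. of_nat (card {o' \<in> \<Omega>. \<forall>j\<in>J. wd o' j = U i j})) * \<Psi> U)"
    by (simp add: sum.inter_filter [OF \<Omega>, symmetric])
  finally show ?thesis .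
qed

text \<open>
  Vertex \<open>(i, s)\<close> stands at place \<open>i\<close> of those blocks that \<open>\<pi> i\<close> maps to one of the \<open>D\<close> pairs
  \<open>(s, r)\<close>. Averaging over \<open>\<pi>\<close> symmetrizes each of the \<open>m\<close> places, and the result is, up to a
  factor, Cayley's invariant \<open>det(\<partial>) ^ (q D)\<close> of the \<open>q\<close>-th power of a form.
\<close>

definition arrangement :: "('n \<Rightarrow> nat \<times> nat \<Rightarrow> nat \<times> nat) \<Rightarrow> nat \<times> nat \<Rightarrow> 'n \<Rightarrow> 'n \<times> nat" where
  "arrangement \<pi> j i = (i, fst (\<pi> i j))"

text \<open>
  The rows are arranged and coloured independently, so the sum applies the functional given by
  \<^const>\<open>row_kernel\<close> to each row of a product of \<open>q D\<close> determinants; \<open>row_kernel_eq\<close> expresses that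
  functional by evaluations at points, and at points the product is a power of a determinant.
\<close>

lemma sum_arrangements:
  fixes D q :: nat
  defines "J \<equiv> blocks q D"
  assumes q: "q > 0"
  shows "(\<Sum>\<pi>\<in>(UNIV :: 'n::finite set) \<rightarrow>\<^sub>E {p. p permutes J}. bracket_value J (UNIV \<times> {..<q}) (arrangement \<pi>)) =
    fact (q * D) ^ CARD('n) * (\<Sum>f\<in>(UNIV :: 'n set) \<rightarrow>\<^sub>E (UNIV <+> kernel_points q D).
      (\<Prod>i\<in>UNIV. extended_weight (kernel_weight q D) (f i)) *
      det (\<chi> i t. extended_point (kernel_point q D) (f i) $ t) ^ (q * D))"
proof -
  let ?wt = "extended_weight (kernel_weight q D) :: 'n + (nat \<Rightarrow> 'n) \<times> ('n \<Rightarrow> nat) \<Rightarrow> complex"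
  let ?pt = "extended_point (kernel_point q D) :: 'n + (nat \<Rightarrow> 'n) \<times> ('n \<Rightarrow> nat) \<Rightarrow> complex^'n"
  let ?F = "(UNIV :: 'n set) \<rightarrow>\<^sub>E (UNIV <+> (kernel_points q D :: ((nat \<Rightarrow> 'n) \<times> ('n \<Rightarrow> nat)) set))"
  let ?W = "(UNIV :: 'n set) \<rightarrow>\<^sub>E (J \<rightarrow>\<^sub>E (UNIV :: 'n set))"
  define S where "S = {p. p permutes J}"
  define V where "V = (UNIV :: 'n set) \<times> {..<q}"
  define \<Omega> where "\<Omega> = S \<times> (words q :: (nat \<Rightarrow> 'n) set)"
  define wd where "wd = (\<lambda>(p :: nat \<times> nat \<Rightarrow> nat \<times> nat, \<kappa> :: nat \<Rightarrow> 'n) j. \<kappa> (fst (p j)))"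
  define \<Psi> where "\<Psi> = (\<lambda>U :: 'n \<Rightarrow> nat \<times> nat \<Rightarrow> 'n. \<Prod>j\<in>J. index_det (\<lambda>i. U i j))"
  have finJ: "finite J" and cardJ: "card J = q * D" by (simp_all add: J_def)
  have finS: "finite S" unfolding S_def by (rule finite_permutations [OF finJ])
  have fin\<Omega>: "finite \<Omega>" by (simp add: \<Omega>_def finS)
  have finP: "finite ((UNIV :: 'n set) <+> (kernel_points q D :: ((nat \<Rightarrow> 'n) \<times> ('n \<Rightarrow> nat)) set))"
    by (simp add: kernel_points_def)
  \<comment> \<open>Regroup a vertex colouring as one colour word per row.\<close>
  have "(\<Sum>\<pi>\<in>(UNIV :: 'n set) \<rightarrow>\<^sub>E S. bracket_value J V (arrangement \<pi>)) =
      (\<Sum>z\<in>(UNIV \<rightarrow>\<^sub>E S) \<times> (V \<rightarrow>\<^sub>E UNIV). \<Prod>j\<in>J. index_det (\<lambda>i. snd z (i, fst (fst z i j))))"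
    unfolding bracket_value_def arrangement_def by (simp add: sum.cartesian_product case_prod_unfold)
  also have "\<dots> = (\<Sum>e\<in>UNIV \<rightarrow>\<^sub>E \<Omega>. \<Psi> (\<lambda>i. wd (e i)))"
  proof (rule sum.reindex_bij_witness [of _
        "\<lambda>e. (\<lambda>i. fst (e i), restrict (\<lambda>v. snd (e (fst v)) (snd v)) V)"
        "\<lambda>z i. (fst z i, restrict (\<lambda>s. snd z (i, s)) {..<q})"])
    fix z :: "('n \<Rightarrow> nat \<times> nat \<Rightarrow> nat \<times> nat) \<times> ('n \<times> nat \<Rightarrow> 'n)"
    assume z: "z \<in> (UNIV \<rightarrow>\<^sub>E S) \<times> (V \<rightarrow>\<^sub>E UNIV)"
    obtain \<pi> k where zk: "z = (\<pi>, k)" by (metis surj_pair)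
    have "\<pi> \<in> UNIV \<rightarrow>\<^sub>E S" using z unfolding zk by simp
    hence \<pi>: "\<pi> i \<in> S" for i by (rule PiE_mem) simp
    have k: "k \<in> V \<rightarrow>\<^sub>E UNIV" using z unfolding zk by simp
    have "restrict (\<lambda>v. restrict (\<lambda>s. k (fst v, s)) {..<q} (snd v)) V = k"
    proof
      fix v show "restrict (\<lambda>v. restrict (\<lambda>s. k (fst v, s)) {..<q} (snd v)) V v = k v"
        using PiE_arb [OF k, of v] by (cases "v \<in> V") (auto simp: V_def)
    qed
    thus "(\<lambda>i. fst (fst z i, restrict (\<lambda>s. snd z (i, s)) {..<q}),
        restrict (\<lambda>v. snd (fst z (fst v), restrict (\<lambda>s. snd z (fst v, s)) {..<q}) (snd v)) V) = z"
      unfolding zk by simp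
    show "(\<lambda>i. (fst z i, restrict (\<lambda>s. snd z (i, s)) {..<q})) \<in> UNIV \<rightarrow>\<^sub>E \<Omega>"
      unfolding zk \<Omega>_def using \<pi> by (simp add: PiE_UNIV_domain)
    show "\<Psi> (\<lambda>i. wd (fst z i, restrict (\<lambda>s. snd z (i, s)) {..<q})) =
        (\<Prod>j\<in>J. index_det (\<lambda>i. snd z (i, fst (fst z i j))))"
      unfolding zk \<Psi>_def
    proof (rule prod.cong [OF refl])
      fix j assume j: "j \<in> J"
      have "fst (\<pi> i j) < q" for i
      proof -
        have "\<pi> i j \<in> J" using \<pi> [of i] j permutes_in_image [of "\<pi> i" J j] unfolding S_def by simp
        thus ?thesis unfolding J_def blocks_def mem_Times_iff by simp
      qed
      thus "index_det (\<lambda>i. wd (fst (\<pi>, k) i, restrict (\<lambda>s. snd (\<pi>, k) (i, s)) {..<q}) j) =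
          index_det (\<lambda>i. snd (\<pi>, k) (i, fst (fst (\<pi>, k) i j)))"
        by (simp add: wd_def)
    qed
  next
    fix e :: "'n \<Rightarrow> (nat \<times> nat \<Rightarrow> nat \<times> nat) \<times> (nat \<Rightarrow> 'n)"
    assume e: "e \<in> UNIV \<rightarrow>\<^sub>E \<Omega>"
    hence ei: "e i \<in> \<Omega>" for i by (rule PiE_mem) simp
    have fst_e: "fst (e i) \<in> S" and snd_e: "snd (e i) \<in> words q" for i
      using ei [of i] unfolding \<Omega>_def mem_Times_iff by simp_all
    have word: "restrict (\<lambda>s. restrict (\<lambda>v. snd (e (fst v)) (snd v)) V (i, s)) {..<q} = snd (e i)" for i
    proof
      fix s show "restrict (\<lambda>s. restrict (\<lambda>v. snd (e (fst v)) (snd v)) V (i, s)) {..<q} s = snd (e i) s"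
        using PiE_arb [OF snd_e, of s i] by (cases "s < q") (simp_all add: V_def)
    qed
    show "(\<lambda>i. (fst (\<lambda>i. fst (e i), restrict (\<lambda>v. snd (e (fst v)) (snd v)) V) i,
        restrict (\<lambda>s. snd (\<lambda>i. fst (e i), restrict (\<lambda>v. snd (e (fst v)) (snd v)) V) (i, s)) {..<q})) = e"
      unfolding fst_conv snd_conv word prod.collapse ..
    show "(\<lambda>i. fst (e i), restrict (\<lambda>v. snd (e (fst v)) (snd v)) V) \<in> (UNIV \<rightarrow>\<^sub>E S) \<times> (V \<rightarrow>\<^sub>E UNIV)"
      using fst_e by (simp add: PiE_UNIV_domain restrict_PiE_iff)
  qed
  also have "\<dots> = (\<Sum>U\<in>?W.
      (\<Prod>i\<in>UNIV. of_nat (card {o' \<in> \<Omega>. \<forall>j\<in>J. wd o' j = U i j})) * \<Psi> U)"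
    by (rule sum_over_words_of_rows [OF finJ fin\<Omega>])
       (simp add: \<Psi>_def cong: prod.cong)
  also have "\<dots> = (\<Sum>U\<in>?W. (\<Prod>i\<in>UNIV. row_kernel q D (U i)) * \<Psi> U)"
  proof -
    have "of_nat (card {o' \<in> \<Omega>. \<forall>j\<in>J. wd o' j = u j}) = row_kernel q D u" for u :: "nat \<times> nat \<Rightarrow> 'n"
    proof -
      have "of_nat (card {o' \<in> \<Omega>. \<forall>j\<in>J. wd o' j = u j}) =
          (\<Sum>o'\<in>\<Omega>. if \<forall>j\<in>J. wd o' j = u j then 1 else 0 :: complex)"
        by (simp add: sum.inter_filter [OF fin\<Omega>, symmetric])
      also have "\<dots> = (\<Sum>p\<in>S. \<Sum>\<kappa>\<in>words q. if \<forall>j\<in>J. \<kappa> (fst (p j)) = u j then 1 else 0)"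
        unfolding \<Omega>_def wd_def by (simp add: sum.cartesian_product case_prod_unfold)
      also have "\<dots> = (\<Sum>\<kappa>\<in>words q. \<Sum>p\<in>S. if \<forall>j\<in>J. \<kappa> (fst (p j)) = u j then 1 else 0)"
        by (rule sum.swap)
      also have "\<dots> = row_kernel q D u"
        unfolding row_kernel_def rearrangements_def S_def [symmetric] J_def [symmetric]
      proof (rule sum.cong [OF refl])
        fix \<kappa> :: "nat \<Rightarrow> 'n"
        have "{\<pi>. \<pi> permutes J \<and> (\<forall>j\<in>J. \<kappa> (fst (\<pi> j)) = u j)} = {p \<in> S. \<forall>j\<in>J. \<kappa> (fst (p j)) = u j}"
          by (simp add: S_def)
        thus "(\<Sum>p\<in>S. if \<forall>j\<in>J. \<kappa> (fst (p j)) = u j then 1 else 0) =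
          (of_nat (card {\<pi>. \<pi> permutes J \<and> (\<forall>j\<in>J. \<kappa> (fst (\<pi> j)) = u j)}) :: complex)"
          by (simp add: sum.inter_filter [OF finS, symmetric])
      qed
      finally show ?thesis .
    qed
    thus ?thesis by (simp only:)
  qed
  also have "\<dots> = (\<Sum>U\<in>?W. fact (q * D) ^ CARD('n) *
      (\<Sum>f\<in>?F. (\<Prod>i\<in>UNIV. ?wt (f i)) *
        (\<Prod>j\<in>J. index_det (\<lambda>i. U i j) * (\<Prod>i\<in>UNIV. ?pt (f i) $ U i j))))"
  proof (rule sum.cong [OF refl])
    fix U :: "'n \<Rightarrow> nat \<times> nat \<Rightarrow> 'n"
    have "(\<Prod>i\<in>UNIV. row_kernel q D (U i)) = fact (q * D) ^ CARD('n) *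
        (\<Prod>i\<in>UNIV. \<Sum>p\<in>UNIV <+> kernel_points q D. ?wt p *
          (\<Prod>j\<in>J. ?pt p $ U i j))"
      unfolding row_kernel_eq [OF q] J_def [symmetric] by (simp add: prod.distrib)
    also have "(\<Prod>i\<in>UNIV. \<Sum>p\<in>UNIV <+> kernel_points q D. ?wt p *
          (\<Prod>j\<in>J. ?pt p $ U i j)) =
        (\<Sum>f\<in>?F. \<Prod>i\<in>UNIV. ?wt (f i) *
          (\<Prod>j\<in>J. ?pt (f i) $ U i j))"
      by (rule prod_sum_PiE) (simp_all only: finite_class.finite_UNIV finP)
    finally have K: "(\<Prod>i\<in>UNIV. row_kernel q D (U i)) = fact (q * D) ^ CARD('n) *
        (\<Sum>f\<in>?F. \<Prod>i\<in>UNIV. ?wt (f i) *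
          (\<Prod>j\<in>J. ?pt (f i) $ U i j))" .
    have swap: "(\<Prod>i\<in>UNIV. \<Prod>j\<in>J. ?pt (f i) $ U i j) =
        (\<Prod>j\<in>J. \<Prod>i\<in>UNIV. ?pt (f i) $ U i j)" for f :: "'n \<Rightarrow> 'n + (nat \<Rightarrow> 'n) \<times> ('n \<Rightarrow> nat)"
      by (rule prod.swap)
    show "(\<Prod>i\<in>UNIV. row_kernel q D (U i)) * \<Psi> U = fact (q * D) ^ CARD('n) *
      (\<Sum>f\<in>?F. (\<Prod>i\<in>UNIV. ?wt (f i)) *
        (\<Prod>j\<in>J. index_det (\<lambda>i. U i j) * (\<Prod>i\<in>UNIV. ?pt (f i) $ U i j)))"
      unfolding K \<Psi>_def prod.distrib swap sum_distrib_left sum_distrib_right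
      by (intro sum.cong refl) (simp only: mult_ac)
  qed
  also have "\<dots> = fact (q * D) ^ CARD('n) *
      (\<Sum>f\<in>?F. (\<Prod>i\<in>UNIV. ?wt (f i)) *
        (\<Sum>U\<in>?W. \<Prod>j\<in>J. index_det (\<lambda>i. U i j) *
          (\<Prod>i\<in>UNIV. ?pt (f i) $ U i j)))"
    unfolding sum_distrib_left by (rule sum.swap)
  also have "\<dots> = fact (q * D) ^ CARD('n) *
      (\<Sum>f\<in>?F. (\<Prod>i\<in>UNIV. ?wt (f i)) *
        det (\<chi> i t. ?pt (f i) $ t) ^ (q * D))"
  proof -
    have "(\<Sum>U\<in>?W. \<Prod>j\<in>J. index_det (\<lambda>i. U i j) *
          (\<Prod>i\<in>UNIV. ?pt (f i) $ U i j)) =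
        det (\<chi> i t. ?pt (f i) $ t) ^ (q * D)"
      for f :: "'n \<Rightarrow> 'n + (nat \<Rightarrow> 'n) \<times> ('n \<Rightarrow> nat)"
      using sum_swap_rows_columns [OF finJ, of "\<lambda>j y. index_det y * (\<Prod>i\<in>UNIV. ?pt (f i) $ y i)"]
      unfolding det_expand_index_det [of "\<lambda>i t. ?pt (f i) $ t", symmetric]
      by (simp add: cardJ)
    thus ?thesis by (simp only:)
  qed
  finally show ?thesis unfolding S_def V_def .
qed

lemma arrangement_degree:
  fixes \<pi> :: "'n::finite \<Rightarrow> nat \<times> nat \<Rightarrow> nat \<times> nat"
  assumes \<pi>: "\<And>i. \<pi> i permutes blocks q D" and v: "v \<in> UNIV \<times> {..<q}"
  shows "card {p \<in> blocks q D \<times> UNIV. arrangement \<pi> (fst p) (snd p) = v} = D"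
proof -
  obtain i s where "v = (i, s)" by (metis surj_pair)
  with v have vs: "v = (i, s)" "s < q" by simp_all
  have "{p \<in> blocks q D \<times> UNIV. arrangement \<pi> (fst p) (snd p) = v} =
      (\<lambda>r. (inv (\<pi> i) (s, r), i)) ` {..<D}"
  proof (intro equalityI subsetI)
    fix p assume "p \<in> {p \<in> blocks q D \<times> UNIV. arrangement \<pi> (fst p) (snd p) = v}"
    then obtain j where j: "p = (j, i)" "j \<in> blocks q D" "fst (\<pi> i j) = s"
      unfolding arrangement_def vs(1) by (cases p) simp
    have "\<pi> i j \<in> blocks q D" using permutes_in_image [OF \<pi>] j(2) by blast
    hence "snd (\<pi> i j) < D" unfolding blocks_def mem_Times_iff by simp
    then obtain r where r: "r < D" "\<pi> i j = (s, r)" using j(3) by (metis prod.collapse)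
    have "j = inv (\<pi> i) (s, r)" unfolding r(2) [symmetric] by (rule permutes_inverses(2) [OF \<pi>, symmetric])
    thus "p \<in> (\<lambda>r. (inv (\<pi> i) (s, r), i)) ` {..<D}" using j(1) r(1) by blast
  next
    fix p assume "p \<in> (\<lambda>r. (inv (\<pi> i) (s, r), i)) ` {..<D}"
    then obtain r where r: "r < D" "p = (inv (\<pi> i) (s, r), i)" by blast
    have "inv (\<pi> i) (s, r) \<in> blocks q D"
      using permutes_in_image [OF permutes_inv [OF \<pi>]] r(1) vs(2) by (simp add: blocks_def)
    moreover have "arrangement \<pi> (fst p) (snd p) = v"
      unfolding r(2) arrangement_def vs(1) by (simp add: permutes_inverses(1) [OF \<pi>])
    ultimately show "p \<in> {p \<in> blocks q D \<times> UNIV. arrangement \<pi> (fst p) (snd p) = v}"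
      using r(2) by simp
  qed
  moreover have "inj_on (\<lambda>r. (inv (\<pi> i) (s, r), i)) {..<D}"
  proof (rule inj_onI)
    fix r r' assume "(inv (\<pi> i) (s, r), i) = (inv (\<pi> i) (s, r'), i)"
    hence "\<pi> i (inv (\<pi> i) (s, r)) = \<pi> i (inv (\<pi> i) (s, r'))" by simp
    thus "r = r'" by (simp add: permutes_inverses(1) [OF \<pi>])
  qed
  ultimately show ?thesis by (simp add: card_image)
qed

text \<open>
  The average over all arrangements is a positive multiple of a number closer to \<open>m!\<close> than \<open>0\<close> is, so
  some arrangement has a nonzero bracket.
\<close>

lemma large_multiples_have_invariants:
  assumes D: "D \<ge> 3"
  shows "\<exists>Q>0. \<forall>q\<ge>Q. even q \<longrightarrow>
    (\<exists>\<phi>. nonzero_invariant_of_degree (q * CARD('n)) (orbit_closure D (fermat D :: ('n::finite, complex) mpoly)) \<phi>) \<and>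
    (\<forall>g\<in>stab (fermat D :: ('n, complex) mpoly). det g ^ (q * D) = 1)"
proof -
  let ?m = "CARD('n)"
  define \<epsilon> where "\<epsilon> = (\<lambda>q. real ?m * ((1 + (\<Sum>k\<in>{1..q div 2}. row_term D q k)) ^ (?m - 1) - 1))"
  have "D > 0" using D by simp
  then obtain Q where Q: "Q > 0" "\<And>q. q \<ge> Q \<Longrightarrow> (real ?m + \<epsilon> q) ^ ?m - real ?m ^ ?m < fact ?m"
    using eventually_error_small [of D ?m] unfolding \<epsilon>_def by blast
  show ?thesis
  proof (intro exI [of _ Q] conjI allI impI Q(1))
    fix q assume q: "q \<ge> Q" "even q"
    have q0: "q > 0" using q(1) Q(1) by simp
    let ?J = "blocks q D" and ?V = "(UNIV :: 'n set) \<times> {..<q}"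
    define X where "X = (\<Sum>f\<in>(UNIV :: 'n set) \<rightarrow>\<^sub>E (UNIV <+> kernel_points q D).
      (\<Prod>i\<in>UNIV. extended_weight (kernel_weight q D) (f i)) *
      det (\<chi> i t. extended_point (kernel_point q D) (f i) $ t) ^ (q * D))"
    have "cmod (X - fact ?m) \<le> (real ?m + \<epsilon> q) ^ ?m - real ?m ^ ?m"
      unfolding X_def
    proof (rule det_power_average_close_to_fact)
      show "finite (kernel_points q D :: ((nat \<Rightarrow> 'n) \<times> ('n \<Rightarrow> nat)) set)" by (simp add: kernel_points_def)
      show "(\<Sum>p\<in>kernel_points q D. cmod (kernel_weight q D (p :: (nat \<Rightarrow> 'n) \<times> ('n \<Rightarrow> nat)))) \<le> \<epsilon> q"
        using sum_kernel_weight [OF q0, of D, where 'n = 'n] sum_row_weights_le [OF q0 D, where 'n = 'n]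
        unfolding \<epsilon>_def by (rule order_trans)
    qed (use q q0 D in \<open>simp_all add: kernel_point_norm\<close>)
    also have "\<dots> < fact ?m" by (rule Q(2) [OF q(1)])
    finally have "X \<noteq> 0" by (auto simp: norm_fact)
    hence "(\<Sum>\<pi>\<in>(UNIV :: 'n set) \<rightarrow>\<^sub>E {p. p permutes ?J}. bracket_value ?J ?V (arrangement \<pi>)) \<noteq> 0"
      unfolding sum_arrangements [OF q0, where 'n = 'n and D = D] X_def [symmetric] by simp
    then obtain \<pi> where \<pi>: "\<pi> \<in> (UNIV :: 'n set) \<rightarrow>\<^sub>E {p. p permutes ?J}" "bracket_value ?J ?V (arrangement \<pi>) \<noteq> 0"
      using sum.not_neutral_contains_not_neutral by blast
    have perm: "\<pi> i permutes ?J" for i using \<pi>(1) by (auto simp: PiE_UNIV_domain)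
    have in_V: "arrangement \<pi> j i \<in> ?V" if "j \<in> ?J" for j i
    proof -
      have "\<pi> i j \<in> ?J" using permutes_in_image [OF perm] that by blast
      thus ?thesis unfolding arrangement_def blocks_def mem_Times_iff by simp
    qed
    have V: "finite ?V" "card ?V = q * ?m" by (simp_all add: card_cartesian_product)
    note inv = bracket_invariant [OF finite_blocks V(1) in_V arrangement_degree [OF perm] \<pi>(2)]
    show "\<exists>\<phi>. nonzero_invariant_of_degree (q * ?m) (orbit_closure D (fermat D :: ('n, complex) mpoly)) \<phi>"
      using inv(1) unfolding V(2) .
    show "\<forall>g\<in>stab (fermat D :: ('n, complex) mpoly). det g ^ (q * D) = 1"
      using inv(2) by simp
  qed
qed

section \<open>Periods and minimal degrees\<close>

lemma minimal_degree_eqI: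
  fixes w :: "('n::finite, complex) mpoly"
  assumes "d > 0" "\<exists>\<phi>. nonzero_invariant_of_degree d (orbit_closure D w) \<phi>"
    and "\<And>d' \<phi>. nonzero_invariant_of_degree d' (orbit_closure D w) \<phi> \<Longrightarrow> d dvd d'"
  shows "minimal_degree D w = d"
  unfolding minimal_degree_def
proof (rule Least_equality)
  fix d' assume "0 < d' \<and> (\<exists>\<phi>. nonzero_invariant_of_degree d' (orbit_closure D w) \<phi>)"
  thus "d \<le> d'" using assms(3) dvd_imp_le by blast
qed (use assms in blast)

lemma fermat_even:
  assumes D: "even D" "D > 0"
  shows "degree_period D (fermat D :: ('n::finite, complex) mpoly) = of_nat CARD('n)"
    and "minimal_degree D (fermat D :: ('n, complex) mpoly) = CARD('n)"
proof -
  have deg: "card {p \<in> {..<D} \<times> (UNIV :: 'n set). (\<lambda>j i. i) (fst p) (snd p) = v} = D" for v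
    using card_bracket_degree_even [of D v] by simp
  have nz: "bracket_value {..<D} (UNIV :: 'n set) (\<lambda>j i. i) \<noteq> 0"
    using bracket_value_even [OF D, where 'n = 'n] by simp
  note inv = bracket_invariant [OF finite_lessThan finite_class.finite_UNIV UNIV_I deg nz]
  have stab: "det ` stab (fermat D :: ('n, complex) mpoly) = {z. z ^ (1 * D) = 1}"
    using det_stab_even [OF D(2), where 'n = 'n] inv(2) by simp
  show "degree_period D (fermat D :: ('n, complex) mpoly) = of_nat CARD('n)"
    using degree_period_fermat [OF D(2) _ stab] by simp
  show "minimal_degree D (fermat D :: ('n, complex) mpoly) = CARD('n)"
    by (rule minimal_degree_eqI [OF _ inv(1)])
       (use invariant_degree_dvd [OF _ D(2) _ stab] in simp_all)
qed

text \<open>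
  Two consecutive even numbers \<open>q\<close> and \<open>q + 2\<close> beyond the bound give
  \<open>det ^ (q D) = det ^ ((q + 2) D) = 1\<close> on the stabilizer, and \<open>det ^ (2 D)\<close> is the quotient.
\<close>

lemma det_stab_fermat_odd:
  assumes D: "odd D" "D \<ge> 3" and m: "CARD('n::finite) \<ge> 2"
  shows "det ` stab (fermat D :: ('n, complex) mpoly) = {z. z ^ (2 * D) = 1}"
proof (rule det_stab_odd [OF D(1) m])
  fix g assume g: "g \<in> stab (fermat D :: ('n, complex) mpoly)"
  obtain Q where Q: "\<And>q. q \<ge> Q \<Longrightarrow> even q \<Longrightarrow> det g ^ (q * D) = 1"
    using large_multiples_have_invariants [OF D(2), where 'n = 'n] g by blast
  have "det g ^ ((2 * Q + 2) * D) = det g ^ (2 * Q * D) * det g ^ (2 * D)"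
    by (simp only: distrib_right power_add)
  moreover have "det g ^ ((2 * Q + 2) * D) = 1" "det g ^ (2 * Q * D) = 1" by (rule Q; simp)+
  ultimately show "det g ^ (2 * D) = 1" by simp
qed

lemma no_invariant_of_double_degree:
  assumes D: "odd D" and m: "2 * CARD('n::finite) > (2 * D) choose D"
  shows "\<not> nonzero_invariant_of_degree (2 * CARD('n)) (orbit_closure D (fermat D :: ('n, complex) mpoly)) \<phi>"
proof
  assume inv: "nonzero_invariant_of_degree (2 * CARD('n)) (orbit_closure D (fermat D :: ('n, complex) mpoly)) \<phi>"
  have D0: "D > 0" using D by (rule odd_pos)
  let ?w = "fermat D :: ('n, complex) mpoly"
  obtain p where nz: "eval_at_form p ?w \<noteq> 0"
    and semi: "\<And>(g :: complex^'n^'n) t. det g \<noteq> 0 \<Longrightarrow> t ^ CARD('n) = det g \<Longrightarrow>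
       eval_at_form p (act g ?w) = t ^ (D * (2 * CARD('n))) * eval_at_form p ?w"
    and hom: "\<And>(g :: complex^'n^'n) t. det g \<noteq> 0 \<Longrightarrow> t \<noteq> 0 \<Longrightarrow>
       eval_at_form p (Const t * act g ?w) = t ^ (2 * CARD('n)) * eval_at_form p (act g ?w)"
    by (rule invariant_on_orbit [OF inv D0]) (rule that)
  have "eval_at_form p (act g ?w) = det g ^ (2 * D) * eval_at_form p ?w" if g: "det g \<noteq> 0" for g :: "complex^'n^'n"
  proof -
    obtain t where t: "t ^ CARD('n) = det g" using exists_root_power_card by blast
    have "t ^ (D * (2 * CARD('n))) = (t ^ CARD('n)) ^ (2 * D)"
      by (simp only: power_mult [symmetric] mult_ac)
    thus ?thesis using semi [OF g t] by (simp only: t)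
  qed
  from no_semiinvariant_of_double_degree [OF D m this hom] nz show False by blast
qed

theorem proposition3p24:
  fixes D :: nat and w :: "('n::finite, complex) mpoly"
  assumes "D \<ge> 2" and "CARD('n) \<ge> 2"
    and "w = (\<Sum>i\<in>UNIV. Var i ^ D)"
  shows "(even D \<longrightarrow>
            degree_period D w = of_nat CARD('n) \<and> minimal_degree D w = CARD('n)) \<and>
         (odd D \<longrightarrow>
            degree_period D w = of_nat (2 * CARD('n)) \<and>
            (2 * CARD('n) \<le> (2 * D) choose D \<longrightarrow> minimal_degree D w = 2 * CARD('n))) \<and>
         (odd D \<and> 2 * CARD('n) > (2 * D) choose D \<longrightarrow>
            minimal_degree D w > 2 * CARD('n)) \<and>
         (even D \<or> (odd D \<and> 2 * CARD('n) \<le> (2 * D) choose D) \<longrightarrow>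
            minimal_exponent D w = 1) \<and>
         (odd D \<and> 2 * CARD('n) > (2 * D) choose D \<longrightarrow>
            minimal_exponent D w > 1)"
proof -
  have w: "w = fermat D" using assms(3) by (simp add: fermat_def)
  have D0: "D > 0" using assms(1) by simp
  have even_case: "degree_period D w = of_nat CARD('n)" "minimal_degree D w = CARD('n)" if "even D"
    unfolding w using fermat_even [OF that D0, where 'n = 'n] by blast+
  have D3: "D \<ge> 3" if "odd D"
    using that assms(1) by (cases "D = 2") simp_all
  have stab: "det ` stab (fermat D :: ('n, complex) mpoly) = {z. z ^ (2 * D) = 1}" if "odd D"
    by (rule det_stab_fermat_odd [OF that D3 [OF that] assms(2)])
  have odd_period: "degree_period D w = of_nat (2 * CARD('n))" if "odd D"
    unfolding w by (rule degree_period_fermat [OF D0 _ stab [OF that]]) simp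
  have dvd: "2 * CARD('n) dvd d" if "odd D" "nonzero_invariant_of_degree d (orbit_closure D w) \<phi>" for d \<phi>
    using invariant_degree_dvd [OF _ D0 _ stab [OF that(1)]] that(2) unfolding w by simp
  have odd_small: "minimal_degree D w = 2 * CARD('n)" if D: "odd D" and m: "2 * CARD('n) \<le> (2 * D) choose D"
  proof -
    obtain A :: "'n \<Rightarrow> nat set" where A: "inj A" "\<And>i. A i \<subseteq> {..<2 * D}" "\<And>i. card (A i) = D" "\<And>i. 0 \<in> A i"
      by (rule choose_half_sets [OF D0 m]) (rule that)
    have deg: "card {p \<in> {..<2 * D} \<times> UNIV. (\<lambda>j i. (i, j \<in> A i)) (fst p) (snd p) = v} = D" for v
      using card_bracket_degree_halves [of A D v] A(2,3) by simp
    have nz: "bracket_value {..<2 * D} UNIV (\<lambda>j i. (i, j \<in> A i)) \<noteq> 0"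
      using bracket_value_halves [OF D0 A] by simp
    have "\<exists>\<phi>. nonzero_invariant_of_degree (card (UNIV :: ('n \<times> bool) set)) (orbit_closure D w) \<phi>"
      unfolding w by (rule bracket_invariant(1) [OF finite_lessThan finite_class.finite_UNIV UNIV_I deg nz])
    moreover have "card (UNIV :: ('n \<times> bool) set) = 2 * CARD('n)"
      by (simp add: card_cartesian_product flip: UNIV_Times_UNIV)
    ultimately have "\<exists>\<phi>. nonzero_invariant_of_degree (2 * CARD('n)) (orbit_closure D w) \<phi>" by (simp only:)
    thus ?thesis by (rule minimal_degree_eqI [rotated]) (use dvd [OF D] in simp_all)
  qed
  have odd_large: "minimal_degree D w > 2 * CARD('n)" if D: "odd D" and m: "2 * CARD('n) > (2 * D) choose D"
  proof -
    obtain Q where Q: "Q > 0" "\<And>q. q \<ge> Q \<Longrightarrow> even q \<Longrightarrow>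
        \<exists>\<phi>. nonzero_invariant_of_degree (q * CARD('n)) (orbit_closure D w) \<phi>"
      using large_multiples_have_invariants [OF D3 [OF D], where 'n = 'n] unfolding w by blast
    have "\<exists>d. 0 < d \<and> (\<exists>\<phi>. nonzero_invariant_of_degree d (orbit_closure D w) \<phi>)"
      using Q(1) Q(2) [of "2 * Q"] by (intro exI [of _ "2 * Q * CARD('n)"]) simp
    from LeastI_ex [OF this]
    have min: "0 < minimal_degree D w"
      "\<exists>\<phi>. nonzero_invariant_of_degree (minimal_degree D w) (orbit_closure D w) \<phi>"
      unfolding minimal_degree_def by blast+
    then obtain \<phi> where \<phi>: "nonzero_invariant_of_degree (minimal_degree D w) (orbit_closure D w) \<phi>" by blast
    have "2 * CARD('n) \<le> minimal_degree D w" using dvd [OF D \<phi>] min(1) by (rule dvd_imp_le)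
    moreover have "minimal_degree D w \<noteq> 2 * CARD('n)"
      using no_invariant_of_double_degree [OF D m] \<phi> unfolding w by metis
    ultimately show ?thesis by simp
  qed
  have exponent: "minimal_exponent D w = of_nat (minimal_degree D w) / degree_period D w"
    by (rule minimal_exponent_def)
  have "minimal_exponent D w = 1" if "even D \<or> (odd D \<and> 2 * CARD('n) \<le> (2 * D) choose D)"
    using that even_case odd_period odd_small assms(2) unfolding exponent by auto
  moreover have "minimal_exponent D w > 1" if D: "odd D" and m: "2 * CARD('n) > (2 * D) choose D"
  proof -
    have "of_nat (minimal_degree D w) > (of_nat (2 * CARD('n)) :: rat)"
      using odd_large [OF D m] by (simp only: of_nat_less_iff)
    moreover have "(of_nat (2 * CARD('n)) :: rat) > 0" by simp
    ultimately show ?thesis unfolding exponent odd_period [OF D] by (simp only: less_divide_eq_1_pos)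
  qed
  ultimately show ?thesis using even_case odd_period odd_small odd_large by blast
qed

end
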